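(* Let $X=\mathbb{R}^d$ and $\mathcal F=\mathscr H+\mathcal E_G-\mathcal E_H$ on $\mathcal P_2(X)$, and suppose the standing assumptions (i)--(iv) of the context hold with constant $\eta_0>0$. Suppose in addition that $H\in C^2(X)$ has uniformly bounded Hessian, and let $L_H$ be a Lipschitz constant of $\nabla H$. Let $\mathcal F^*$ be the optimal value of $\mathcal F$ and suppose $\mathcal F$ satisfies the Łojasiewicz condition of the context with parameters $(r_0,c,\theta)$. Let $0<\eta<\eta_0$, let $\mu_0\in\mathcal P_{2,\mathrm{abs}}(X)$ be such that $\mathcal F(\mu_0)-\mathcal F^*<r_0$, and let $(\mu_n)_{n\ge 0}$ be a sequence produced by the semi Forward-Backward Euler scheme $$\nu_{n+1}=(I+\eta\nabla H)_{\#}\mu_n,\qquad \mu_{n+1}\in \mathrm{JKO}_{\eta(\mathcal E_G+\mathscr H)}(\nu_{n+1}),\qquad n\ge 0.$$ Then: (i) if $\theta=0$, $\mathcal F(\mu_n)-\mathcal F^*$ converges to $0$ in a finite number of steps; (ii) if $\theta\in(0,1/2]$, $\mathcal F(\mu_n)-\mathcal F^*=O\left(\left(\frac{M}{M+1}\right)^n\right)$, where $M=\frac{2(\eta^2L_H^2+1)}{c^2\eta}$; (iii) if $\theta\in(1/2,1)$, $\mathcal F(\mu_n)-\mathcal F^*$ converges sublinearly to $0$, namely $\mathcal F(\mu_n)-\mathcal F^*=O\left(n^{-\frac{1}{2\theta-1}}\right)$.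
   Context: $X=\mathbb R^d$. $\mathcal P_2(X)$ is the set of Borel probability measures on $X$ with finite second moment, $W_2$ the 2-Wasserstein distance on it, and $\mathcal P_{2,\mathrm{abs}}(X)\subset\mathcal P_2(X)$ the subset of measures absolutely continuous with respect to Lebesgue measure. $\Gamma_o(\mu,\nu)$ is the set of optimal transport plans between $\mu$ and $\nu$ for the cost $\|x-y\|^2$. For $\mu\in\mathcal P_{2,\mathrm{abs}}(X)$ and $\nu\in\mathcal P_2(X)$, $T_\mu^\nu$ is the ($\mu$-a.e. unique) optimal transport map from $\mu$ to $\nu$. $T_\#\mu$ is the pushforward, $I$ the identity map, and $L^2(X,X,\mu)$ the Hilbert space of Borel maps $\xi:X\to X$ with norm $\|\xi\|_{L^2(X,X,\mu)}=(\int\|\xi\|^2d\mu)^{1/2}<\infty$. A function $f:X\to\mathbb R$ has quadratic growth if there is $a>0$ with $|f(x)|\le a(\|x\|^2+1)$ for all $x$. For such $f$, $\mathcal E_f(\mu):=\int f\,d\mu$ for $\mu\in\mathcal P_2(X)$. For $\phi:\mathcal P_2(X)\to\mathbb R\cup\{+\infty\}$: $\mathrm{dom}(\phi)=\{\mu:\phi(\mu)<+\infty\}$; $\phi$ is proper if $\mathrm{dom}(\phi)\ne\emptyset$; $\phi$ is l.s.c. if $\liminf_n\phi(\mu_n)\ge\phi(\mu)$ whenever $W_2(\mu_n,\mu)\to0$; $\phi$ is convex along generalized geodesics if for all $\mu,\pi\in\mathcal P_2(X)$, $\nu\in\mathcal P_{2,\mathrm{abs}}(X)$, $t\in[0,1]$,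 $\phi((tT_\nu^\mu+(1-t)T_\nu^\pi)_\#\nu)\le t\phi(\mu)+(1-t)\phi(\pi)$. Fréchet subdifferential: for $\mu\in\mathrm{dom}(\phi)$, $\xi\in L^2(X,X,\mu)$ belongs to $\partial_F^-\phi(\mu)$ if for all $\nu\in\mathcal P_2(X)$, $\phi(\nu)-\phi(\mu)\ge\sup_{\gamma\in\Gamma_o(\mu,\nu)}\int\langle\xi(x),y-x\rangle d\gamma(x,y)+o(W_2(\mu,\nu))$, where $o(s)/s\to0$ as $s\to 0$. JKO operator: $\mathrm{JKO}_{\eta\phi}(\mu):=\arg\min_{\nu\in\mathcal P_2(X)}\phi(\nu)+\frac1{2\eta}W_2^2(\mu,\nu)$ (set of minimizers). Standing assumptions: $F=G-H$ and $\mathcal F(\mu)=\mathcal E_F(\mu)+\mathscr H(\mu)=\mathcal E_G(\mu)-\mathcal E_H(\mu)+\mathscr H(\mu)$, where (i) $\mathcal F$ is bounded below; (ii) $G,H:X\to\mathbb R$ are convex and have quadratic growth; (iii) $\mathscr H:\mathcal P_2(X)\to\mathbb R\cup\{+\infty\}$ is proper, l.s.c., convex along generalized geodesics, and $\mathrm{dom}(\mathscr H)\subset\mathcal P_{2,\mathrm{abs}}(X)$; (iv) there is $\eta_0>0$ such that for all $\eta\in(0,\eta_0)$ and all $\mu\in\mathcal P_2(X)$, $\mathrm{JKO}_{\eta(\mathcal E_G+\mathscr H)}(\mu)\neq\emptyset$. Łojasiewicz condition with parameters $(r_0,c,\theta)$: $\mathcal F^*=\inf_{\mathcal P_2(X)}\mathcal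 F$ is the optimal value, $r_0\in(\mathcal F^*,+\infty]$, $\theta\in[0,1)$, $c>0$, and for all $\mu\in\mathcal P_2(X)$, $$\mathcal F(\mu)-\mathcal F^*<r_0\ \Rightarrow\ c(\mathcal F(\mu)-\mathcal F^* )^\theta\le\inf\{\|\xi\|_{L^2(X,X,\mu)}:\xi\in\partial_F^-\mathcal F(\mu)\},$$ with the conventions $0^0=0$ and $\inf\emptyset=+\infty$. *)

theory Defs
  imports "HOL-Probability.Probability" "HOL-Library.Landau_Symbols"
begin

section \<open>Wasserstein space\<close>

definition P2 :: "'a::euclidean_space measure set" where
  "P2 = {\<mu>. sets \<mu> = sets borel \<and> prob_space \<mu> \<and> integrable \<mu> (\<lambda>x. (norm x)\<^sup>2)}"

definition P2_abs :: "'a::euclidean_space measure set" where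
  "P2_abs = {\<mu> \<in> P2. absolutely_continuous lborel \<mu>}"

definition plans ::
  "'a::euclidean_space measure \<Rightarrow> 'a measure \<Rightarrow> ('a \<times> 'a) measure set" where
  "plans \<mu> \<nu> = {\<gamma>. sets \<gamma> = sets borel \<and> distr \<gamma> borel fst = \<mu> \<and> distr \<gamma> borel snd = \<nu>}"

text \<open>If both marginals are in \<^const>\<open>P2\<close>, the integrand below is integrable, so the Bochner
  integral is the genuine transport cost.\<close>

definition transport_cost :: "('a::euclidean_space \<times> 'a) measure \<Rightarrow> real" where
  "transport_cost \<gamma> = (\<integral>(x, y). (norm (x - y))\<^sup>2 \<partial>\<gamma>)"

definition W2 :: "'a::euclidean_space measure \<Rightarrow> 'a measure \<Rightarrow> real" where
  "W2 \<mu> \<nu> = sqrt (INF \<gamma> \<in> plans \<mu> \<nu>. transport_cost \<gamma>)"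

definition opt_plans ::
  "'a::euclidean_space measure \<Rightarrow> 'a measure \<Rightarrow> ('a \<times> 'a) measure set" where
  "opt_plans \<mu> \<nu> = {\<gamma>. is_arg_min transport_cost (\<lambda>\<gamma>. \<gamma> \<in> plans \<mu> \<nu>) \<gamma>}"

text \<open>Optimal transport maps are only unique almost everywhere, so they are given by a predicate
  that holds of every Borel representative.\<close>

definition is_opt_map ::
  "'a::euclidean_space measure \<Rightarrow> 'a measure \<Rightarrow> ('a \<Rightarrow> 'a) \<Rightarrow> bool" where
  "is_opt_map \<mu> \<nu> T \<longleftrightarrow>
     T \<in> borel_measurable borel \<and> distr \<mu> borel T = \<nu> \<and>
     distr \<mu> borel (\<lambda>x. (x, T x)) \<in> opt_plans \<mu> \<nu>"

definition L2 :: "'a::euclidean_space measure \<Rightarrow> ('a \<Rightarrow> 'a) set" where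
  "L2 \<mu> = {\<xi>. \<xi> \<in> borel_measurable borel \<and> integrable \<mu> (\<lambda>x. (norm (\<xi> x))\<^sup>2)}"

definition L2_norm_wrt :: "'a::euclidean_space measure \<Rightarrow> ('a \<Rightarrow> 'a) \<Rightarrow> real" where
  "L2_norm_wrt \<mu> \<xi> = sqrt (\<integral>x. (norm (\<xi> x))\<^sup>2 \<partial>\<mu>)"

section \<open>Functionals on the Wasserstein space\<close>

text \<open>Functionals \<open>\<phi> : P2 \<rightarrow> (-\<infinity>, \<infinity>]\<close> are functions from measures to \<^typ>\<open>ereal\<close>; only their
  values on \<^const>\<open>P2\<close> are ever used.\<close>

definition never_minf :: "('a::euclidean_space measure \<Rightarrow> ereal) \<Rightarrow> bool" where
  "never_minf \<phi> \<longleftrightarrow> (\<forall>\<mu> \<in> P2. \<phi> \<mu> \<noteq> -\<infinity>)"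

definition dom_fun :: "('a::euclidean_space measure \<Rightarrow> ereal) \<Rightarrow> 'a measure set" where
  "dom_fun \<phi> = {\<mu> \<in> P2. \<phi> \<mu> < \<infinity>}"

definition proper_fun :: "('a::euclidean_space measure \<Rightarrow> ereal) \<Rightarrow> bool" where
  "proper_fun \<phi> \<longleftrightarrow> dom_fun \<phi> \<noteq> {}"

definition lsc_W2 :: "('a::euclidean_space measure \<Rightarrow> ereal) \<Rightarrow> bool" where
  "lsc_W2 \<phi> \<longleftrightarrow>
     (\<forall>\<mu>s :: nat \<Rightarrow> 'a measure. \<forall>\<mu> \<in> P2.
        range \<mu>s \<subseteq> P2 \<longrightarrow> (\<lambda>n. W2 (\<mu>s n) \<mu>) \<longlonglongrightarrow> 0 \<longrightarrow>
        \<phi> \<mu> \<le> liminf (\<lambda>n. \<phi> (\<mu>s n)))"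

text \<open>For \<open>t \<in> {0, 1}\<close> the convention \<open>0 * \<infinity> = 0\<close> of \<^typ>\<open>ereal\<close> makes the inequality
  trivial.\<close>

definition gen_geodesically_convex :: "('a::euclidean_space measure \<Rightarrow> ereal) \<Rightarrow> bool" where
  "gen_geodesically_convex \<phi> \<longleftrightarrow>
     (\<forall>\<mu> \<in> P2. \<forall>\<pi> \<in> P2. \<forall>\<nu> \<in> P2_abs. \<forall>t \<in> {0..1}. \<forall>T S.
        is_opt_map \<nu> \<mu> T \<longrightarrow> is_opt_map \<nu> \<pi> S \<longrightarrow>
        \<phi> (distr \<nu> borel (\<lambda>x. t *\<^sub>R T x + (1 - t) *\<^sub>R S x))
          \<le> ereal t * \<phi> \<mu> + ereal (1 - t) * \<phi> \<pi>)"

definition bounded_below_fun :: "('a::euclidean_space measure \<Rightarrow> ereal) \<Rightarrow> bool" where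
  "bounded_below_fun \<phi> \<longleftrightarrow> (\<exists>m::real. \<forall>\<mu> \<in> P2. ereal m \<le> \<phi> \<mu>)"

definition optval :: "('a::euclidean_space measure \<Rightarrow> ereal) \<Rightarrow> ereal" where
  "optval \<phi> = (INF \<mu> \<in> P2. \<phi> \<mu>)"

text \<open>The remainder \<open>r\<close> is a function of the distance alone, uniform in \<open>\<nu>\<close>. The supremum is taken
  in \<^typ>\<open>ereal\<close>, so no boundedness is presupposed.\<close>

definition frechet_subdiff ::
  "('a::euclidean_space measure \<Rightarrow> ereal) \<Rightarrow> 'a measure \<Rightarrow> ('a \<Rightarrow> 'a) set" where
  "frechet_subdiff \<phi> \<mu> =
     {\<xi>. \<mu> \<in> dom_fun \<phi> \<and> \<xi> \<in> L2 \<mu> \<and>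
        (\<exists>r :: real \<Rightarrow> real. r \<in> o[at_right 0](\<lambda>s. s) \<and>
           (\<forall>\<nu> \<in> P2. \<phi> \<nu> - \<phi> \<mu> \<ge>
              (SUP \<gamma> \<in> opt_plans \<mu> \<nu>. ereal (\<integral>(x, y). \<xi> x \<bullet> (y - x) \<partial>\<gamma>))
              + ereal (r (W2 \<mu> \<nu>))))}"

definition jko ::
  "real \<Rightarrow> ('a::euclidean_space measure \<Rightarrow> ereal) \<Rightarrow> 'a measure \<Rightarrow> 'a measure set" where
  "jko \<eta> \<phi> \<mu> =
     {\<nu>. is_arg_min (\<lambda>\<nu>. \<phi> \<nu> + ereal (1 / (2 * \<eta>) * (W2 \<mu> \<nu>)\<^sup>2)) (\<lambda>\<nu>. \<nu> \<in> P2) \<nu>}"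

text \<open>Since \<open>0 powr 0 = 0\<close> and the infimum of the empty set in \<^typ>\<open>ereal\<close> is \<open>\<infinity>\<close>, both
  conventions \<open>0\<^sup>0 = 0\<close> and \<open>inf \<emptyset> = \<infinity>\<close> are built in. The gap is finite under the premise as soon
  as the optimal value is finite.\<close>

definition lojasiewicz ::
  "('a::euclidean_space measure \<Rightarrow> ereal) \<Rightarrow> ereal \<Rightarrow> real \<Rightarrow> real \<Rightarrow> bool" where
  "lojasiewicz \<phi> r0 c \<theta> \<longleftrightarrow>
     optval \<phi> < r0 \<and> 0 < c \<and> 0 \<le> \<theta> \<and> \<theta> < 1 \<and>
     (\<forall>\<mu> \<in> P2. \<phi> \<mu> - optval \<phi> < r0 \<longrightarrow>
        ereal (c * real_of_ereal (\<phi> \<mu> - optval \<phi>) powr \<theta>)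
          \<le> (INF \<xi> \<in> frechet_subdiff \<phi> \<mu>. ereal (L2_norm_wrt \<mu> \<xi>)))"

section \<open>The objective and its data\<close>

definition quadratic_growth :: "('a::euclidean_space \<Rightarrow> real) \<Rightarrow> bool" where
  "quadratic_growth f \<longleftrightarrow> (\<exists>a>0. \<forall>x. \<bar>f x\<bar> \<le> a * ((norm x)\<^sup>2 + 1))"

definition potential :: "('a::euclidean_space \<Rightarrow> real) \<Rightarrow> 'a measure \<Rightarrow> real" where
  "potential f \<mu> = (\<integral>x. f x \<partial>\<mu>)"

definition objective ::
  "('a::euclidean_space measure \<Rightarrow> ereal) \<Rightarrow> ('a \<Rightarrow> real) \<Rightarrow> ('a \<Rightarrow> real) \<Rightarrow> 'a measure \<Rightarrow> ereal" where
  "objective \<H> G H \<mu> = \<H> \<mu> + ereal (potential G \<mu>) - ereal (potential H \<mu>)"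

text \<open>\<open>H\<close> is \<open>C\<^sup>2\<close> with gradient \<open>gradH\<close> and a Hessian that is bounded in operator norm.\<close>

definition C2_bounded_hessian ::
  "('a::euclidean_space \<Rightarrow> real) \<Rightarrow> ('a \<Rightarrow> 'a) \<Rightarrow> bool" where
  "C2_bounded_hessian H gradH \<longleftrightarrow>
     (\<forall>x. GDERIV H x :> gradH x) \<and>
     (\<exists>hess :: 'a \<Rightarrow> 'a \<Rightarrow>\<^sub>L 'a.
        (\<forall>x. (gradH has_derivative blinfun_apply (hess x)) (at x)) \<and>
        continuous_on UNIV hess \<and> bounded (range hess))"

end

theory Submission
  imports Defs
begin

text \<open>
  One step of the scheme decreases the objective \<open>F\<close> by an amount that controls the squared norm of
  a Frechet subgradient at the new point. Let \<open>X \<sim> \<nu>\<close> be the point after the explicit step and let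
  \<open>Y = S X \<sim> \<mu>\<close>, where \<open>S\<close> inverts \<open>I + \<eta> \<nabla>H\<close>, so that \<open>X = Y + \<eta> \<nabla>H(Y)\<close>. As \<open>I + \<eta> \<nabla>H\<close> is the
  gradient of a convex function, \<open>S\<close> is an optimal map. Let \<open>Z = T X \<sim> m\<close> with \<open>T\<close> the optimal map
  from \<open>\<nu>\<close> to the JKO minimiser \<open>m\<close>. Moving along the generalized geodesic \<open>t Y + (1 - t) Z\<close> based
  at \<open>\<nu>\<close>, the JKO functional is strongly convex; minimality of \<open>m\<close>, together with the gradient
  inequality for \<open>H\<close>, gives
  \<open>F(m) + E|Y - Z|\<^sup>2 / \<eta> \<le> F(\<mu>)\<close>. The full strong convexity matters here: testing minimality of
  \<open>m\<close> against \<open>\<mu>\<close> alone would lose a factor of two, and with it the constant \<open>M\<close>.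

  If \<open>R\<close> is the optimal map from \<open>m\<close> back to \<open>\<nu>\<close>, then \<open>\<xi> = (R - I) / \<eta> - \<nabla>H\<close> is a Frechet
  subgradient of \<open>F\<close> at \<open>m\<close>. Since optimal plans starting from an absolutely continuous measure are
  unique, \<open>\<xi>(Z) = (X - Z) / \<eta> - \<nabla>H(Z) = (Y - Z) / \<eta> + \<nabla>H(Y) - \<nabla>H(Z)\<close>, whose squared norm is at most
  \<open>2 (1 / \<eta>\<^sup>2 + L\<^sup>2) E|Y - Z|\<^sup>2\<close>. Both facts are combined in \<open>semi_fb_step\<close>. With the Lojasiewicz
  inequality the gaps \<open>a n\<close> satisfy \<open>a (n + 1) powr (2 \<theta>) \<le> M (a n - a (n + 1))\<close>, and the three
  rates follow from this recursion of reals.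

  The argument needs optimal maps that exist exactly, since convexity along generalized geodesics
  speaks of nothing else. Most of the work below is therefore Brenier's theorem
  (\<open>optimal_map_exists_unique\<close>), proved from the dual side without compactness of measures.
  Minimising pairs \<open>(u, v)\<close> of the dual problem exist by a convexity argument in the style of
  Komlos: near-minimisers that in addition nearly minimise the strictly convex functional
  \<open>E exp(-u) + E exp(-v)\<close> converge almost everywhere (\<open>dual_minimiser_exists\<close>). Then \<open>u\<close> may be
  replaced by the Legendre transform of \<open>v\<close>. It is differentiable almost everywhere, because a
  convex function has only countably many kinks on each line (\<open>smooth_points_AE\<close>). Perturbing \<open>v\<close>
  to \<open>v + \<epsilon> h\<close> changes \<open>u\<close> at first order by \<open>-\<epsilon> h(\<nabla>u)\<close> (\<open>conj_fun_derivative\<close>), so minimality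
  says exactly that \<open>\<nabla>u\<close> pushes \<open>\<rho>\<close> to \<open>\<sigma>\<close>. Equality \<open>u(x) + v(y) = x \<bullet> y\<close> on the graph of \<open>\<nabla>u\<close>
  certifies optimality, and forces every optimal plan to sit on this graph.
\<close>

section \<open>Transport plans and optimal maps\<close>

lemma P2_sets: "\<mu> \<in> P2 \<Longrightarrow> sets \<mu> = sets borel"
  and P2_space: "\<mu> \<in> P2 \<Longrightarrow> space \<mu> = UNIV"
  and P2_prob: "\<mu> \<in> P2 \<Longrightarrow> prob_space \<mu>"
  and P2_integrable_norm_sq: "\<mu> \<in> P2 \<Longrightarrow> integrable \<mu> (\<lambda>x. (norm x)\<^sup>2)"
  by (auto simp: P2_def dest: sets_eq_imp_space_eq)

lemma P2_measurable: "\<mu> \<in> P2 \<Longrightarrow> measurable \<mu> N = measurable borel N"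
  by (simp add: P2_sets cong: measurable_cong_sets)

lemma P2_integrable:
  fixes f :: "'a::euclidean_space \<Rightarrow> 'b::{banach,second_countable_topology}"
  assumes "\<mu> \<in> P2" and f: "f \<in> borel_measurable borel"
    and bound: "\<And>x. norm (f x) \<le> a * ((norm x)\<^sup>2 + 1)"
  shows "integrable \<mu> f"
proof -
  interpret prob_space \<mu> using P2_prob[OF assms(1)] .
  have "integrable \<mu> (\<lambda>x. a * ((norm x)\<^sup>2 + 1))"
    using P2_integrable_norm_sq[OF assms(1)] by simp
  then show ?thesis
    by (rule Bochner_Integration.integrable_bound)
       (use f bound in \<open>auto simp: P2_measurable[OF assms(1)] intro: order_trans[OF _ abs_ge_self]\<close>)
qed

lemma distr_in_P2:
  fixes \<mu> :: "'a::euclidean_space measure" and f :: "'a \<Rightarrow> 'a"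
  assumes "prob_space \<kappa>" and f: "f \<in> borel_measurable \<kappa>"
    and "integrable \<kappa> (\<lambda>x. (norm (f x))\<^sup>2)"
  shows "distr \<kappa> borel f \<in> P2"
  using assms prob_space.prob_space_distr[OF assms(1) f]
  by (simp add: P2_def integrable_distr_eq)

lemma measurable_fst_borel: "sets \<gamma> = sets (borel :: ('a::euclidean_space \<times> 'a) measure) \<Longrightarrow> fst \<in> borel_measurable \<gamma>"
  and measurable_snd_borel: "sets \<gamma> = sets (borel :: ('a \<times> 'a) measure) \<Longrightarrow> snd \<in> borel_measurable \<gamma>"
  by (simp_all cong: measurable_cong_sets
        add: borel_measurable_continuous_onI continuous_on_fst continuous_on_snd continuous_on_id)

lemma norm_add_sq_le: "(norm (x + y))\<^sup>2 \<le> 2 * (norm x)\<^sup>2 + 2 * (norm y)\<^sup>2" for x y :: "'a::real_inner"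
  using zero_le_power2[of "norm (x - y)"]
  by (simp add: power2_norm_eq_inner inner_add_left inner_add_right inner_diff_left inner_diff_right inner_commute)

lemma norm_diff_sq_le: "(norm (x - y))\<^sup>2 \<le> 2 * (norm x)\<^sup>2 + 2 * (norm y)\<^sup>2" for x y :: "'a::real_inner"
  using norm_add_sq_le[of x "- y"] by simp

lemma abs_inner_le_norm_sq: "\<bar>x \<bullet> y\<bar> \<le> (norm x)\<^sup>2 + (norm y)\<^sup>2" for x y :: "'b::real_inner"
proof -
  have "\<bar>x \<bullet> y\<bar> \<le> norm x * norm y" by (rule Cauchy_Schwarz_ineq2)
  also have "\<dots> \<le> (norm x)\<^sup>2 + (norm y)\<^sup>2"
    using sum_squares_bound[of "norm x" "norm y"] mult_nonneg_nonneg[OF norm_ge_zero[of x] norm_ge_zero[of y]]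
    by linarith
  finally show ?thesis .
qed

lemma norm_diff_sq: "(norm (x - y))\<^sup>2 = (norm x)\<^sup>2 + (norm y)\<^sup>2 - 2 * (x \<bullet> y)" for x y :: "'b::real_inner"
  by (simp add: power2_norm_eq_inner inner_diff_left inner_diff_right inner_commute)

lemma transport_cost_nonneg: "0 \<le> transport_cost \<gamma>"
  by (simp add: transport_cost_def case_prod_beta integral_nonneg_AE)

context
  fixes \<mu> \<nu> :: "'a::euclidean_space measure" and \<gamma>
  assumes \<mu>: "\<mu> \<in> P2" and \<nu>: "\<nu> \<in> P2" and \<gamma>: "\<gamma> \<in> plans \<mu> \<nu>"
begin

lemma plan_sets: "sets \<gamma> = sets borel"
  using \<gamma> by (simp add: plans_def)

lemma plan_measurable: "measurable \<gamma> N = measurable borel N"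
  by (simp add: plan_sets cong: measurable_cong_sets)

lemma plan_fst [measurable]: "fst \<in> borel_measurable \<gamma>"
  and plan_snd [measurable]: "snd \<in> borel_measurable \<gamma>"
  by (rule measurable_fst_borel measurable_snd_borel, rule plan_sets)+

lemma plan_distr: "distr \<gamma> borel fst = \<mu>" "distr \<gamma> borel snd = \<nu>"
  using \<gamma> by (auto simp: plans_def)

lemma plan_prob: "prob_space \<gamma>"
proof -
  have "prob_space (distr \<gamma> borel fst)" using plan_distr P2_prob[OF \<mu>] by simp
  then show ?thesis by (rule prob_space_distrD[OF plan_fst])
qed

lemma plan_integral:
  fixes f :: "'a \<Rightarrow> 'b::{banach,second_countable_topology}"
  assumes "f \<in> borel_measurable borel"
  shows plan_integral_fst: "(\<integral>z. f (fst z) \<partial>\<gamma>) = (\<integral>x. f x \<partial>\<mu>)"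
    and plan_integral_snd: "(\<integral>z. f (snd z) \<partial>\<gamma>) = (\<integral>x. f x \<partial>\<nu>)"
  using assms integral_distr[OF plan_fst, of f] integral_distr[OF plan_snd, of f]
  by (simp_all add: plan_distr)

lemma plan_integrable_iff:
  fixes f :: "'a \<Rightarrow> 'b::{banach,second_countable_topology}"
  assumes "f \<in> borel_measurable borel"
  shows plan_integrable_fst: "integrable \<gamma> (\<lambda>z. f (fst z)) \<longleftrightarrow> integrable \<mu> f"
    and plan_integrable_snd: "integrable \<gamma> (\<lambda>z. f (snd z)) \<longleftrightarrow> integrable \<nu> f"
  using assms integrable_distr_eq[OF plan_fst, of f] integrable_distr_eq[OF plan_snd, of f]
  by (simp_all add: plan_distr)

lemma plan_integrable_fst_sq: "integrable \<gamma> (\<lambda>z. (norm (fst z))\<^sup>2)"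
  and plan_integrable_snd_sq: "integrable \<gamma> (\<lambda>z. (norm (snd z))\<^sup>2)"
  using P2_integrable_norm_sq[OF \<mu>] P2_integrable_norm_sq[OF \<nu>]
    plan_integrable_fst[of "\<lambda>x. (norm x)\<^sup>2"] plan_integrable_snd[of "\<lambda>x. (norm x)\<^sup>2"] by auto

lemma plan_integrable:
  fixes g :: "'a \<times> 'a \<Rightarrow> 'b::{banach,second_countable_topology}"
  assumes g: "g \<in> borel_measurable borel"
    and bound: "\<And>x y. norm (g (x, y)) \<le> a * ((norm x)\<^sup>2 + (norm y)\<^sup>2 + 1)"
  shows "integrable \<gamma> g"
proof -
  interpret prob_space \<gamma> by (rule plan_prob)
  have "integrable \<gamma> (\<lambda>z. (norm (fst z))\<^sup>2)" "integrable \<gamma> (\<lambda>z. (norm (snd z))\<^sup>2)"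
    by (rule plan_integrable_fst_sq plan_integrable_snd_sq)+
  then have "integrable \<gamma> (\<lambda>z. a * ((norm (fst z))\<^sup>2 + (norm (snd z))\<^sup>2 + 1))" by simp
  moreover have "norm (g z) \<le> norm (a * ((norm (fst z))\<^sup>2 + (norm (snd z))\<^sup>2 + 1))" for z
    using bound[of "fst z" "snd z"] by simp
  moreover have "g \<in> borel_measurable \<gamma>" using g by (simp add: plan_measurable)
  ultimately show ?thesis
    using Bochner_Integration.integrable_bound[of \<gamma> "\<lambda>z. a * ((norm (fst z))\<^sup>2 + (norm (snd z))\<^sup>2 + 1)" g] by blast
qed

lemma plan_integrable_inner: "integrable \<gamma> (\<lambda>z. fst z \<bullet> snd z)"
  by (rule plan_integrable[where a = 1])
     (auto intro!: order_trans[OF abs_inner_le_norm_sq] borel_measurable_continuous_onI continuous_intros)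

lemma transport_cost_eq:
  "transport_cost \<gamma> = (\<integral>x. (norm x)\<^sup>2 \<partial>\<mu>) + (\<integral>y. (norm y)\<^sup>2 \<partial>\<nu>) - 2 * (\<integral>z. fst z \<bullet> snd z \<partial>\<gamma>)"
proof -
  have i: "integrable \<gamma> (\<lambda>z. (norm (fst z))\<^sup>2)" "integrable \<gamma> (\<lambda>z. (norm (snd z))\<^sup>2)"
    by (rule plan_integrable_fst_sq plan_integrable_snd_sq)+
  have "transport_cost \<gamma> = (\<integral>z. (norm (fst z))\<^sup>2 + (norm (snd z))\<^sup>2 - 2 * (fst z \<bullet> snd z) \<partial>\<gamma>)"
    unfolding transport_cost_def case_prod_beta by (simp add: norm_diff_sq)
  also have "\<dots> = (\<integral>z. (norm (fst z))\<^sup>2 \<partial>\<gamma>) + (\<integral>z. (norm (snd z))\<^sup>2 \<partial>\<gamma>) - 2 * (\<integral>z. fst z \<bullet> snd z \<partial>\<gamma>)"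
    using i plan_integrable_inner by simp
  finally show ?thesis
    using plan_integral_fst[of "\<lambda>x. (norm x)\<^sup>2"] plan_integral_snd[of "\<lambda>x. (norm x)\<^sup>2"] by simp
qed

lemma plan_integrable_norm_sq: "integrable \<gamma> (\<lambda>z. (norm (fst z - snd z))\<^sup>2)"
proof -
  have i: "integrable \<gamma> (\<lambda>z. (norm (fst z))\<^sup>2)" "integrable \<gamma> (\<lambda>z. (norm (snd z))\<^sup>2)"
    by (rule plan_integrable_fst_sq plan_integrable_snd_sq)+
  show ?thesis using i plan_integrable_inner by (simp add: norm_diff_sq)
qed

lemma W2_sq_le: "(W2 \<mu> \<nu>)\<^sup>2 \<le> transport_cost \<gamma>"
proof -
  have "(INF \<gamma> \<in> plans \<mu> \<nu>. transport_cost \<gamma>) \<le> transport_cost \<gamma>"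
    by (rule cINF_lower[OF _ \<gamma>]) (auto intro!: bdd_belowI2 transport_cost_nonneg)
  moreover have "0 \<le> (INF \<gamma> \<in> plans \<mu> \<nu>. transport_cost \<gamma>)"
    by (rule cINF_greatest) (use \<gamma> transport_cost_nonneg in auto)
  ultimately show ?thesis by (simp add: W2_def)
qed

end

lemma opt_plansD:
  assumes "\<gamma> \<in> opt_plans \<mu> \<nu>"
  shows "\<gamma> \<in> plans \<mu> \<nu>" and "\<And>\<gamma>'. \<gamma>' \<in> plans \<mu> \<nu> \<Longrightarrow> transport_cost \<gamma> \<le> transport_cost \<gamma>'"
  using assms by (auto simp: opt_plans_def is_arg_min_linorder)

lemma W2_sq_opt:
  assumes "\<gamma> \<in> opt_plans \<mu> \<nu>"
  shows "(W2 \<mu> \<nu>)\<^sup>2 = transport_cost \<gamma>"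
proof -
  have "(INF \<gamma> \<in> plans \<mu> \<nu>. transport_cost \<gamma>) = transport_cost \<gamma>"
    by (rule cInf_eq_minimum) (use opt_plansD[OF assms] in auto)
  then show ?thesis by (simp add: W2_def transport_cost_nonneg)
qed

lemma plan_of_maps:
  fixes f g :: "'b \<Rightarrow> 'a::euclidean_space"
  assumes f [measurable]: "f \<in> borel_measurable \<kappa>" and g [measurable]: "g \<in> borel_measurable \<kappa>"
  shows "distr \<kappa> borel (\<lambda>x. (f x, g x)) \<in> plans (distr \<kappa> borel f) (distr \<kappa> borel g)"
proof -
  have m: "(\<lambda>x. (f x, g x)) \<in> borel_measurable \<kappa>" by measurable
  show ?thesis
    by (auto simp: plans_def distr_distr[OF measurable_fst_borel m] distr_distr[OF measurable_snd_borel m] o_def)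
qed

lemma transport_cost_of_maps:
  fixes f g :: "'b \<Rightarrow> 'a::euclidean_space"
  assumes f [measurable]: "f \<in> borel_measurable \<kappa>" and g [measurable]: "g \<in> borel_measurable \<kappa>"
  shows "transport_cost (distr \<kappa> borel (\<lambda>x. (f x, g x))) = (\<integral>x. (norm (f x - g x))\<^sup>2 \<partial>\<kappa>)"
  unfolding transport_cost_def case_prod_beta
  by (subst integral_distr) (auto intro!: borel_measurable_continuous_onI continuous_intros)

text \<open>Bounds of this form control \<^const>\<open>W2\<close> at the competitors in the JKO problem: writing the
  coupling as a pair of maps on a common space replaces the gluing of plans.\<close>
lemma W2_sq_le_maps:
  fixes f g :: "'b \<Rightarrow> 'a::euclidean_space"
  assumes "f \<in> borel_measurable \<kappa>" "g \<in> borel_measurable \<kappa>"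
    and "distr \<kappa> borel f \<in> P2" "distr \<kappa> borel g \<in> P2"
  shows "(W2 (distr \<kappa> borel f) (distr \<kappa> borel g))\<^sup>2 \<le> (\<integral>x. (norm (f x - g x))\<^sup>2 \<partial>\<kappa>)"
  using W2_sq_le[OF assms(3,4) plan_of_maps[OF assms(1,2)]] transport_cost_of_maps[OF assms(1,2)] by simp

lemma opt_plan_flip:
  assumes \<gamma>: "\<gamma> \<in> opt_plans \<mu> \<nu>"
  shows "distr \<gamma> borel (\<lambda>z. (snd z, fst z)) \<in> opt_plans \<nu> \<mu>"
proof -
  have flip: "distr \<gamma> borel (\<lambda>z. (snd z, fst z)) \<in> plans \<nu> \<mu>
      \<and> transport_cost (distr \<gamma> borel (\<lambda>z. (snd z, fst z))) = transport_cost \<gamma>"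
    if "\<gamma> \<in> plans \<mu> \<nu>" for \<mu> \<nu> \<gamma>
  proof -
    have s: "sets \<gamma> = sets borel" "distr \<gamma> borel fst = \<mu>" "distr \<gamma> borel snd = \<nu>" using that by (auto simp: plans_def)
    note m = measurable_fst_borel[OF s(1)] measurable_snd_borel[OF s(1)]
    show ?thesis
      using plan_of_maps[OF m(2,1)] transport_cost_of_maps[OF m(2,1)] s
      unfolding transport_cost_def case_prod_beta by (simp add: norm_minus_commute)
  qed
  show ?thesis
    unfolding opt_plans_def is_arg_min_linorder
    using flip[of _ \<mu> \<nu>] flip[of _ \<nu> \<mu>] opt_plansD[OF \<gamma>] by (auto, metis)
qed

lemma is_opt_mapD:
  assumes "is_opt_map \<mu> \<nu> T"
  shows "T \<in> borel_measurable borel" "distr \<mu> borel T = \<nu>" "distr \<mu> borel (\<lambda>x. (x, T x)) \<in> opt_plans \<mu> \<nu>"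
  using assms by (auto simp: is_opt_map_def)

lemma integrable_norm_sq_map:
  assumes "\<mu> \<in> P2" "T \<in> borel_measurable borel" "distr \<mu> borel T \<in> P2"
  shows "integrable \<mu> (\<lambda>x. (norm (T x))\<^sup>2)"
  using P2_integrable_norm_sq[OF assms(3)] assms(1,2) by (simp add: integrable_distr_eq P2_measurable)

lemma integrable_norm_diff_sq:
  fixes f g :: "'b \<Rightarrow> 'a::euclidean_space"
  assumes f: "f \<in> borel_measurable M" and g: "g \<in> borel_measurable M"
    and "integrable M (\<lambda>x. (norm (f x))\<^sup>2)" "integrable M (\<lambda>x. (norm (g x))\<^sup>2)"
  shows "integrable M (\<lambda>x. (norm (f x - g x))\<^sup>2)"
proof (rule Bochner_Integration.integrable_bound)
  show "integrable M (\<lambda>x. 2 * (norm (f x))\<^sup>2 + 2 * (norm (g x))\<^sup>2)" using assms by simp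
  show "(\<lambda>x. (norm (f x - g x))\<^sup>2) \<in> borel_measurable M" using f g by measurable
  show "AE x in M. norm ((norm (f x - g x))\<^sup>2) \<le> norm (2 * (norm (f x))\<^sup>2 + 2 * (norm (g x))\<^sup>2)"
    using norm_diff_sq_le by (intro AE_I2) simp
qed

lemma W2_sq_opt_map:
  assumes "\<mu> \<in> P2" "is_opt_map \<mu> \<nu> T"
  shows "(W2 \<mu> \<nu>)\<^sup>2 = (\<integral>x. (norm (x - T x))\<^sup>2 \<partial>\<mu>)"
  using W2_sq_opt[OF is_opt_mapD(3)[OF assms(2)]] transport_cost_of_maps[of "\<lambda>x. x" \<mu> T]
    is_opt_mapD(1)[OF assms(2)] by (simp add: P2_measurable[OF assms(1)])

lemma opt_map_flip:
  assumes "\<mu> \<in> P2" "is_opt_map \<mu> \<nu> T"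
  shows "distr \<mu> borel (\<lambda>x. (T x, x)) \<in> opt_plans \<nu> \<mu>"
    and "(W2 \<nu> \<mu>)\<^sup>2 = (\<integral>x. (norm (T x - x))\<^sup>2 \<partial>\<mu>)"
proof -
  have T: "T \<in> borel_measurable \<mu>" using is_opt_mapD(1)[OF assms(2)] by (simp add: P2_measurable[OF assms(1)])
  have pair: "(\<lambda>x. (x, T x)) \<in> borel_measurable \<mu>"
    unfolding P2_measurable[OF assms(1)] by (intro borel_measurable_Pair is_opt_mapD(1)[OF assms(2)]) simp
  have "(\<lambda>z. (snd z, fst z)) \<in> borel_measurable (borel :: ('a \<times> 'a) measure)"
    by (intro borel_measurable_continuous_onI continuous_intros)
  then have "distr (distr \<mu> borel (\<lambda>x. (x, T x))) borel (\<lambda>z. (snd z, fst z)) = distr \<mu> borel (\<lambda>x. (T x, x))"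
    using pair by (subst distr_distr) (auto simp: o_def)
  then show *: "distr \<mu> borel (\<lambda>x. (T x, x)) \<in> opt_plans \<nu> \<mu>"
    using opt_plan_flip[OF is_opt_mapD(3)[OF assms(2)]] by simp
  show "(W2 \<nu> \<mu>)\<^sup>2 = (\<integral>x. (norm (T x - x))\<^sup>2 \<partial>\<mu>)"
    using W2_sq_opt[OF *] transport_cost_of_maps[OF T, of "\<lambda>x. x"] by (simp add: P2_measurable[OF assms(1)])
qed

lemma quadratic_growth_integrable:
  assumes "quadratic_growth f" "continuous_on UNIV f" "\<mu> \<in> P2"
  shows "integrable \<mu> f"
proof -
  obtain a where "\<And>x. \<bar>f x\<bar> \<le> a * ((norm x)\<^sup>2 + 1)" using assms(1) by (auto simp: quadratic_growth_def)
  then show ?thesis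
    by (intro P2_integrable[OF assms(3), where a = a] borel_measurable_continuous_onI assms(2)) simp
qed

context
  fixes \<rho> \<sigma> :: "'a::euclidean_space measure" and u v :: "'a \<Rightarrow> real" and X Y
  assumes \<rho>: "\<rho> \<in> P2" and \<sigma>: "\<sigma> \<in> P2"
    and u: "integrable \<rho> u" and v: "integrable \<sigma> v"
    and X: "AE x in \<rho>. x \<in> X" and Y: "AE y in \<sigma>. y \<in> Y"
    and dual: "\<And>x y. x \<in> X \<Longrightarrow> y \<in> Y \<Longrightarrow> x \<bullet> y \<le> u x + v y"
begin

lemma fst_potential_measurable: "u \<in> borel_measurable borel" and snd_potential_measurable: "v \<in> borel_measurable borel"
  using borel_measurable_integrable[OF u] borel_measurable_integrable[OF v]
  by (simp_all add: P2_measurable \<rho> \<sigma>)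

lemma plan_dual_AE:
  assumes "\<gamma> \<in> plans \<rho> \<sigma>"
  shows "AE z in \<gamma>. 0 \<le> u (fst z) + v (snd z) - fst z \<bullet> snd z"
proof -
  have "AE z in \<gamma>. fst z \<in> X" "AE z in \<gamma>. snd z \<in> Y"
    using AE_distrD[OF plan_fst[OF \<rho> \<sigma> assms], of "\<lambda>x. x \<in> X", unfolded plan_distr[OF \<rho> \<sigma> assms]]
      AE_distrD[OF plan_snd[OF \<rho> \<sigma> assms], of "\<lambda>x. x \<in> Y", unfolded plan_distr[OF \<rho> \<sigma> assms]] X Y
    by blast+
  then show ?thesis by eventually_elim (simp add: dual)
qed

lemma plan_dual_gap:
  assumes \<gamma>: "\<gamma> \<in> plans \<rho> \<sigma>"
  shows "integrable \<gamma> (\<lambda>z. u (fst z) + v (snd z) - fst z \<bullet> snd z)"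
    and "(\<integral>z. u (fst z) + v (snd z) - fst z \<bullet> snd z \<partial>\<gamma>) = (\<integral>x. u x \<partial>\<rho>) + (\<integral>y. v y \<partial>\<sigma>) - (\<integral>z. fst z \<bullet> snd z \<partial>\<gamma>)"
proof -
  note p = \<rho> \<sigma> \<gamma>
  have i: "integrable \<gamma> (\<lambda>z. u (fst z))" "integrable \<gamma> (\<lambda>z. v (snd z))"
    using u v by (simp_all add: plan_integrable_fst[OF p fst_potential_measurable] plan_integrable_snd[OF p snd_potential_measurable])
  show "integrable \<gamma> (\<lambda>z. u (fst z) + v (snd z) - fst z \<bullet> snd z)"
    using i plan_integrable_inner[OF p] by simp
  show "(\<integral>z. u (fst z) + v (snd z) - fst z \<bullet> snd z \<partial>\<gamma>) = (\<integral>x. u x \<partial>\<rho>) + (\<integral>y. v y \<partial>\<sigma>) - (\<integral>z. fst z \<bullet> snd z \<partial>\<gamma>)"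
    using i plan_integrable_inner[OF p]
    by (simp add: plan_integral_fst[OF p fst_potential_measurable] plan_integral_snd[OF p snd_potential_measurable])
qed

text \<open>This is weak duality. As the marginals are fixed, transport cost and correlation
  \<open>\<integral> x \<bullet> y\<close> determine each other, and the correlation of a plan falls short of the dual
  cost by the integral of the nonnegative slack \<open>u x + v y - x \<bullet> y\<close>.\<close>
lemma plan_dual_gap_nonneg:
  assumes "\<gamma> \<in> plans \<rho> \<sigma>"
  shows "(\<integral>z. fst z \<bullet> snd z \<partial>\<gamma>) \<le> (\<integral>x. u x \<partial>\<rho>) + (\<integral>y. v y \<partial>\<sigma>)"
  using integral_nonneg_AE[OF plan_dual_AE[OF assms]] plan_dual_gap(2)[OF assms] by simp

text \<open>A plan on which the slack vanishes attains the bound of weak duality.\<close>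
lemma opt_plan_of_potentials:
  assumes \<gamma>: "\<gamma> \<in> plans \<rho> \<sigma>" and eq: "AE z in \<gamma>. u (fst z) + v (snd z) = fst z \<bullet> snd z"
  shows "\<gamma> \<in> opt_plans \<rho> \<sigma>"
proof -
  have "(\<integral>z. u (fst z) + v (snd z) - fst z \<bullet> snd z \<partial>\<gamma>) = 0"
    by (rule integral_eq_zero_AE) (use eq in eventually_elim, simp)
  then have *: "(\<integral>z. fst z \<bullet> snd z \<partial>\<gamma>) = (\<integral>x. u x \<partial>\<rho>) + (\<integral>y. v y \<partial>\<sigma>)"
    using plan_dual_gap(2)[OF \<gamma>] by simp
  show ?thesis
    unfolding opt_plans_def is_arg_min_linorder
    using \<gamma> plan_dual_gap_nonneg
    by (auto simp: transport_cost_eq[OF \<rho> \<sigma>] * algebra_simps) (smt (verit))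
qed

text \<open>Once one plan attains the bound, every optimal plan has zero integrated slack, hence zero
  slack almost everywhere. Uniqueness of optimal plans comes from here.\<close>
lemma opt_plan_equality:
  assumes \<gamma>: "\<gamma> \<in> plans \<rho> \<sigma>" and eq: "AE z in \<gamma>. u (fst z) + v (snd z) = fst z \<bullet> snd z"
    and \<gamma>': "\<gamma>' \<in> opt_plans \<rho> \<sigma>"
  shows "AE z in \<gamma>'. u (fst z) + v (snd z) = fst z \<bullet> snd z"
proof -
  note p = opt_plansD(1)[OF \<gamma>']
  have "(\<integral>z. u (fst z) + v (snd z) - fst z \<bullet> snd z \<partial>\<gamma>) = 0"
    by (rule integral_eq_zero_AE) (use eq in eventually_elim, simp)
  moreover have "transport_cost \<gamma>' \<le> transport_cost \<gamma>" by (rule opt_plansD(2)[OF \<gamma>' \<gamma>])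
  ultimately have "(\<integral>z. u (fst z) + v (snd z) - fst z \<bullet> snd z \<partial>\<gamma>') \<le> 0"
    using plan_dual_gap(2)[OF \<gamma>] plan_dual_gap(2)[OF p]
    by (simp add: transport_cost_eq[OF \<rho> \<sigma>] \<gamma> p)
  with integral_nonneg_AE[OF plan_dual_AE[OF p]]
  have "(\<integral>z. u (fst z) + v (snd z) - fst z \<bullet> snd z \<partial>\<gamma>') = 0" by simp
  with integral_nonneg_eq_0_iff_AE[OF plan_dual_gap(1)[OF p] plan_dual_AE[OF p]]
  show ?thesis by auto
qed

end

section \<open>Existence of Kantorovich potentials\<close>

text \<open>The increments have summable \<open>L\<^sup>1\<close> norms, so the telescoping series converges absolutely
  almost everywhere.\<close>
lemma AE_convergent_of_fast_L2_Cauchy: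
  fixes f :: "nat \<Rightarrow> 'a \<Rightarrow> real"
  assumes "prob_space M" and f [measurable]: "\<And>k. f k \<in> borel_measurable M"
    and int: "\<And>k. integrable M (\<lambda>x. (f (Suc k) x - f k x)\<^sup>2)"
    and le: "\<And>k. (\<integral>x. (f (Suc k) x - f k x)\<^sup>2 \<partial>M) \<le> (1 / 4) ^ k"
  shows "AE x in M. convergent (\<lambda>k. f k x)"
proof -
  interpret prob_space M by fact
  \<comment> \<open>The weight \<open>2 ^ k\<close> balances the bound \<open>(1 / 4) ^ k\<close> on the squares.\<close>
  have young: "\<bar>t\<bar> \<le> 2 ^ k * t\<^sup>2 + (1 / 2) ^ k" for t :: real and k
  proof -
    have "2 * \<bar>t\<bar> = 2 * (2 ^ k * \<bar>t\<bar>) * (1 / 2) ^ k"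
      by (simp add: power_divide)
    also have "2 * (2 ^ k * \<bar>t\<bar>) * (1 / 2) ^ k \<le> ((2 ^ k * \<bar>t\<bar>)\<^sup>2 + 1) * (1 / 2) ^ k"
      using sum_squares_bound[of "2 ^ k * \<bar>t\<bar>" 1] by (intro mult_right_mono) auto
    also have "\<dots> = 2 ^ k * t\<^sup>2 + (1 / 2) ^ k"
      by (simp add: power2_eq_square field_simps)
    finally show ?thesis by linarith
  qed
  have nn: "(\<integral>\<^sup>+x. ennreal \<bar>f (Suc k) x - f k x\<bar> \<partial>M) \<le> ennreal (2 * (1 / 2) ^ k)" for k
  proof -
    have "(\<integral>\<^sup>+x. ennreal \<bar>f (Suc k) x - f k x\<bar> \<partial>M) \<le> (\<integral>\<^sup>+x. ennreal (2 ^ k * (f (Suc k) x - f k x)\<^sup>2 + (1 / 2) ^ k) \<partial>M)"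
      by (intro nn_integral_mono ennreal_leI young)
    also have "\<dots> = ennreal (\<integral>x. 2 ^ k * (f (Suc k) x - f k x)\<^sup>2 + (1 / 2) ^ k \<partial>M)"
      using int by (intro nn_integral_eq_integral) auto
    also have "(\<integral>x. 2 ^ k * (f (Suc k) x - f k x)\<^sup>2 + (1 / 2) ^ k \<partial>M)
        = 2 ^ k * (\<integral>x. (f (Suc k) x - f k x)\<^sup>2 \<partial>M) + (1 / 2) ^ k"
      using int by (simp add: prob_space)
    also have "\<dots> \<le> 2 ^ k * (1 / 4) ^ k + (1 / 2) ^ k"
      using le[of k] by simp
    also have "\<dots> = 2 * (1 / 2) ^ k"
      by (simp add: power_mult_distrib[symmetric])
    finally show ?thesis by (simp add: ennreal_leI)
  qed
  have "(\<integral>\<^sup>+x. (\<Sum>k. ennreal \<bar>f (Suc k) x - f k x\<bar>) \<partial>M) = (\<Sum>k. \<integral>\<^sup>+x. ennreal \<bar>f (Suc k) x - f k x\<bar> \<partial>M)"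
    by (intro nn_integral_suminf) measurable
  also have "\<dots> \<le> (\<Sum>k. ennreal (2 * (1 / 2) ^ k))"
    by (intro suminf_le nn) auto
  also have "\<dots> = ennreal (\<Sum>k. 2 * (1 / 2) ^ k)"
    by (intro suminf_ennreal2 summable_mult summable_geometric) auto
  finally have "(\<integral>\<^sup>+x. (\<Sum>k. ennreal \<bar>f (Suc k) x - f k x\<bar>) \<partial>M) \<noteq> \<infinity>"
    by (auto simp: top_unique)
  then have "AE x in M. (\<Sum>k. ennreal \<bar>f (Suc k) x - f k x\<bar>) \<noteq> \<infinity>"
    by (intro nn_integral_PInf_AE) auto
  then show ?thesis
  proof eventually_elim
    case (elim x)
    then have "summable (\<lambda>k. \<bar>f (Suc k) x - f k x\<bar>)"
      by (intro summable_suminf_not_top) auto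
    then have "summable (\<lambda>k. f (Suc k) x - f k x)" by (rule summable_rabs_cancel)
    then have "convergent (\<lambda>n. \<Sum>k<n. f (Suc k) x - f k x)" by (simp add: summable_iff_convergent)
    then have "convergent (\<lambda>n. f n x - f 0 x)"
      by (simp only: sum_lessThan_telescope[of "\<lambda>k. f k x"])
    then show ?case using convergent_add[OF _ convergent_const, of "\<lambda>n. f n x - f 0 x" "f 0 x"] by simp
  qed
qed

lemma integrable_limit_Fatou:
  fixes f :: "nat \<Rightarrow> 'a \<Rightarrow> real"
  assumes int: "\<And>k. integrable M (f k)" and nonneg: "\<And>k x. 0 \<le> f k x"
    and g [measurable]: "g \<in> borel_measurable M" and lim: "AE x in M. (\<lambda>k. f k x) \<longlonglongrightarrow> g x"
    and le: "\<And>k. (\<integral>x. f k x \<partial>M) \<le> \<alpha> k" and \<alpha>: "\<alpha> \<longlonglongrightarrow> l"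
  shows "integrable M g" and "(\<integral>x. g x \<partial>M) \<le> l"
proof -
  have g0: "AE x in M. 0 \<le> g x"
    using lim by eventually_elim (auto intro: LIMSEQ_le_const nonneg)
  have \<alpha>0: "0 \<le> \<alpha> k" for k using order_trans[OF Bochner_Integration.integral_nonneg le[of k]] nonneg by simp
  then have l0: "0 \<le> l" using \<alpha> by (auto intro: LIMSEQ_le_const)
  have "(\<integral>\<^sup>+x. ennreal (g x) \<partial>M) = (\<integral>\<^sup>+x. liminf (\<lambda>k. ennreal (f k x)) \<partial>M)"
    by (rule nn_integral_cong_AE, use lim in eventually_elim)
       (rule lim_imp_Liminf[symmetric, OF sequentially_bot tendsto_ennrealI])
  also have "\<dots> \<le> liminf (\<lambda>k. \<integral>\<^sup>+x. ennreal (f k x) \<partial>M)"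
    by (rule nn_integral_liminf) (use int in auto)
  also have "\<dots> \<le> liminf (\<lambda>k. ennreal (\<alpha> k))"
    by (intro Liminf_mono always_eventually allI, subst nn_integral_eq_integral)
       (use int nonneg le in \<open>auto intro!: ennreal_leI\<close>)
  also have "\<dots> = ennreal l"
    using \<alpha> by (intro lim_imp_Liminf tendsto_ennrealI) auto
  finally have *: "(\<integral>\<^sup>+x. ennreal (g x) \<partial>M) \<le> ennreal l" .
  then show ig: "integrable M g"
    by (intro integrableI_nonneg g0 g) (auto simp: less_top[symmetric] top_unique)
  have "ennreal (\<integral>x. g x \<partial>M) \<le> ennreal l"
    using * nn_integral_eq_integral[OF ig g0] by simp
  then show "(\<integral>x. g x \<partial>M) \<le> l" using l0 by simp
qed

text \<open>The constraint is only asked on a product of sets of full measure. In this form it passes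
  to almost everywhere limits without any redefinition on null sets.\<close>
definition dual_feasible ::
  "'a measure \<Rightarrow> 'b measure \<Rightarrow> ('a \<Rightarrow> 'b \<Rightarrow> real) \<Rightarrow> ('a \<Rightarrow> real) \<Rightarrow> ('b \<Rightarrow> real) \<Rightarrow> bool" where
  "dual_feasible \<rho> \<sigma> c u v \<longleftrightarrow> integrable \<rho> u \<and> integrable \<sigma> v \<and>
     (\<exists>X Y. (AE x in \<rho>. x \<in> X) \<and> (AE y in \<sigma>. y \<in> Y) \<and> (\<forall>x\<in>X. \<forall>y\<in>Y. c x y \<le> u x + v y))"

definition dual_cost :: "'a measure \<Rightarrow> 'b measure \<Rightarrow> ('a \<Rightarrow> real) \<Rightarrow> ('b \<Rightarrow> real) \<Rightarrow> real" where
  "dual_cost \<rho> \<sigma> u v = (\<integral>x. u x \<partial>\<rho>) + (\<integral>y. v y \<partial>\<sigma>)"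

lemma dual_feasible_mid:
  assumes "dual_feasible \<rho> \<sigma> c u v" "dual_feasible \<rho> \<sigma> c u' v'"
  shows "dual_feasible \<rho> \<sigma> c (\<lambda>x. (u x + u' x) / 2) (\<lambda>y. (v y + v' y) / 2)"
    and "dual_cost \<rho> \<sigma> (\<lambda>x. (u x + u' x) / 2) (\<lambda>y. (v y + v' y) / 2)
       = (dual_cost \<rho> \<sigma> u v + dual_cost \<rho> \<sigma> u' v') / 2"
proof -
  from assms obtain X Y X' Y' where
    "AE x in \<rho>. x \<in> X" "AE y in \<sigma>. y \<in> Y" and 1: "\<And>x y. x \<in> X \<Longrightarrow> y \<in> Y \<Longrightarrow> c x y \<le> u x + v y"
    and "AE x in \<rho>. x \<in> X'" "AE y in \<sigma>. y \<in> Y'" and 2: "\<And>x y. x \<in> X' \<Longrightarrow> y \<in> Y' \<Longrightarrow> c x y \<le> u' x + v' y"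
    unfolding dual_feasible_def by blast
  then have "AE x in \<rho>. x \<in> X \<inter> X'" "AE y in \<sigma>. y \<in> Y \<inter> Y'" by auto
  moreover have "c x y \<le> (u x + u' x) / 2 + (v y + v' y) / 2" if "x \<in> X \<inter> X'" "y \<in> Y \<inter> Y'" for x y
    using 1[of x y] 2[of x y] that by (simp add: field_simps)
  ultimately show "dual_feasible \<rho> \<sigma> c (\<lambda>x. (u x + u' x) / 2) (\<lambda>y. (v y + v' y) / 2)"
    using assms unfolding dual_feasible_def
    by (intro conjI exI[of _ "X \<inter> X'"] exI[of _ "Y \<inter> Y'"]) auto
  show "dual_cost \<rho> \<sigma> (\<lambda>x. (u x + u' x) / 2) (\<lambda>y. (v y + v' y) / 2)
       = (dual_cost \<rho> \<sigma> u v + dual_cost \<rho> \<sigma> u' v') / 2"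
    using assms by (simp add: dual_cost_def dual_feasible_def add_divide_distrib)
qed

text \<open>Fatou's lemma gives the cost of the limit, but only for each of the two integrals. Along a
  subsequence the first integral converges to some \<open>l\<close>, which leaves \<open>J - l\<close> for the second.\<close>
lemma dual_feasible_limit:
  assumes feas: "\<And>k. dual_feasible \<rho> \<sigma> c (u k) (v k)"
    and u0: "\<And>k x. 0 \<le> u k x" and v0: "\<And>k y. 0 \<le> v k y"
    and u: "AE x in \<rho>. convergent (\<lambda>k. u k x)" and v: "AE y in \<sigma>. convergent (\<lambda>k. v k y)"
    and cost: "\<And>k. dual_cost \<rho> \<sigma> (u k) (v k) \<le> \<alpha> k" and \<alpha>: "\<alpha> \<longlonglongrightarrow> J"
  shows "\<exists>u' v'. dual_feasible \<rho> \<sigma> c u' v' \<and> dual_cost \<rho> \<sigma> u' v' \<le> J"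
proof -
  define u' where "u' x = lim (\<lambda>k. u k x)" for x
  define v' where "v' y = lim (\<lambda>k. v k y)" for y
  have iu: "integrable \<rho> (u k)" and iv: "integrable \<sigma> (v k)" for k
    using feas[of k] by (auto simp: dual_feasible_def)
  have [measurable]: "u k \<in> borel_measurable \<rho>" "v k \<in> borel_measurable \<sigma>" for k
    using iu iv by auto
  have u'm: "u' \<in> borel_measurable \<rho>" and v'm: "v' \<in> borel_measurable \<sigma>"
    unfolding u'_def v'_def by measurable
  have lu: "AE x in \<rho>. (\<lambda>k. u k x) \<longlonglongrightarrow> u' x" and lv: "AE y in \<sigma>. (\<lambda>k. v k y) \<longlonglongrightarrow> v' y"
    using u v by (simp_all add: u'_def v'_def convergent_LIMSEQ_iff)
  define a where "a k = (\<integral>x. u k x \<partial>\<rho>)" for k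
  obtain C where C: "\<And>k. \<alpha> k \<le> C"
    using convergent_imp_Bseq[OF convergentI[OF \<alpha>]] unfolding Bseq_def real_norm_def abs_le_iff by blast
  have nn: "0 \<le> a k" "0 \<le> (\<integral>y. v k y \<partial>\<sigma>)" for k
    using u0 v0 by (simp_all add: a_def)
  have ac: "a k + (\<integral>y. v k y \<partial>\<sigma>) \<le> \<alpha> k" for k
    using cost[of k] by (simp add: dual_cost_def a_def)
  have "bounded (range a)"
  proof (rule boundedI)
    show "norm x \<le> C" if "x \<in> range a" for x
    proof -
      obtain k where "x = a k" using \<open>x \<in> range a\<close> by blast
      then show ?thesis using nn(1)[of k] nn(2)[of k] ac[of k] C[of k] by simp
    qed
  qed
  then obtain l s where s: "strict_mono s" and l: "(a \<circ> s) \<longlonglongrightarrow> l"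
    using bounded_imp_convergent_subsequence by blast
  have "integrable \<rho> u'" and cu: "(\<integral>x. u' x \<partial>\<rho>) \<le> l"
  proof -
    have lim: "AE x in \<rho>. (\<lambda>k. u (s k) x) \<longlonglongrightarrow> u' x"
      using lu by eventually_elim (use LIMSEQ_subseq_LIMSEQ[OF _ s] in \<open>simp add: o_def\<close>)
    have "(\<integral>x. u (s k) x \<partial>\<rho>) \<le> (a \<circ> s) k" for k by (simp add: a_def)
    note F = integrable_limit_Fatou[OF iu u0 u'm lim this l]
    show "integrable \<rho> u'" "(\<integral>x. u' x \<partial>\<rho>) \<le> l" by (fact F)+
  qed
  moreover have "integrable \<sigma> v'" and cv: "(\<integral>y. v' y \<partial>\<sigma>) \<le> J - l"
  proof -
    have lim: "AE y in \<sigma>. (\<lambda>k. v (s k) y) \<longlonglongrightarrow> v' y"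
      using lv by eventually_elim (use LIMSEQ_subseq_LIMSEQ[OF _ s] in \<open>simp add: o_def\<close>)
    have le: "(\<integral>y. v (s k) y \<partial>\<sigma>) \<le> (\<alpha> \<circ> s) k - (a \<circ> s) k" for k
      using ac[of "s k"] by simp
    have "(\<lambda>k. (\<alpha> \<circ> s) k - (a \<circ> s) k) \<longlonglongrightarrow> J - l"
      using LIMSEQ_subseq_LIMSEQ[OF \<alpha> s] l by (intro tendsto_diff)
    note F = integrable_limit_Fatou[OF iv v0 v'm lim le this]
    show "integrable \<sigma> v'" "(\<integral>y. v' y \<partial>\<sigma>) \<le> J - l" by (fact F)+
  qed
  moreover have "\<exists>X Y. (AE x in \<rho>. x \<in> X) \<and> (AE y in \<sigma>. y \<in> Y) \<and> (\<forall>x\<in>X. \<forall>y\<in>Y. c x y \<le> u' x + v' y)"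
  proof -
    have "\<forall>k. \<exists>X Y. (AE x in \<rho>. x \<in> X) \<and> (AE y in \<sigma>. y \<in> Y) \<and> (\<forall>x\<in>X. \<forall>y\<in>Y. c x y \<le> u k x + v k y)"
      using feas by (auto simp: dual_feasible_def)
    then obtain X Y where XY: "\<And>k. AE x in \<rho>. x \<in> X k" "\<And>k. AE y in \<sigma>. y \<in> Y k"
      "\<And>k x y. x \<in> X k \<Longrightarrow> y \<in> Y k \<Longrightarrow> c x y \<le> u k x + v k y" by metis
    define X' where "X' = {x. (\<forall>k. x \<in> X k) \<and> (\<lambda>k. u k x) \<longlonglongrightarrow> u' x}"
    define Y' where "Y' = {y. (\<forall>k. y \<in> Y k) \<and> (\<lambda>k. v k y) \<longlonglongrightarrow> v' y}"
    have "AE x in \<rho>. x \<in> X'" "AE y in \<sigma>. y \<in> Y'"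
      using XY(1,2) lu lv by (auto simp: X'_def Y'_def AE_all_countable)
    moreover have "c x y \<le> u' x + v' y" if "x \<in> X'" "y \<in> Y'" for x y
    proof (rule LIMSEQ_le_const)
      show "(\<lambda>k. u k x + v k y) \<longlonglongrightarrow> u' x + v' y"
        using that by (intro tendsto_add) (auto simp: X'_def Y'_def)
      show "\<exists>N. \<forall>k\<ge>N. c x y \<le> u k x + v k y"
        using that XY(3) by (auto simp: X'_def Y'_def)
    qed
    ultimately show ?thesis by blast
  qed
  ultimately show ?thesis
    unfolding dual_feasible_def dual_cost_def by (intro exI[of _ u'] exI[of _ v']) auto
qed

text \<open>Convergence of \<open>exp (- a k / 2)\<close> allows \<open>a k\<close> to tend to infinity; finiteness of the limes
  inferior, which Fatou's lemma provides, excludes this.\<close>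
lemma convergent_of_exp:
  fixes a :: "nat \<Rightarrow> real"
  assumes "convergent (\<lambda>k. exp (- a k / 2))" "liminf (\<lambda>k. ennreal (a k)) \<noteq> \<infinity>"
  shows "convergent a"
proof -
  obtain l where l: "(\<lambda>k. exp (- a k / 2)) \<longlonglongrightarrow> l" using assms(1) by (auto simp: convergent_def)
  have "l \<noteq> 0"
  proof
    assume "l = 0"
    have "filterlim a at_top sequentially"
      unfolding filterlim_at_top
    proof
      fix Z :: real
      have "eventually (\<lambda>k. exp (- a k / 2) < exp (- Z / 2)) sequentially"
        using l \<open>l = 0\<close> by (intro order_tendstoD) auto
      then show "eventually (\<lambda>k. Z \<le> a k) sequentially" by eventually_elim simp
    qed
    then have "(\<lambda>k. ennreal (a k)) \<longlonglongrightarrow> \<infinity>"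
      by (simp add: ennreal_tendsto_top_eq_at_top)
    then show False using assms(2) lim_imp_Liminf[OF sequentially_bot] by blast
  qed
  then have "(\<lambda>k. - 2 * ln (exp (- a k / 2))) \<longlonglongrightarrow> - 2 * ln l"
    by (intro tendsto_intros l)
  then show ?thesis by (auto simp: convergent_def)
qed

text \<open>
  A minimising sequence need not converge, and there is no weak compactness for functions that are
  only bounded in \<open>L\<^sup>1\<close>. But the sets \<open>K n\<close> of feasible pairs with cost at most \<open>J + 1 / (n + 1)\<close>
  are nested and closed under midpoints. Choosing \<open>p n\<close> in \<open>K n\<close> almost minimal for
  \<open>E = \<integral> exp (- a) + \<integral> exp (- b)\<close>, the identity
  \<open>(exp (- s / 2) - exp (- t / 2))\<^sup>2 = exp (- s) + exp (- t) - 2 exp (- (s + t) / 2)\<close>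
  turns the comparison of \<open>E\<close> at \<open>p m\<close>, \<open>p n\<close> and their midpoint into a Cauchy estimate in \<open>L\<^sup>2\<close>,
  much as the parallelogram law does for projections onto convex sets.
\<close>
proposition dual_minimiser_exists:
  fixes c :: "'a \<Rightarrow> 'b \<Rightarrow> real"
  assumes "prob_space \<rho>" "prob_space \<sigma>"
    and feas0: "dual_feasible \<rho> \<sigma> c a0 b0" "\<And>x. 0 \<le> a0 x" "\<And>y. 0 \<le> b0 y"
  shows "\<exists>a b. dual_feasible \<rho> \<sigma> c a b \<and>
    (\<forall>a' b'. dual_feasible \<rho> \<sigma> c a' b' \<longrightarrow> (\<forall>x. 0 \<le> a' x) \<longrightarrow> (\<forall>y. 0 \<le> b' y) \<longrightarrow>
       dual_cost \<rho> \<sigma> a b \<le> dual_cost \<rho> \<sigma> a' b')"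
proof -
  interpret \<rho>: prob_space \<rho> by fact
  interpret \<sigma>: prob_space \<sigma> by fact
  define F where "F = {p. dual_feasible \<rho> \<sigma> c (fst p) (snd p) \<and> (\<forall>x. 0 \<le> fst p x) \<and> (\<forall>y. 0 \<le> snd p y)}"
  define cost where "cost p = dual_cost \<rho> \<sigma> (fst p) (snd p)" for p :: "('a \<Rightarrow> real) \<times> ('b \<Rightarrow> real)"
  define mid :: "('a \<Rightarrow> real) \<times> ('b \<Rightarrow> real) \<Rightarrow> _ \<Rightarrow> ('a \<Rightarrow> real) \<times> ('b \<Rightarrow> real)"
    where "mid p q = ((\<lambda>x. (fst p x + fst q x) / 2), (\<lambda>y. (snd p y + snd q y) / 2))" for p q
  define J where "J = Inf (cost ` F)"
  define K where "K n = {p \<in> F. cost p \<le> J + 1 / Suc n}" for n :: nat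
  define E where "E p = (\<integral>x. exp (- fst p x) \<partial>\<rho>) + (\<integral>y. exp (- snd p y) \<partial>\<sigma>)" for p :: "('a \<Rightarrow> real) \<times> ('b \<Rightarrow> real)"
  define I where "I n = Inf (E ` K n)" for n
  have F0: "F \<noteq> {}" using feas0 by (auto simp: F_def intro!: exI[of _ "(a0, b0)"])
  have cost0: "0 \<le> cost p" if "p \<in> F" for p using that by (auto simp: cost_def dual_cost_def F_def intro!: add_nonneg_nonneg)
  have bdd: "bdd_below (cost ` F)" using cost0 by (auto intro!: bdd_belowI2)
  have J_le: "J \<le> cost p" if "p \<in> F" for p unfolding J_def using bdd that by (rule cINF_lower)
  have midF: "mid p q \<in> F" "cost (mid p q) = (cost p + cost q) / 2" if "p \<in> F" "q \<in> F" for p q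
    using that dual_feasible_mid[of \<rho> \<sigma> c "fst p" "snd p" "fst q" "snd q"] by (auto simp: F_def mid_def cost_def)
  have K_nonempty: "K n \<noteq> {}" for n
  proof -
    have "J < J + 1 / Suc n" by simp
    then obtain p where "p \<in> F" "cost p < J + 1 / Suc n"
      unfolding J_def using cINF_less_iff[OF F0 bdd] by blast
    then show ?thesis unfolding K_def by (metis (mono_tags, lifting) mem_Collect_eq empty_iff less_imp_le)
  qed
  have K_mono: "K m \<subseteq> K n" if "n \<le> m" for m n
    using that by (auto simp: K_def frac_le intro: order_trans)
  have E0: "0 \<le> E p" for p by (simp add: E_def add_nonneg_nonneg)
  have bddE: "bdd_below (E ` K n)" for n by (auto intro!: bdd_belowI2 E0)
  have intE: "integrable \<rho> (\<lambda>x. exp (- fst p x))" "integrable \<sigma> (\<lambda>y. exp (- snd p y))" if "p \<in> F" for p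
    using that by (auto simp: F_def dual_feasible_def intro!: \<rho>.integrable_const_bound[of _ 1] \<sigma>.integrable_const_bound[of _ 1])
  have E2: "E p \<le> 2" if "p \<in> F" for p
  proof -
    have "(\<integral>x. exp (- fst p x) \<partial>\<rho>) \<le> 1" "(\<integral>y. exp (- snd p y) \<partial>\<sigma>) \<le> 1"
      using that intE[OF that] by (auto simp: F_def intro!: \<rho>.integral_le_const \<sigma>.integral_le_const)
    then show ?thesis by (simp add: E_def)
  qed
  have I_le: "I n \<le> E p" if "p \<in> K n" for n p unfolding I_def using bddE that by (rule cINF_lower)
  have "incseq I"
    unfolding incseq_def I_def using K_mono by (intro allI impI cINF_superset_mono K_nonempty bddE) auto
  moreover have "I n \<le> 2" for n
  proof -
    obtain p where "p \<in> K n" using K_nonempty by blast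
    then show ?thesis using I_le[of p n] E2[of p] by (auto simp: K_def)
  qed
  ultimately have "convergent I" using incseq_convergent[of I 2] by (metis convergentI)
  have "\<exists>p \<in> K n. E p \<le> I n + 1 / Suc n" for n
  proof -
    have "I n < I n + 1 / Suc n" by simp
    then obtain p where "p \<in> K n" "E p < I n + 1 / Suc n"
      unfolding I_def using cINF_less_iff[OF K_nonempty bddE] by blast
    then show ?thesis by (auto intro: less_imp_le)
  qed
  then obtain p where pK: "\<And>n. p n \<in> K n" and pE: "\<And>n. E (p n) \<le> I n + 1 / Suc n" by metis
  have pF: "p n \<in> F" for n using pK by (auto simp: K_def)
  define fA where "fA n x = exp (- fst (p n) x / 2)" for n x
  define fB where "fB n y = exp (- snd (p n) y / 2)" for n y
  have sq: "(exp (- s / 2) - exp (- t / 2))\<^sup>2 = exp (- s) + exp (- t) - 2 * exp (- ((s + t) / 2))" for s t :: real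
    by (simp add: power2_eq_square algebra_simps exp_add[symmetric] add_divide_distrib[symmetric])
  have fA_sq: "integrable \<rho> (\<lambda>x. (fA m x - fA n x)\<^sup>2)" and fB_sq: "integrable \<sigma> (\<lambda>y. (fB m y - fB n y)\<^sup>2)" for m n
    unfolding fA_def fB_def sq using intE[OF pF] intE[OF midF(1)[OF pF pF], of m n]
    by (auto simp: mid_def)
  have Q_eq: "(\<integral>x. (fA m x - fA n x)\<^sup>2 \<partial>\<rho>) + (\<integral>y. (fB m y - fB n y)\<^sup>2 \<partial>\<sigma>)
      = E (p m) + E (p n) - 2 * E (mid (p m) (p n))" for m n
    unfolding fA_def fB_def sq E_def using intE[OF pF] intE[OF midF(1)[OF pF pF], of m n]
    by (simp add: mid_def)
  have Q_le: "(\<integral>x. (fA m x - fA n x)\<^sup>2 \<partial>\<rho>) + (\<integral>y. (fB m y - fB n y)\<^sup>2 \<partial>\<sigma>) \<le> I m - I n + 2 / Suc n"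
    if "n \<le> m" for m n
  proof -
    have "mid (p m) (p n) \<in> K n"
    proof -
      have "p m \<in> K n" using K_mono[OF that] pK[of m] by blast
      then show ?thesis using midF[OF pF pF, of m n] pK[of n] unfolding K_def by auto
    qed
    then have "I n \<le> E (mid (p m) (p n))" by (rule I_le)
    moreover have "1 / real (Suc m) \<le> 1 / Suc n" using that by (simp add: frac_le)
    moreover have "2 / real (Suc n) = 1 / real (Suc n) + 1 / real (Suc n)" by (simp only: add_divide_distrib[symmetric] one_add_one)
    ultimately show ?thesis unfolding Q_eq using pE[of m] pE[of n] by linarith
  qed
  have Q_small: "\<exists>N. \<forall>n\<ge>N. \<forall>m\<ge>n. (\<integral>x. (fA m x - fA n x)\<^sup>2 \<partial>\<rho>) + (\<integral>y. (fB m y - fB n y)\<^sup>2 \<partial>\<sigma>) \<le> e"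
    if "0 < e" for e
  proof -
    obtain N1 where N1: "\<And>m n. N1 \<le> m \<Longrightarrow> N1 \<le> n \<Longrightarrow> \<bar>I m - I n\<bar> < e / 2"
      using convergent_Cauchy[OF \<open>convergent I\<close>] half_gt_zero[OF \<open>0 < e\<close>] unfolding Cauchy_iff real_norm_def by blast
    obtain N2 where N2: "4 / e < real N2" using reals_Archimedean2 by blast
    show ?thesis
    proof (intro exI[of _ "max N1 N2"] allI impI)
      fix n m assume n: "max N1 N2 \<le> n" and m: "n \<le> m"
      have "4 / e < real (Suc n)" using N2 n by simp
      then have "2 / real (Suc n) \<le> e / 2" using \<open>0 < e\<close> by (simp add: field_simps)
      then show "(\<integral>x. (fA m x - fA n x)\<^sup>2 \<partial>\<rho>) + (\<integral>y. (fB m y - fB n y)\<^sup>2 \<partial>\<sigma>) \<le> e"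
        using Q_le[OF m] abs_le_D1[OF less_imp_le[OF N1[of m n]]] n m by linarith
    qed
  qed
  then have "\<forall>k. \<exists>N. \<forall>n\<ge>N. \<forall>m\<ge>n. (\<integral>x. (fA m x - fA n x)\<^sup>2 \<partial>\<rho>) + (\<integral>y. (fB m y - fB n y)\<^sup>2 \<partial>\<sigma>) \<le> (1 / 4) ^ k"
    by simp
  then obtain N where N: "\<And>k n m. N k \<le> n \<Longrightarrow> n \<le> m \<Longrightarrow>
      (\<integral>x. (fA m x - fA n x)\<^sup>2 \<partial>\<rho>) + (\<integral>y. (fB m y - fB n y)\<^sup>2 \<partial>\<sigma>) \<le> (1 / 4) ^ k" by metis
  \<comment> \<open>The partial sums make the chosen indices increasing and at least \<open>N k\<close>; adding \<open>k\<close> keeps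
    \<open>p (r k)\<close> in \<open>K k\<close>.\<close>
  define r where "r k = k + (\<Sum>i\<le>k. N i)" for k
  have r_ge: "N k \<le> r k" "k \<le> r k" "r k \<le> r (Suc k)" for k
    by (auto simp: r_def intro: trans_le_add2 member_le_sum)
  have small: "(\<integral>x. (fA (r (Suc k)) x - fA (r k) x)\<^sup>2 \<partial>\<rho>) \<le> (1 / 4) ^ k"
    "(\<integral>y. (fB (r (Suc k)) y - fB (r k) y)\<^sup>2 \<partial>\<sigma>) \<le> (1 / 4) ^ k" for k
  proof -
    have "0 \<le> (\<integral>x. (fA (r (Suc k)) x - fA (r k) x)\<^sup>2 \<partial>\<rho>)" "0 \<le> (\<integral>y. (fB (r (Suc k)) y - fB (r k) y)\<^sup>2 \<partial>\<sigma>)"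
      by simp_all
    then show "(\<integral>x. (fA (r (Suc k)) x - fA (r k) x)\<^sup>2 \<partial>\<rho>) \<le> (1 / 4) ^ k"
      "(\<integral>y. (fB (r (Suc k)) y - fB (r k) y)\<^sup>2 \<partial>\<sigma>) \<le> (1 / 4) ^ k"
      using N[OF r_ge(1,3), of k] by linarith+
  qed
  have int: "integrable \<rho> (fst (p n))" "integrable \<sigma> (snd (p n))"
    and nonneg: "0 \<le> fst (p n) x" "0 \<le> snd (p n) y" for n x y
    using pF[of n] by (auto simp: F_def dual_feasible_def)
  then have [measurable]: "fst (p n) \<in> borel_measurable \<rho>" "snd (p n) \<in> borel_measurable \<sigma>" for n by auto
  have cA: "AE x in \<rho>. convergent (\<lambda>k. fA (r k) x)"
    by (rule AE_convergent_of_fast_L2_Cauchy[OF assms(1) _ fA_sq small(1)]) (simp add: fA_def)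
  have cB: "AE y in \<sigma>. convergent (\<lambda>k. fB (r k) y)"
    by (rule AE_convergent_of_fast_L2_Cauchy[OF assms(2) _ fB_sq small(2)]) (simp add: fB_def)
  have cost_le: "cost (p (r k)) \<le> J + 1 / Suc k" for k
    using K_mono[OF r_ge(2)] pK[of "r k"] by (auto simp: K_def)
  have int_le: "(\<integral>x. fst (p (r k)) x \<partial>\<rho>) \<le> J + 1" "(\<integral>y. snd (p (r k)) y \<partial>\<sigma>) \<le> J + 1" for k
  proof -
    have "0 \<le> (\<integral>x. fst (p (r k)) x \<partial>\<rho>)" "0 \<le> (\<integral>y. snd (p (r k)) y \<partial>\<sigma>)" using nonneg by simp_all
    moreover have "1 / real (Suc k) \<le> 1" by simp
    ultimately show "(\<integral>x. fst (p (r k)) x \<partial>\<rho>) \<le> J + 1" "(\<integral>y. snd (p (r k)) y \<partial>\<sigma>) \<le> J + 1"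
      using cost_le[of k] unfolding cost_def dual_cost_def by linarith+
  qed
  have liminf_finite: "AE x in M. liminf (\<lambda>k. ennreal (g k x)) \<noteq> \<infinity>"
    if "\<And>k. integrable M (g k)" "\<And>k x. 0 \<le> g k x" "\<And>k. (\<integral>x. g k x \<partial>M) \<le> C"
    for M :: "'c measure" and g :: "nat \<Rightarrow> 'c \<Rightarrow> real" and C
  proof (rule nn_integral_PInf_AE)
    show "(\<lambda>x. liminf (\<lambda>k. ennreal (g k x))) \<in> borel_measurable M" using that(1) by measurable
    have "(\<integral>\<^sup>+x. liminf (\<lambda>k. ennreal (g k x)) \<partial>M) \<le> liminf (\<lambda>k. \<integral>\<^sup>+x. ennreal (g k x) \<partial>M)"
      by (rule nn_integral_liminf) (use that(1) in auto)
    also have "\<dots> \<le> liminf (\<lambda>k. ennreal C)"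
      by (intro Liminf_mono always_eventually allI, subst nn_integral_eq_integral)
         (use that in \<open>auto intro!: ennreal_leI\<close>)
    finally show "(\<integral>\<^sup>+x. liminf (\<lambda>k. ennreal (g k x)) \<partial>M) \<noteq> \<infinity>"
      by (auto simp: Liminf_const top_unique)
  qed
  have convA: "AE x in \<rho>. convergent (\<lambda>k. fst (p (r k)) x)"
    using cA liminf_finite[OF int(1) nonneg(1) int_le(1)]
    by eventually_elim (rule convergent_of_exp, simp_all add: fA_def nonneg)
  have convB: "AE y in \<sigma>. convergent (\<lambda>k. snd (p (r k)) y)"
    using cB liminf_finite[OF int(2) nonneg(2) int_le(2)]
    by eventually_elim (rule convergent_of_exp, simp_all add: fB_def nonneg)
  have "(\<lambda>k. J + 1 / Suc k) \<longlonglongrightarrow> J + 0"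
    by (intro tendsto_add tendsto_const LIMSEQ_Suc[OF lim_1_over_n])
  then have lim: "(\<lambda>k. J + 1 / Suc k) \<longlonglongrightarrow> J" by simp
  have "dual_feasible \<rho> \<sigma> c (fst (p (r k))) (snd (p (r k)))" for k using pF by (simp add: F_def)
  from dual_feasible_limit[OF this nonneg convA convB cost_le[unfolded cost_def] lim]
  obtain a b where "dual_feasible \<rho> \<sigma> c a b" "dual_cost \<rho> \<sigma> a b \<le> J" by blast
  moreover have "J \<le> dual_cost \<rho> \<sigma> a' b'"
    if "dual_feasible \<rho> \<sigma> c a' b'" "\<forall>x. 0 \<le> a' x" "\<forall>y. 0 \<le> b' y" for a' b'
    using J_le[of "(a', b')"] that by (simp add: F_def cost_def)
  ultimately show ?thesis by (intro exI[of _ a] exI[of _ b]) (auto intro: order_trans)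
qed

lemma dual_feasibleI:
  assumes "integrable \<rho> u" "integrable \<sigma> v" "AE x in \<rho>. x \<in> X" "AE y in \<sigma>. y \<in> Y"
    and "\<And>x y. x \<in> X \<Longrightarrow> y \<in> Y \<Longrightarrow> c x y \<le> u x + v y"
  shows "dual_feasible \<rho> \<sigma> c u v"
  using assms unfolding dual_feasible_def by blast

lemma (in prob_space) AE_in_nonempty: "AE x in M. x \<in> X \<Longrightarrow> X \<noteq> {}"
  by (auto simp: AE_False)

text \<open>
  The existence result asks for nonnegative pairs. Adding \<open>|x|\<^sup>2 / 2\<close> and \<open>|y|\<^sup>2 / 2\<close> to the
  potentials changes the constraint \<open>x \<bullet> y\<close> into \<open>|x + y|\<^sup>2 / 2 \<ge> 0\<close>. Hence, for any feasible
  pair, shifting a constant from one potential to the other makes both nonnegative without changing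
  the cost.
\<close>
lemma kantorovich_potentials_exist:
  fixes \<rho> \<sigma> :: "'a::euclidean_space measure"
  assumes \<rho>: "\<rho> \<in> P2" and \<sigma>: "\<sigma> \<in> P2"
  shows "\<exists>u v. dual_feasible \<rho> \<sigma> (\<bullet>) u v \<and>
    (\<forall>u' v'. dual_feasible \<rho> \<sigma> (\<bullet>) u' v' \<longrightarrow> dual_cost \<rho> \<sigma> u v \<le> dual_cost \<rho> \<sigma> u' v')"
proof -
  interpret \<rho>: prob_space \<rho> by (rule P2_prob[OF \<rho>])
  interpret \<sigma>: prob_space \<sigma> by (rule P2_prob[OF \<sigma>])
  define c :: "'a \<Rightarrow> 'a \<Rightarrow> real" where "c x y = (norm (x + y))\<^sup>2 / 2" for x y
  have c_eq: "c x y = (norm x)\<^sup>2 / 2 + (norm y)\<^sup>2 / 2 + x \<bullet> y" for x y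
    unfolding c_def power2_norm_eq_inner by (simp add: inner_add_left inner_add_right inner_commute)
  have c0: "0 \<le> c x y" for x y by (simp add: c_def)
  note sq = P2_integrable_norm_sq[OF \<rho>] P2_integrable_norm_sq[OF \<sigma>]
  have "c x y \<le> (norm x)\<^sup>2 + (norm y)\<^sup>2" for x y
    using zero_le_power2[of "norm (x - y)"] by (simp add: c_eq norm_diff_sq)
  then have "dual_feasible \<rho> \<sigma> c (\<lambda>x. (norm x)\<^sup>2) (\<lambda>y. (norm y)\<^sup>2)"
    using sq unfolding dual_feasible_def by (intro conjI exI[of _ UNIV]) auto
  from dual_minimiser_exists[OF P2_prob[OF \<rho>] P2_prob[OF \<sigma>] this]
  obtain a b where ab: "dual_feasible \<rho> \<sigma> c a b"
    and min: "\<And>a' b'. dual_feasible \<rho> \<sigma> c a' b' \<Longrightarrow> (\<And>x. 0 \<le> a' x) \<Longrightarrow> (\<And>y. 0 \<le> b' y) \<Longrightarrow>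
       dual_cost \<rho> \<sigma> a b \<le> dual_cost \<rho> \<sigma> a' b'"
    by (metis zero_le_power2)
  define u where "u x = a x - (norm x)\<^sup>2 / 2" for x
  define v where "v y = b y - (norm y)\<^sup>2 / 2" for y
  define K where "K = (\<integral>x. (norm x)\<^sup>2 / 2 \<partial>\<rho>) + (\<integral>y. (norm y)\<^sup>2 / 2 \<partial>\<sigma>)"
  have "dual_feasible \<rho> \<sigma> (\<bullet>) u v"
  proof -
    obtain X Y where XY: "integrable \<rho> a" "integrable \<sigma> b" "AE x in \<rho>. x \<in> X" "AE y in \<sigma>. y \<in> Y"
      "\<And>x y. x \<in> X \<Longrightarrow> y \<in> Y \<Longrightarrow> c x y \<le> a x + b y" using ab unfolding dual_feasible_def by blast
    have "x \<bullet> y \<le> u x + v y" if "x \<in> X" "y \<in> Y" for x y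
      using XY(5)[OF that] by (simp add: c_eq u_def v_def)
    then show ?thesis
      using XY(1,2) sq by (intro dual_feasibleI[OF _ _ XY(3,4)]) (auto simp: u_def[abs_def] v_def[abs_def])
  qed
  moreover have "dual_cost \<rho> \<sigma> u v \<le> dual_cost \<rho> \<sigma> u' v'" if uv': "dual_feasible \<rho> \<sigma> (\<bullet>) u' v'" for u' v'
  proof -
    obtain X Y where XY: "integrable \<rho> u'" "integrable \<sigma> v'" "AE x in \<rho>. x \<in> X" "AE y in \<sigma>. y \<in> Y"
      "\<And>x y. x \<in> X \<Longrightarrow> y \<in> Y \<Longrightarrow> x \<bullet> y \<le> u' x + v' y" using uv' unfolding dual_feasible_def by blast
    define a' where "a' x = u' x + (norm x)\<^sup>2 / 2" for x
    define b' where "b' y = v' y + (norm y)\<^sup>2 / 2" for y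
    have c_le: "c x y \<le> a' x + b' y" if "x \<in> X" "y \<in> Y" for x y
      using XY(5)[OF that] by (simp add: c_eq a'_def b'_def)
    obtain y0 where y0: "y0 \<in> Y" using \<sigma>.AE_in_nonempty[OF XY(4)] by blast
    have X_ne: "X \<noteq> {}" by (rule \<rho>.AE_in_nonempty[OF XY(3)])
    define m where "m = Inf (a' ` X)"
    have m_le: "m \<le> a' x" if "x \<in> X" for x
      unfolding m_def
    proof (rule cINF_lower[OF _ that])
      show "bdd_below (a' ` X)"
        by (rule bdd_belowI2[where m = "- b' y0"]) (use c_le[OF _ y0] c0 in \<open>smt (verit)\<close>)
    qed
    have m_ge: "0 \<le> b' y + m" if "y \<in> Y" for y
    proof -
      have "- b' y \<le> m"
        unfolding m_def by (rule cINF_greatest[OF X_ne]) (use c_le[OF _ that] c0 in \<open>smt (verit)\<close>)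
      then show ?thesis by simp
    qed
    define a'' where "a'' x = max 0 (a' x - m)" for x
    define b'' where "b'' y = max 0 (b' y + m)" for y
    have i: "integrable \<rho> a'" "integrable \<sigma> b'" using XY(1,2) sq by (auto simp: a'_def[abs_def] b'_def[abs_def])
    have "dual_cost \<rho> \<sigma> a b \<le> dual_cost \<rho> \<sigma> a'' b''"
    proof (rule min)
      have "c x y \<le> a'' x + b'' y" if "x \<in> X" "y \<in> Y" for x y
        using c_le[OF that] by (simp add: a''_def b''_def)
      then show "dual_feasible \<rho> \<sigma> c a'' b''"
        using i by (intro dual_feasibleI[OF _ _ XY(3,4)]) (auto simp: a''_def[abs_def] b''_def[abs_def])
    qed (simp_all add: a''_def b''_def)
    also have "dual_cost \<rho> \<sigma> a'' b'' = (\<integral>x. a' x - m \<partial>\<rho>) + (\<integral>y. b' y + m \<partial>\<sigma>)"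
    proof -
      have "(\<integral>x. a'' x \<partial>\<rho>) = (\<integral>x. a' x - m \<partial>\<rho>)"
        by (rule integral_cong_AE) (use i XY(3) m_le in \<open>auto simp: a''_def[abs_def] elim!: eventually_mono\<close>)
      moreover have "(\<integral>y. b'' y \<partial>\<sigma>) = (\<integral>y. b' y + m \<partial>\<sigma>)"
        by (rule integral_cong_AE)
           (use i XY(4) m_ge in \<open>auto simp: b''_def[abs_def] elim!: eventually_mono\<close>)
      ultimately show ?thesis by (simp add: dual_cost_def)
    qed
    also have "\<dots> = (\<integral>x. a' x \<partial>\<rho>) + (\<integral>y. b' y \<partial>\<sigma>)"
      using i by (simp add: \<rho>.prob_space \<sigma>.prob_space)
    also have "\<dots> = dual_cost \<rho> \<sigma> u' v' + K"
      using XY(1,2) sq by (simp add: dual_cost_def K_def a'_def b'_def)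
    finally have "dual_cost \<rho> \<sigma> a b \<le> dual_cost \<rho> \<sigma> u' v' + K" .
    moreover have "dual_cost \<rho> \<sigma> u v = dual_cost \<rho> \<sigma> a b - K"
      using ab sq by (simp add: dual_cost_def K_def u_def v_def dual_feasible_def)
    ultimately show ?thesis by simp
  qed
  ultimately show ?thesis by blast
qed

section \<open>Almost everywhere differentiability of convex functions\<close>

text \<open>Averaging the measure of \<open>N - t b\<close> over \<open>t \<in> [0, 1]\<close> gives the measure of \<open>N\<close> by translation
  invariance, and gives zero by Tonelli because each line meets \<open>N\<close> in a null set of parameters.
  No choice of coordinates is involved.\<close>
lemma null_set_of_countable_lines:
  fixes N :: "'a::euclidean_space set"
  assumes N [measurable]: "N \<in> sets borel" and cnt: "\<And>x. countable {t::real. x + t *\<^sub>R b \<in> N}"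
  shows "N \<in> null_sets lborel"
proof -
  define f :: "real \<Rightarrow> 'a \<Rightarrow> ennreal" where "f t x = indicator {0..1} t * indicator N (x + t *\<^sub>R b)" for t x
  have [measurable]: "(\<lambda>(t, x). f t x) \<in> borel_measurable (lborel \<Otimes>\<^sub>M lborel)"
    unfolding f_def by measurable
  have "(\<integral>\<^sup>+t. f t x \<partial>lborel) = 0" for x
  proof -
    have "AE t in lborel. t \<notin> {t::real. x + t *\<^sub>R b \<in> N}"
      by (intro AE_not_in countable_imp_null_set_lborel cnt)
    then have "(\<integral>\<^sup>+t. f t x \<partial>lborel) = (\<integral>\<^sup>+t. 0 \<partial>(lborel :: real measure))"
      by (intro nn_integral_cong_AE) (auto simp: f_def elim!: eventually_mono)
    then show ?thesis by simp
  qed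
  then have "0 = (\<integral>\<^sup>+x. (\<integral>\<^sup>+t. f t x \<partial>lborel) \<partial>lborel)" by simp
  also have "\<dots> = (\<integral>\<^sup>+t. (\<integral>\<^sup>+x. f t x \<partial>lborel) \<partial>lborel)"
    by (rule lborel_pair.Fubini') measurable
  also have "\<dots> = (\<integral>\<^sup>+t. indicator {0..1::real} t * emeasure lborel N \<partial>lborel)"
  proof (intro nn_integral_cong)
    fix t :: real
    have "(\<integral>\<^sup>+x. indicator N (x + t *\<^sub>R b) \<partial>lborel) = (\<integral>\<^sup>+x. indicator N x \<partial>(distr lborel borel ((+) (t *\<^sub>R b))))"
      by (subst nn_integral_distr) (auto simp: add.commute)
    then have "(\<integral>\<^sup>+x. indicator N (x + t *\<^sub>R b) \<partial>lborel) = emeasure lborel N"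
      by (simp add: lborel_distr_plus)
    then show "(\<integral>\<^sup>+x. f t x \<partial>lborel) = indicator {0..1} t * emeasure lborel N"
      unfolding f_def by (subst nn_integral_cmult) (auto simp: measurable_lborel1)
  qed
  also have "\<dots> = emeasure lborel N"
    by (subst nn_integral_multc) auto
  finally show ?thesis by (auto intro: null_setsI)
qed

text \<open>For a convex function slopes increase with the step, so the infimum is the one-sided
  directional derivative. Steps that leave the domain are skipped, which stands for the value
  \<open>\<infinity>\<close> there.\<close>
definition dir_deriv :: "'a::euclidean_space set \<Rightarrow> ('a \<Rightarrow> real) \<Rightarrow> 'a \<Rightarrow> 'a \<Rightarrow> real" where
  "dir_deriv D u b x = Inf {(u (x + s *\<^sub>R b) - u x) / s | s. 0 < s \<and> x + s *\<^sub>R b \<in> D}"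

text \<open>The derivative along \<open>- b\<close> is the negative of the left derivative along \<open>b\<close>, so the sum is
  the size of the kink. Kinks along the axes are all that matters: without them there is only one
  subgradient.\<close>
definition smooth_points :: "'a::euclidean_space set \<Rightarrow> ('a \<Rightarrow> real) \<Rightarrow> 'a set" where
  "smooth_points D u = {x \<in> interior D. \<forall>b\<in>Basis. dir_deriv D u b x + dir_deriv D u (- b) x = 0}"

definition conv_grad :: "'a::euclidean_space set \<Rightarrow> ('a \<Rightarrow> real) \<Rightarrow> 'a \<Rightarrow> 'a" where
  "conv_grad D u x = (\<Sum>b\<in>Basis. (if x \<in> interior D then dir_deriv D u b x else 0) *\<^sub>R b)"

context
  fixes D :: "'a::euclidean_space set" and u :: "'a \<Rightarrow> real"
  assumes convex: "convex_on D u"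
begin

lemma slope_mono:
  assumes "x \<in> D" "0 < s" "s \<le> t" "x + t *\<^sub>R b \<in> D"
  shows "x + s *\<^sub>R b \<in> D" and "(u (x + s *\<^sub>R b) - u x) / s \<le> (u (x + t *\<^sub>R b) - u x) / t"
proof -
  define l where "l = s / t"
  have l: "0 \<le> l" "l \<le> 1" "0 < l" "s = l * t" using assms by (auto simp: l_def)
  have eq: "x + s *\<^sub>R b = (1 - l) *\<^sub>R x + l *\<^sub>R (x + t *\<^sub>R b)"
    by (simp add: l algebra_simps)
  show "x + s *\<^sub>R b \<in> D"
    unfolding eq using assms l convexD_alt[OF convex_on_imp_convex[OF convex]] by blast
  have "u (x + s *\<^sub>R b) \<le> (1 - l) * u x + l * u (x + t *\<^sub>R b)"
    unfolding eq by (rule convex_onD[OF convex]) (use assms l in auto)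
  then have "u (x + s *\<^sub>R b) - u x \<le> l * (u (x + t *\<^sub>R b) - u x)" by (simp add: algebra_simps)
  then have "(u (x + s *\<^sub>R b) - u x) / s \<le> l * (u (x + t *\<^sub>R b) - u x) / s"
    using assms by (intro divide_right_mono) auto
  then show "(u (x + s *\<^sub>R b) - u x) / s \<le> (u (x + t *\<^sub>R b) - u x) / t"
    using l assms by simp
qed

lemma slope_opposite:
  assumes "x + s *\<^sub>R b \<in> D" "x + t *\<^sub>R (- b) \<in> D" "0 < s" "0 < t"
  shows "0 \<le> (u (x + s *\<^sub>R b) - u x) / s + (u (x + t *\<^sub>R (- b)) - u x) / t"
proof -
  define l where "l = t / (s + t)"
  have l: "0 \<le> l" "l \<le> 1" using assms by (auto simp: l_def)
  have "l * s = (1 - l) * t" using assms by (simp add: l_def field_simps)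
  have "(1 - l) *\<^sub>R (x + t *\<^sub>R (- b)) + l *\<^sub>R (x + s *\<^sub>R b) = x + (l * s) *\<^sub>R b - ((1 - l) * t) *\<^sub>R b"
    by (simp add: algebra_simps)
  then have eq: "x = (1 - l) *\<^sub>R (x + t *\<^sub>R (- b)) + l *\<^sub>R (x + s *\<^sub>R b)"
    using \<open>l * s = (1 - l) * t\<close> by simp
  have "u x \<le> (1 - l) * u (x + t *\<^sub>R (- b)) + l * u (x + s *\<^sub>R b)"
    using convex_onD[OF convex, of l "x + t *\<^sub>R (- b)" "x + s *\<^sub>R b"] l assms eq by auto
  then have "0 \<le> l * (u (x + s *\<^sub>R b) - u x) + (1 - l) * (u (x + t *\<^sub>R (- b)) - u x)"
    by (simp add: algebra_simps)
  moreover have "1 - l = s / (s + t)" using assms by (simp add: l_def field_simps)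
  ultimately have "0 \<le> (t * (u (x + s *\<^sub>R b) - u x) + s * (u (x + t *\<^sub>R (- b)) - u x)) / (s + t)"
    by (simp add: l_def add_divide_distrib)
  then have "0 \<le> t * (u (x + s *\<^sub>R b) - u x) + s * (u (x + t *\<^sub>R (- b)) - u x)"
    using assms by (simp add: zero_le_divide_iff)
  then have "0 \<le> (t * (u (x + s *\<^sub>R b) - u x) + s * (u (x + t *\<^sub>R (- b)) - u x)) / (s * t)"
    using assms by simp
  then show ?thesis using assms by (simp add: add_divide_distrib)
qed

lemma interior_step:
  assumes "x \<in> interior D"
  shows "\<exists>s>0. x + s *\<^sub>R b \<in> D"
proof -
  obtain e where e: "0 < e" "ball x e \<subseteq> D" using assms mem_interior by blast
  let ?s = "e / (2 * (norm b + 1))"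
  have "0 < ?s" using e by (simp add: add_nonneg_pos)
  have "?s * norm b \<le> e / 2"
  proof -
    have "?s * norm b = (e / 2) * (norm b / (norm b + 1))" by simp
    also have "\<dots> \<le> (e / 2) * 1"
      using e by (intro mult_left_mono) (auto simp: divide_le_eq_1 add_nonneg_pos)
    finally show ?thesis by simp
  qed
  moreover have "dist x (x + ?s *\<^sub>R b) = ?s * norm b" using e by (simp add: dist_norm)
  ultimately have "x + ?s *\<^sub>R b \<in> ball x e" unfolding mem_ball using e by linarith
  then show ?thesis using e \<open>0 < ?s\<close> by blast
qed

lemma slopes_bdd_below:
  assumes "x \<in> interior D"
  shows "bdd_below {(u (x + s *\<^sub>R b) - u x) / s | s. 0 < s \<and> x + s *\<^sub>R b \<in> D}"
proof -
  obtain t where t: "0 < t" "x + t *\<^sub>R (- b) \<in> D" using interior_step[OF assms] by blast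
  show ?thesis
    by (rule bdd_belowI[where m = "- ((u (x + t *\<^sub>R (- b)) - u x) / t)"]) (use slope_opposite t in force)
qed

lemma dir_deriv_le:
  assumes "x \<in> interior D" "0 < s" "x + s *\<^sub>R b \<in> D"
  shows "dir_deriv D u b x \<le> (u (x + s *\<^sub>R b) - u x) / s"
  unfolding dir_deriv_def by (rule cInf_lower[OF _ slopes_bdd_below[OF assms(1)]]) (use assms in blast)

lemma dir_deriv_less_iff:
  assumes "x \<in> interior D"
  shows "dir_deriv D u b x < a \<longleftrightarrow> (\<exists>s>0. x + s *\<^sub>R b \<in> D \<and> (u (x + s *\<^sub>R b) - u x) / s < a)"
  unfolding dir_deriv_def
  by (subst cInf_less_iff[OF _ slopes_bdd_below[OF assms]]) (use interior_step[OF assms] in blast)+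

lemma dir_deriv_opposite_ge_0:
  assumes "x \<in> interior D"
  shows "0 \<le> dir_deriv D u b x + dir_deriv D u (- b) x"
proof (rule ccontr)
  assume "\<not> ?thesis"
  then have "dir_deriv D u b x < - dir_deriv D u (- b) x" by simp
  then obtain s where s: "0 < s" "x + s *\<^sub>R b \<in> D" "(u (x + s *\<^sub>R b) - u x) / s < - dir_deriv D u (- b) x"
    using dir_deriv_less_iff[OF assms] by blast
  then have "dir_deriv D u (- b) x < - ((u (x + s *\<^sub>R b) - u x) / s)" by simp
  then obtain t where "0 < t" "x + t *\<^sub>R (- b) \<in> D" "(u (x + t *\<^sub>R (- b)) - u x) / t < - ((u (x + s *\<^sub>R b) - u x) / s)"
    using dir_deriv_less_iff[OF assms] by blast
  then show False using slope_opposite[OF s(2) _ s(1), of t] by simp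
qed

text \<open>By monotonicity of slopes the steps \<open>1 / (n + 1)\<close> suffice, which leaves a countable union.\<close>
lemma dir_deriv_measurable:
  assumes [measurable]: "D \<in> sets borel" "u \<in> borel_measurable borel"
  shows "(\<lambda>x. if x \<in> interior D then dir_deriv D u b x else 0) \<in> borel_measurable borel"
proof (rule borel_measurableI_less)
  fix a :: real
  have I: "interior D \<in> sets borel" by simp
  define g where "g n x = (u (x + (1 / Suc n) *\<^sub>R b) - u x) / (1 / Suc n)" for n :: nat and x
  have [measurable]: "g n \<in> borel_measurable borel" for n unfolding g_def by measurable
  define S where "S = (\<Union>n. {x \<in> interior D. x + (1 / Suc n) *\<^sub>R b \<in> D \<and> g n x < a})"
  have "S \<in> sets borel" unfolding S_def using I by measurable
  have iff: "dir_deriv D u b x < a \<longleftrightarrow> x \<in> S" if x: "x \<in> interior D" for x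
  proof
    assume "dir_deriv D u b x < a"
    then obtain t where t: "0 < t" "x + t *\<^sub>R b \<in> D" "(u (x + t *\<^sub>R b) - u x) / t < a"
      using dir_deriv_less_iff[OF x] by blast
    obtain n where n: "1 / real (Suc n) < t" using nat_approx_posE[OF t(1)] by blast
    then show "x \<in> S"
      using slope_mono[OF subsetD[OF interior_subset x], of "1 / Suc n" t b] t x
      unfolding S_def g_def by (auto intro!: exI[of _ n])
  next
    assume "x \<in> S"
    then obtain n where "x + (1 / Suc n) *\<^sub>R b \<in> D" "g n x < a" unfolding S_def by blast
    moreover have "0 < 1 / real (Suc n)" by simp
    ultimately show "dir_deriv D u b x < a"
      using dir_deriv_less_iff[OF x] unfolding g_def by blast
  qed
  have "S \<subseteq> interior D" unfolding S_def by auto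
  then have "{x \<in> space borel. (if x \<in> interior D then dir_deriv D u b x else 0) < a}
      = S \<union> (if 0 < a then - interior D else {})"
    using iff by auto
  also have "\<dots> \<in> sets borel" using \<open>S \<in> sets borel\<close> I by auto
  finally show "{x \<in> space borel. (if x \<in> interior D then dir_deriv D u b x else 0) < a} \<in> sets borel" .
qed

lemma conv_grad_measurable:
  assumes "D \<in> sets borel" "u \<in> borel_measurable borel"
  shows "conv_grad D u \<in> borel_measurable borel"
  unfolding conv_grad_def using dir_deriv_measurable[OF assms] by measurable

lemma dir_deriv_along_line:
  assumes "x + s *\<^sub>R b \<in> interior D" "x + t *\<^sub>R b \<in> interior D" "s < t"
  shows "dir_deriv D u b (x + s *\<^sub>R b) \<le> - dir_deriv D u (- b) (x + t *\<^sub>R b)"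
proof -
  have D: "x + s *\<^sub>R b \<in> D" "x + t *\<^sub>R b \<in> D" using assms interior_subset by auto
  have e: "x + s *\<^sub>R b + (t - s) *\<^sub>R b = x + t *\<^sub>R b" "x + t *\<^sub>R b + (t - s) *\<^sub>R (- b) = x + s *\<^sub>R b"
    by (simp_all add: algebra_simps)
  have "dir_deriv D u b (x + s *\<^sub>R b) \<le> (u (x + t *\<^sub>R b) - u (x + s *\<^sub>R b)) / (t - s)"
    using dir_deriv_le[OF assms(1), of "t - s" b] assms(3) D unfolding e by simp
  also have "\<dots> = - ((u (x + s *\<^sub>R b) - u (x + t *\<^sub>R b)) / (t - s))"
    by (simp add: diff_divide_distrib)
  also have "\<dots> \<le> - dir_deriv D u (- b) (x + t *\<^sub>R b)"
    using dir_deriv_le[OF assms(2), of "t - s" "- b"] assms(3) D unfolding e by simp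
  finally show ?thesis .
qed

text \<open>Along a line the intervals between left and right derivative are disjoint, and each
  nondegenerate one contains a rational number.\<close>
lemma kinks_countable:
  "countable {t. x + t *\<^sub>R b \<in> interior D \<and> dir_deriv D u b (x + t *\<^sub>R b) + dir_deriv D u (- b) (x + t *\<^sub>R b) \<noteq> 0}"
  (is "countable ?N")
proof -
  define lo hi where "lo t = - dir_deriv D u (- b) (x + t *\<^sub>R b)" and "hi t = dir_deriv D u b (x + t *\<^sub>R b)" for t
  have "\<forall>t\<in>?N. \<exists>q::rat. lo t < of_rat q \<and> of_rat q < hi t"
  proof
    fix t assume "t \<in> ?N"
    then have "lo t < hi t" using dir_deriv_opposite_ge_0[of "x + t *\<^sub>R b" b] by (auto simp: lo_def hi_def)
    then show "\<exists>q::rat. lo t < of_rat q \<and> of_rat q < hi t" using of_rat_dense by blast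
  qed
  from bchoice[OF this] obtain q :: "real \<Rightarrow> rat"
    where q: "\<And>t. t \<in> ?N \<Longrightarrow> lo t < of_rat (q t) \<and> of_rat (q t) < hi t"
    by blast
  have lt: "real_of_rat (q s) < real_of_rat (q t)" if "s \<in> ?N" "t \<in> ?N" "s < t" for s t
  proof -
    have "hi s \<le> lo t"
      unfolding lo_def hi_def by (rule dir_deriv_along_line) (use that in auto)
    then show ?thesis using q[OF that(1)] q[OF that(2)] by linarith
  qed
  have "inj_on q ?N"
  proof (rule inj_onI)
    fix s t assume "s \<in> ?N" "t \<in> ?N" "q s = q t"
    then show "s = t" using lt[of s t] lt[of t s] by (cases s t rule: linorder_cases) auto
  qed
  then show ?thesis by (rule countableI'[of q])
qed

lemma smooth_points_AE:
  assumes [measurable]: "D \<in> sets borel" "u \<in> borel_measurable borel"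
  shows "AE x in lborel. x \<in> D \<longrightarrow> x \<in> smooth_points D u"
proof -
  have null: "{x \<in> interior D. dir_deriv D u b x + dir_deriv D u (- b) x \<noteq> 0} \<in> null_sets lborel" for b
  proof (rule null_set_of_countable_lines)
    have "{x \<in> interior D. dir_deriv D u b x + dir_deriv D u (- b) x \<noteq> 0} =
      {x. (if x \<in> interior D then dir_deriv D u b x else 0) + (if x \<in> interior D then dir_deriv D u (- b) x else 0) \<noteq> 0}"
      by auto
    moreover have "{x. (if x \<in> interior D then dir_deriv D u b x else 0) + (if x \<in> interior D then dir_deriv D u (- b) x else 0) \<noteq> 0} \<in> sets borel"
      using dir_deriv_measurable[OF assms, of b] dir_deriv_measurable[OF assms, of "- b"] by measurable
    ultimately show "{x \<in> interior D. dir_deriv D u b x + dir_deriv D u (- b) x \<noteq> 0} \<in> sets borel" by simp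
    show "countable {t. x + t *\<^sub>R b \<in> {x \<in> interior D. dir_deriv D u b x + dir_deriv D u (- b) x \<noteq> 0}}" for x
      using kinks_countable[of x b] by simp
  qed
  have "AE x in lborel. \<forall>b\<in>Basis. x \<notin> {x \<in> interior D. dir_deriv D u b x + dir_deriv D u (- b) x \<noteq> 0}"
    by (intro AE_finite_allI finite_Basis AE_not_in null)
  moreover have "AE x in lborel. x \<notin> frontier D"
  proof (rule AE_not_in)
    have "negligible (frontier D)" by (rule negligible_convex_frontier[OF convex_on_imp_convex[OF convex]])
    then show "frontier D \<in> null_sets lborel"
      by (simp add: negligible_iff_null_sets null_sets_completion_iff borel_closed)
  qed
  ultimately show ?thesis
    by eventually_elim (use closure_subset in \<open>auto simp: smooth_points_def frontier_def\<close>)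
qed

text \<open>At a fixed step \<open>s\<close> the slopes of \<open>u\<close> in the directions \<open>b\<close> and \<open>- b\<close> enclose \<open>y k \<bullet> b\<close> up to
  \<open>\<delta> k / s\<close>. Sending first \<open>k\<close> to infinity and then \<open>s\<close> to zero leaves no room if there is no
  kink. Working with approximate subgradients means that suprema defining Legendre transforms never
  have to be attained.\<close>
lemma approx_subgradients_converge:
  assumes x: "x \<in> smooth_points D u" and \<delta>: "\<delta> \<longlonglongrightarrow> 0"
    and sub: "\<And>k z. z \<in> D \<Longrightarrow> u x + (z - x) \<bullet> y k - \<delta> k \<le> u z"
  shows "y \<longlonglongrightarrow> conv_grad D u x"
proof -
  have xi: "x \<in> interior D" using x by (simp add: smooth_points_def)
  have upper: "eventually (\<lambda>k. y k \<bullet> b < a) sequentially" if "dir_deriv D u b x < a" for a b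
  proof -
    obtain s where s: "0 < s" "x + s *\<^sub>R b \<in> D" "(u (x + s *\<^sub>R b) - u x) / s < a"
      using \<open>dir_deriv D u b x < a\<close> dir_deriv_less_iff[OF xi] by blast
    have le: "y k \<bullet> b \<le> (u (x + s *\<^sub>R b) - u x) / s + \<delta> k / s" for k
    proof -
      have "s * (y k \<bullet> b) \<le> u (x + s *\<^sub>R b) - u x + \<delta> k"
        using sub[OF s(2), of k] by (simp add: inner_commute)
      then show ?thesis using s(1) by (simp add: field_simps)
    qed
    have "(\<lambda>k. (u (x + s *\<^sub>R b) - u x) / s + \<delta> k / s) \<longlonglongrightarrow> (u (x + s *\<^sub>R b) - u x) / s + 0 / s"
      using s(1) by (intro tendsto_intros \<delta>) auto
    then have "eventually (\<lambda>k. (u (x + s *\<^sub>R b) - u x) / s + \<delta> k / s < a) sequentially"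
      by (rule order_tendstoD) (use s in simp)
    then show ?thesis by eventually_elim (use le order.strict_trans1 in blast)
  qed
  have comp: "(\<lambda>k. y k \<bullet> b) \<longlonglongrightarrow> dir_deriv D u b x" if "b \<in> Basis" for b
  proof (rule order_tendstoI)
    fix a assume "dir_deriv D u b x < a"
    then show "eventually (\<lambda>k. y k \<bullet> b < a) sequentially" by (rule upper)
  next
    fix a assume "a < dir_deriv D u b x"
    moreover have "dir_deriv D u b x + dir_deriv D u (- b) x = 0"
      using x \<open>b \<in> Basis\<close> by (simp add: smooth_points_def)
    ultimately have "dir_deriv D u (- b) x < - a" by simp
    from upper[OF this] show "eventually (\<lambda>k. a < y k \<bullet> b) sequentially" by simp
  qed
  have "(\<lambda>k. \<Sum>b\<in>Basis. (y k \<bullet> b) *\<^sub>R b) \<longlonglongrightarrow> (\<Sum>b\<in>Basis. dir_deriv D u b x *\<^sub>R b)"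
    by (intro tendsto_sum tendsto_scaleR comp tendsto_const)
  then show ?thesis by (simp add: euclidean_representation conv_grad_def xi)
qed

lemma subgradient_unique:
  assumes "x \<in> smooth_points D u" and "\<And>z. z \<in> D \<Longrightarrow> u x + (z - x) \<bullet> y \<le> u z"
  shows "y = conv_grad D u x"
  using approx_subgradients_converge[OF assms(1), of "\<lambda>_. 0" "\<lambda>_. y"] assms(2)
  by (simp add: LIMSEQ_const_iff)

end

section \<open>Legendre transforms\<close>

definition conj_dom :: "'a::euclidean_space set \<Rightarrow> ('a \<Rightarrow> real) \<Rightarrow> 'a set" where
  "conj_dom Y v = {x. bdd_above ((\<lambda>y. x \<bullet> y - v y) ` Y)}"

text \<open>The Legendre transform of \<open>v\<close> restricted to \<open>Y\<close>, kept real-valued by the default \<open>0\<close> where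
  the supremum is infinite.\<close>
definition conj_fun :: "'a::euclidean_space set \<Rightarrow> ('a \<Rightarrow> real) \<Rightarrow> 'a \<Rightarrow> real" where
  "conj_fun Y v x = (if x \<in> conj_dom Y v then SUP y\<in>Y. x \<bullet> y - v y else 0)"

lemma conj_fun_ge: "x \<in> conj_dom Y v \<Longrightarrow> y \<in> Y \<Longrightarrow> x \<bullet> y - v y \<le> conj_fun Y v x"
  by (auto simp: conj_fun_def conj_dom_def intro: cSUP_upper)

lemma
  assumes "Y \<noteq> {}" "\<And>y. y \<in> Y \<Longrightarrow> x \<bullet> y - v y \<le> C"
  shows conj_domI: "x \<in> conj_dom Y v" and conj_fun_le: "conj_fun Y v x \<le> C"
proof -
  show "x \<in> conj_dom Y v" unfolding conj_dom_def by (simp add: bdd_aboveI2[OF assms(2)])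
  then show "conj_fun Y v x \<le> C" using assms by (auto simp: conj_fun_def intro: cSUP_least)
qed

lemma conj_fun_approx:
  assumes "Y \<noteq> {}" "x \<in> conj_dom Y v" "0 < e"
  shows "\<exists>y\<in>Y. conj_fun Y v x - e < x \<bullet> y - v y"
proof (rule ccontr)
  assume "\<not> ?thesis"
  then have "conj_fun Y v x \<le> conj_fun Y v x - e" by (intro conj_fun_le assms) (auto simp: not_less)
  then show False using assms by simp
qed

lemma conj_fun_convex:
  assumes "Y \<noteq> {}"
  shows "convex_on (conj_dom Y v) (conj_fun Y v)"
proof -
  have *: "(a *\<^sub>R x + b *\<^sub>R z) \<bullet> y - v y \<le> a * conj_fun Y v x + b * conj_fun Y v z"
    if "x \<in> conj_dom Y v" "z \<in> conj_dom Y v" "0 \<le> a" "0 \<le> b" "a + b = 1" "y \<in> Y" for a b x y z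
  proof -
    have "(a *\<^sub>R x + b *\<^sub>R z) \<bullet> y - v y = (a *\<^sub>R x + b *\<^sub>R z) \<bullet> y - (a + b) * v y" using that by simp
    also have "\<dots> = a * (x \<bullet> y - v y) + b * (z \<bullet> y - v y)"
      by (simp add: inner_left_distrib algebra_simps)
    also have "\<dots> \<le> a * conj_fun Y v x + b * conj_fun Y v z"
      using that by (intro add_mono mult_left_mono conj_fun_ge)
    finally show ?thesis .
  qed
  have "convex (conj_dom Y v)"
  proof (rule convexI)
    fix x z a b assume "x \<in> conj_dom Y v" "z \<in> conj_dom Y v" "(0::real) \<le> a" "0 \<le> b" "a + b = 1"
    then show "a *\<^sub>R x + b *\<^sub>R z \<in> conj_dom Y v" using conj_domI[OF assms *] by blast
  qed
  then show ?thesis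
    unfolding convex_on_def by (auto intro!: conj_fun_le assms *)
qed

text \<open>The supremum ranges over an arbitrary set, but it is lower semicontinuous: bounds from above
  define closed sets.\<close>
lemma conj_dom_borel: "conj_dom Y v \<in> sets borel"
proof -
  have "conj_dom Y v = (\<Union>n::nat. \<Inter>y\<in>Y. {x. x \<bullet> y - v y \<le> real n})"
  proof (intro equalityI subsetI)
    fix x assume "x \<in> conj_dom Y v"
    then obtain C where "\<And>y. y \<in> Y \<Longrightarrow> x \<bullet> y - v y \<le> C" by (auto simp: conj_dom_def bdd_above_def)
    moreover obtain n :: nat where "C \<le> real n" using real_arch_simple by blast
    ultimately show "x \<in> (\<Union>n::nat. \<Inter>y\<in>Y. {x. x \<bullet> y - v y \<le> real n})" by (auto intro: order_trans)
  qed (auto simp: conj_dom_def intro: bdd_aboveI2)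
  moreover have "closed (\<Inter>y\<in>Y. {x. x \<bullet> y - v y \<le> real n})" for n
    by (intro closed_INT ballI closed_Collect_le continuous_intros)
  ultimately show ?thesis by (auto intro: borel_closed)
qed

lemma conj_fun_measurable:
  assumes "Y \<noteq> {}"
  shows "conj_fun Y v \<in> borel_measurable borel"
proof (rule borel_measurableI_greater)
  fix a :: real
  have "a < conj_fun Y v x \<longleftrightarrow> (\<exists>y\<in>Y. a < x \<bullet> y - v y)" if "x \<in> conj_dom Y v" for x
    using that assms by (simp add: conj_fun_def conj_dom_def less_cSUP_iff)
  then have "{x \<in> space borel. a < conj_fun Y v x} =
      (conj_dom Y v \<inter> (\<Union>y\<in>Y. {x. a < x \<bullet> y - v y})) \<union> (if a < 0 then - conj_dom Y v else {})"
    by (auto simp: conj_fun_def)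
  also have "\<dots> \<in> sets borel"
  proof -
    have "open (\<Union>y\<in>Y. {x. a < x \<bullet> y - v y})"
      by (intro open_UN ballI open_Collect_less continuous_intros)
    then show ?thesis using conj_dom_borel[of Y v] by auto
  qed
  finally show "{x \<in> space borel. a < conj_fun Y v x} \<in> sets borel" .
qed

lemma conj_near_maximiser_subgradient:
  assumes "x \<in> conj_dom Y v" "z \<in> conj_dom Y v" "y \<in> Y" "conj_fun Y v x - \<delta> \<le> x \<bullet> y - v y"
  shows "conj_fun Y v x + (z - x) \<bullet> y - \<delta> \<le> conj_fun Y v z"
  using conj_fun_ge[OF assms(2,3)] assms(4) by (simp add: inner_diff_left)

lemma conj_fun_perturb:
  assumes "Y \<noteq> {}" "\<And>y. y \<in> Y \<Longrightarrow> \<bar>w y - v y\<bar> \<le> C" "x \<in> conj_dom Y v"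
  shows "x \<in> conj_dom Y w" and "conj_fun Y w x \<le> conj_fun Y v x + C"
proof -
  have *: "x \<bullet> y - w y \<le> conj_fun Y v x + C" if "y \<in> Y" for y
    using conj_fun_ge[OF assms(3) that] assms(2)[OF that] by simp
  show "x \<in> conj_dom Y w" by (rule conj_domI[OF assms(1) *])
  show "conj_fun Y w x \<le> conj_fun Y v x + C" by (rule conj_fun_le[OF assms(1) *])
qed

text \<open>
  This is the envelope theorem: to first order the transform only sees \<open>h\<close> at the maximiser, which
  is the gradient. Near-maximisers of the perturbed problem bound the difference quotient from
  above, near-maximisers of the unperturbed one from below. Both are approximate subgradients of
  the unperturbed transform at \<open>x\<close>, hence converge to its gradient.
\<close>
lemma conj_fun_derivative:
  fixes h :: "'a::euclidean_space \<Rightarrow> real"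
  assumes Y: "Y \<noteq> {}" and h: "continuous_on UNIV h" and B: "\<And>y. \<bar>h y\<bar> \<le> B"
    and x: "x \<in> smooth_points (conj_dom Y v) (conj_fun Y v)"
    and e0: "\<And>n. 0 < e n" and e: "e \<longlonglongrightarrow> 0"
  shows "(\<lambda>n. (conj_fun Y (\<lambda>y. v y + e n * h y) x - conj_fun Y v x) / e n)
           \<longlonglongrightarrow> - h (conv_grad (conj_dom Y v) (conj_fun Y v) x)"
proof -
  define u where "u = conj_fun Y v"
  define D where "D = conj_dom Y v"
  define T where "T = conv_grad D u x"
  define w where "w n y = v y + e n * h y" for n y
  define un where "un n = conj_fun Y (w n) x" for n
  note conv = conj_fun_convex[OF Y, of v, folded u_def D_def]
  have xD: "x \<in> D" using x interior_subset by (auto simp: smooth_points_def D_def)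
  have w_diff: "\<bar>w n y - v y\<bar> \<le> e n * B" for n y
    using B[of y] e0[of n] by (simp add: w_def abs_mult)
  have xw: "x \<in> conj_dom Y (w n)" for n
    using conj_fun_perturb(1)[OF Y w_diff] xD by (simp add: D_def)
  have near: "(\<lambda>n. h (z n)) \<longlonglongrightarrow> h T"
    if z: "\<And>n. z n \<in> Y" "\<And>n. u x - \<delta> n \<le> x \<bullet> z n - v (z n)" and \<delta>: "\<delta> \<longlonglongrightarrow> 0" for z \<delta>
  proof -
    have "z \<longlonglongrightarrow> T"
      unfolding T_def
    proof (rule approx_subgradients_converge[OF conv _ \<delta>])
      show "x \<in> smooth_points D u" using x by (simp add: D_def u_def)
      show "u x + (y - x) \<bullet> z k - \<delta> k \<le> u y" if "y \<in> D" for k y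
        using conj_near_maximiser_subgradient[of x Y v y "z k" "\<delta> k"] xD that z by (simp add: u_def D_def)
    qed
    then show ?thesis
      using h by (auto intro: continuous_on_tendsto_compose[of UNIV h])
  qed
  \<comment> \<open>The tolerance is \<open>(e n)\<^sup>2\<close> so that it still vanishes after division by \<open>e n\<close>.\<close>
  have "\<forall>n. \<exists>y\<in>Y. un n - e n * e n < x \<bullet> y - w n y"
    unfolding un_def using conj_fun_approx[OF Y xw] e0 by simp
  then obtain y where y: "\<And>n. y n \<in> Y" "\<And>n. un n - e n * e n < x \<bullet> y n - w n (y n)" by metis
  have "\<forall>n. \<exists>y\<in>Y. u x - e n * e n < x \<bullet> y - v y"
    unfolding u_def using conj_fun_approx[OF Y xD[unfolded D_def]] e0 by simp
  then obtain z where z: "\<And>n. z n \<in> Y" "\<And>n. u x - e n * e n < x \<bullet> z n - v (z n)" by metis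
  have hy: "(\<lambda>n. h (y n)) \<longlonglongrightarrow> h T"
  proof (rule near[of y "\<lambda>n. 2 * (e n * B) + e n * e n"])
    show "u x - (2 * (e n * B) + e n * e n) \<le> x \<bullet> y n - v (y n)" for n
    proof -
      have "u x \<le> un n + e n * B"
        unfolding u_def un_def
        by (rule conj_fun_perturb(2)[OF Y _ xw]) (use w_diff in \<open>simp add: abs_minus_commute\<close>)
      moreover have "- (e n * B) \<le> w n (y n) - v (y n)" using w_diff[of n "y n"] by simp
      ultimately show ?thesis using y(2)[of n] by simp
    qed
    have "(\<lambda>n. 2 * (e n * B) + e n * e n) \<longlonglongrightarrow> 2 * (0 * B) + 0 * 0" by (intro tendsto_intros e)
    then show "(\<lambda>n. 2 * (e n * B) + e n * e n) \<longlonglongrightarrow> 0" by simp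
  qed (rule y)
  have hz: "(\<lambda>n. h (z n)) \<longlonglongrightarrow> h T"
  proof (rule near[of z "\<lambda>n. e n * e n"])
    have "(\<lambda>n. e n * e n) \<longlonglongrightarrow> 0 * 0" by (intro tendsto_intros e)
    then show "(\<lambda>n. e n * e n) \<longlonglongrightarrow> 0" by simp
  qed (use z in \<open>auto intro: less_imp_le\<close>)
  have up: "(un n - u x) / e n \<le> e n - h (y n)" for n
  proof -
    have "x \<bullet> y n - v (y n) \<le> u x" unfolding u_def by (rule conj_fun_ge[OF xD[unfolded D_def] y(1)])
    then have "un n - u x \<le> e n * (e n - h (y n))"
      using y(2)[of n] by (simp add: w_def algebra_simps)
    then show ?thesis using e0[of n] by (simp add: divide_le_eq mult.commute)
  qed
  have low: "- e n - h (z n) \<le> (un n - u x) / e n" for n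
  proof -
    have "x \<bullet> z n - w n (z n) \<le> un n" unfolding un_def by (rule conj_fun_ge[OF xw z(1)])
    then have "e n * (- e n - h (z n)) \<le> un n - u x"
      using z(2)[of n] by (simp add: w_def algebra_simps)
    then show ?thesis using e0[of n] by (simp add: le_divide_eq mult.commute)
  qed
  have "(\<lambda>n. (un n - u x) / e n) \<longlonglongrightarrow> - h T"
  proof (rule real_tendsto_sandwich[OF always_eventually always_eventually])
    show "\<forall>n. - e n - h (z n) \<le> (un n - u x) / e n" using low by blast
    show "\<forall>n. (un n - u x) / e n \<le> e n - h (y n)" using up by blast
    have "(\<lambda>n. - e n - h (z n)) \<longlonglongrightarrow> - 0 - h T" by (intro tendsto_intros e hz)
    then show "(\<lambda>n. - e n - h (z n)) \<longlonglongrightarrow> - h T" by simp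
    have "(\<lambda>n. e n - h (y n)) \<longlonglongrightarrow> 0 - h T" by (intro tendsto_intros e hy)
    then show "(\<lambda>n. e n - h (y n)) \<longlonglongrightarrow> - h T" by simp
  qed
  then show ?thesis by (simp add: un_def[abs_def] w_def[abs_def] u_def T_def D_def)
qed

section \<open>Optimal maps from absolutely continuous measures\<close>

text \<open>Closed sets generate the Borel sets, and the indicator of a closed set is a decreasing
  limit of the continuous functions \<open>max 0 (1 - n infdist x C)\<close>.\<close>
lemma measure_eqI_bounded_continuous:
  fixes M N :: "'a::euclidean_space measure"
  assumes M: "prob_space M" "sets M = sets borel" and N: "prob_space N" "sets N = sets borel"
    and eq: "\<And>h B. continuous_on UNIV h \<Longrightarrow> (\<And>x. \<bar>h x\<bar> \<le> B) \<Longrightarrow> (\<integral>x. h x \<partial>M) = (\<integral>x. (h x :: real) \<partial>N)"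
  shows "M = N"
proof (rule measure_eqI_generator_eq[where E = "{C. closed C}" and \<Omega> = UNIV and A = "\<lambda>_. UNIV"])
  interpret M: prob_space M by fact
  interpret N: prob_space N by fact
  show "Int_stable {C::'a set. closed C}" by (auto simp: Int_stable_def)
  show "sets M = sigma_sets UNIV {C. closed C}" "sets N = sigma_sets UNIV {C. closed C}"
    using M(2) N(2) by (simp_all add: borel_eq_closed)
  show "emeasure M UNIV \<noteq> \<infinity>" for i :: nat by simp
  fix C :: "'a set" assume "C \<in> {C. closed C}"
  then have C: "closed C" by simp
  show "emeasure M C = emeasure N C"
  proof (cases "C = {}")
    case False
    define h where "h n x = max 0 (1 - real n * infdist x C)" for n :: nat and x
    have cont: "continuous_on UNIV (h n)" for n
      unfolding h_def by (intro continuous_intros)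
    have bd: "\<bar>h n x\<bar> \<le> 1" for n x by (simp add: h_def infdist_nonneg)
    have lim: "(\<lambda>n. h n x) \<longlonglongrightarrow> indicator C x" for x
    proof (cases "x \<in> C")
      case True
      then show ?thesis by (simp add: h_def)
    next
      case nC: False
      then have pos: "0 < infdist x C"
        using infdist_pos_not_in_closed[OF C False] by simp
      obtain k :: nat where k: "1 / infdist x C < real k" using reals_Archimedean2 by blast
      have "h n x = 0" if "k \<le> n" for n
      proof -
        have "1 / infdist x C < real n" using k that by linarith
        then show ?thesis using pos by (simp add: h_def field_simps)
      qed
      then have "eventually (\<lambda>n. h n x = indicator C x) sequentially"
        using nC by (intro eventually_sequentiallyI[of k]) simp
      then show ?thesis by (rule tendsto_eventually)
    qed
    have "(\<lambda>n. \<integral>x. h n x \<partial>L) \<longlonglongrightarrow> measure L C" if L: "prob_space L" "sets L = sets borel" for L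
    proof -
      interpret L: prob_space L by fact
      have m: "h n \<in> borel_measurable L" for n
        using borel_measurable_continuous_onI[OF cont] L(2) by (simp cong: measurable_cong_sets)
      have CL: "C \<in> sets L" using C L(2) by auto
      have "(\<lambda>n. \<integral>x. h n x \<partial>L) \<longlonglongrightarrow> (\<integral>x. indicator C x \<partial>L)"
        by (rule integral_dominated_convergence[where w = "\<lambda>_. 1"])
           (use m CL lim bd in \<open>auto intro: borel_measurable_indicator\<close>)
      then show ?thesis using CL by simp
    qed
    from this[OF M] this[OF N] have "measure M C = measure N C"
      using eq[OF cont bd] by (simp add: LIMSEQ_unique)
    then show ?thesis by (simp add: M.emeasure_eq_measure N.emeasure_eq_measure)
  qed simp
qed auto

text \<open>
  Brenier's theorem, with the optimal map obtained as the gradient of the potential \<open>u\<close>, the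
  Legendre transform of the second half of a dual minimiser. That the gradient transports \<open>\<rho>\<close> to
  \<open>\<sigma>\<close> is the Euler-Lagrange equation of the dual problem, tested with every bounded continuous
  \<open>h\<close>. Absolute continuity of \<open>\<rho>\<close> enters because \<open>u\<close> is differentiable only Lebesgue almost
  everywhere.
\<close>
theorem optimal_map_exists_unique:
  fixes \<rho> \<sigma> :: "'a::euclidean_space measure"
  assumes \<rho>a: "\<rho> \<in> P2_abs" and \<sigma>: "\<sigma> \<in> P2"
  shows "\<exists>T. is_opt_map \<rho> \<sigma> T \<and> (\<forall>\<gamma> \<in> opt_plans \<rho> \<sigma>. \<gamma> = distr \<rho> borel (\<lambda>x. (x, T x)))"
proof -
  have \<rho>: "\<rho> \<in> P2" and ac: "absolutely_continuous lborel \<rho>" using \<rho>a by (auto simp: P2_abs_def)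
  interpret \<rho>: prob_space \<rho> by (rule P2_prob[OF \<rho>])
  interpret \<sigma>: prob_space \<sigma> by (rule P2_prob[OF \<sigma>])
  obtain u0 v where feas0: "dual_feasible \<rho> \<sigma> (\<bullet>) u0 v"
    and min0: "\<And>u' v'. dual_feasible \<rho> \<sigma> (\<bullet>) u' v' \<Longrightarrow> dual_cost \<rho> \<sigma> u0 v \<le> dual_cost \<rho> \<sigma> u' v'"
    using kantorovich_potentials_exist[OF \<rho> \<sigma>] by blast
  from feas0 obtain X Y where iu0: "integrable \<rho> u0" and iv: "integrable \<sigma> v"
    and X: "AE x in \<rho>. x \<in> X" and Y: "AE y in \<sigma>. y \<in> Y"
    and dual0: "\<And>x y. x \<in> X \<Longrightarrow> y \<in> Y \<Longrightarrow> x \<bullet> y \<le> u0 x + v y" unfolding dual_feasible_def by blast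
  have Y_ne: "Y \<noteq> {}" by (rule \<sigma>.AE_in_nonempty[OF Y])
  then obtain y0 where y0: "y0 \<in> Y" by blast
  have X_ne: "X \<noteq> {}" by (rule \<rho>.AE_in_nonempty[OF X])
  define D where "D = conj_dom Y v"
  define u where "u = conj_fun Y v"
  define T where "T = conv_grad D u"
  note conv = conj_fun_convex[OF Y_ne, of v, folded u_def D_def]
  have D_borel: "D \<in> sets borel" unfolding D_def by (rule conj_dom_borel)
  have u_borel: "u \<in> borel_measurable borel" unfolding u_def by (rule conj_fun_measurable[OF Y_ne])
  have T_borel: "T \<in> borel_measurable borel" unfolding T_def by (rule conv_grad_measurable[OF conv D_borel u_borel])
  have XD: "x \<in> D" and u_le: "u x \<le> u0 x" if "x \<in> X" for x
    unfolding D_def u_def using conj_domI[OF Y_ne, of x v "u0 x"] conj_fun_le[OF Y_ne, of x v "u0 x"] dual0[OF that]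
    by (auto simp: algebra_simps)
  have D_AE: "AE x in \<rho>. x \<in> D" using X by eventually_elim (rule XD)
  have dual: "x \<bullet> y \<le> u x + v y" if "x \<in> D" "y \<in> Y" for x y
    using conj_fun_ge[of x Y v y] that by (simp add: D_def u_def)
  have iu: "integrable \<rho> u"
  proof (rule Bochner_Integration.integrable_bound)
    have "integrable \<rho> (\<lambda>x. x \<bullet> y0)"
    proof (rule P2_integrable[OF \<rho>, where a = "1 + (norm y0)\<^sup>2"])
      show "norm (x \<bullet> y0) \<le> (1 + (norm y0)\<^sup>2) * ((norm x)\<^sup>2 + 1)" for x
      proof -
        have "norm (x \<bullet> y0) \<le> (norm x)\<^sup>2 + (norm y0)\<^sup>2" using abs_inner_le_norm_sq by simp
        also have "\<dots> \<le> (1 + (norm y0)\<^sup>2) * ((norm x)\<^sup>2 + 1)" by (simp add: algebra_simps)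
        finally show ?thesis .
      qed
    qed simp
    then show "integrable \<rho> (\<lambda>x. \<bar>u0 x\<bar> + (\<bar>x \<bullet> y0\<bar> + \<bar>v y0\<bar>))" using iu0 by simp
    show "u \<in> borel_measurable \<rho>" using u_borel by (simp add: P2_measurable[OF \<rho>])
    show "AE x in \<rho>. norm (u x) \<le> norm (\<bar>u0 x\<bar> + (\<bar>x \<bullet> y0\<bar> + \<bar>v y0\<bar>))"
      using X
    proof eventually_elim
      case (elim x)
      then show ?case using u_le[OF elim] dual[OF XD[OF elim] y0] by (simp add: abs_le_iff) linarith
    qed
  qed
  have min: "(\<integral>x. u x \<partial>\<rho>) + (\<integral>y. v y \<partial>\<sigma>) \<le> dual_cost \<rho> \<sigma> u' v'"
    if "dual_feasible \<rho> \<sigma> (\<bullet>) u' v'" for u' v'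
  proof -
    have "(\<integral>x. u x \<partial>\<rho>) \<le> (\<integral>x. u0 x \<partial>\<rho>)"
      by (rule integral_mono_AE[OF iu iu0]) (use X u_le in \<open>auto elim: eventually_mono\<close>)
    then show ?thesis using min0[OF that] by (simp add: dual_cost_def)
  qed
  have smooth: "AE x in \<rho>. x \<in> smooth_points D u"
  proof -
    have "AE x in \<rho>. x \<in> D \<longrightarrow> x \<in> smooth_points D u"
      by (rule absolutely_continuous_AE[OF _ ac smooth_points_AE[OF conv D_borel u_borel]])
         (simp add: P2_sets[OF \<rho>])
    then show ?thesis using D_AE by eventually_elim blast
  qed
  have T_\<rho>: "T \<in> borel_measurable \<rho>" using T_borel by (simp add: P2_measurable[OF \<rho>])
  \<comment> \<open>One-sided perturbations \<open>v + e n * h\<close> give one inequality; the other one comes from \<open>- h\<close>.\<close>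
  have half: "(\<integral>x. h (T x) \<partial>\<rho>) \<le> (\<integral>y. h y \<partial>\<sigma>)" if h: "continuous_on UNIV h" and B: "\<And>y. \<bar>h y\<bar> \<le> B"
    for h :: "'a \<Rightarrow> real" and B
  proof -
    define e where "e n = inverse (real (Suc n))" for n
    have e0: "0 < e n" for n by (simp add: e_def)
    have e: "e \<longlonglongrightarrow> 0" unfolding e_def by (rule LIMSEQ_inverse_real_of_nat)
    define w where "w n y = v y + e n * h y" for n y
    define un where "un n = conj_fun Y (w n)" for n
    have h_borel: "h \<in> borel_measurable borel" by (rule borel_measurable_continuous_onI[OF h])
    have ih: "integrable \<sigma> h"
      by (rule \<sigma>.integrable_const_bound[of _ B]) (use B h_borel in \<open>auto simp: P2_measurable[OF \<sigma>]\<close>)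
    have w_diff: "\<bar>w n y - v y\<bar> \<le> e n * B" for n y
      using B[of y] e0[of n] by (simp add: w_def abs_mult)
    have xw: "x \<in> conj_dom Y (w n)" if "x \<in> D" for n x
      using conj_fun_perturb(1)[OF Y_ne w_diff] that by (simp add: D_def)
    have un_diff: "\<bar>un n x - u x\<bar> \<le> e n * B" if "x \<in> D" for n x
    proof -
      have "un n x \<le> u x + e n * B"
        unfolding un_def u_def by (rule conj_fun_perturb(2)[OF Y_ne w_diff that[unfolded D_def]])
      moreover have "u x \<le> un n x + e n * B"
        unfolding un_def u_def
        by (rule conj_fun_perturb(2)[OF Y_ne _ xw[OF that]]) (use w_diff in \<open>simp add: abs_minus_commute\<close>)
      ultimately show ?thesis by (simp add: abs_le_iff)
    qed
    have un_borel: "un n \<in> borel_measurable \<rho>" for n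
      using conj_fun_measurable[OF Y_ne] by (simp add: un_def P2_measurable[OF \<rho>])
    have idiff: "integrable \<rho> (\<lambda>x. un n x - u x)" for n
      by (rule \<rho>.integrable_const_bound[of _ "e n * B"])
         (use D_AE un_diff un_borel iu in \<open>auto elim!: eventually_mono\<close>)
    have iun: "integrable \<rho> (un n)" for n
      using Bochner_Integration.integrable_add[OF idiff[of n] iu] by simp
    have ge: "- (\<integral>y. h y \<partial>\<sigma>) \<le> (\<integral>x. (un n x - u x) / e n \<partial>\<rho>)" for n
    proof -
      have "x \<bullet> y \<le> un n x + w n y" if "x \<in> D" "y \<in> Y" for x y
        using conj_fun_ge[OF xw[OF that(1)] that(2), of n] by (simp add: un_def)
      then have "dual_feasible \<rho> \<sigma> (\<bullet>) (un n) (w n)"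
        using iun iv ih by (intro dual_feasibleI[OF _ _ D_AE Y]) (auto simp: w_def[abs_def])
      from min[OF this] have "(\<integral>x. u x \<partial>\<rho>) + (\<integral>y. v y \<partial>\<sigma>) \<le> (\<integral>x. un n x \<partial>\<rho>) + ((\<integral>y. v y \<partial>\<sigma>) + e n * (\<integral>y. h y \<partial>\<sigma>))"
        using iv ih by (simp add: dual_cost_def w_def)
      then have "- (\<integral>y. h y \<partial>\<sigma>) * e n \<le> (\<integral>x. un n x - u x \<partial>\<rho>)"
        using iun iu by (simp add: mult.commute)
      then show ?thesis using e0[of n] by (simp add: le_divide_eq)
    qed
    have "(\<lambda>n. \<integral>x. (un n x - u x) / e n \<partial>\<rho>) \<longlonglongrightarrow> (\<integral>x. - h (T x) \<partial>\<rho>)"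
    proof (rule integral_dominated_convergence[where w = "\<lambda>_. B"])
      show "(\<lambda>x. - h (T x)) \<in> borel_measurable \<rho>" using h_borel T_\<rho> by measurable
      show "(\<lambda>x. (un n x - u x) / e n) \<in> borel_measurable \<rho>" for n using un_borel iu by auto
      show "AE x in \<rho>. (\<lambda>n. (un n x - u x) / e n) \<longlonglongrightarrow> - h (T x)"
        using smooth
      proof eventually_elim
        case (elim x)
        from conj_fun_derivative[OF Y_ne h B elim[unfolded D_def u_def] e0 e]
        show ?case by (simp add: un_def[abs_def] w_def[abs_def] u_def T_def D_def)
      qed
      show "AE x in \<rho>. norm ((un n x - u x) / e n) \<le> B" for n
        using D_AE
      proof eventually_elim
        case (elim x)
        then show ?case using un_diff[OF elim, of n] e0[of n] by (simp add: abs_divide divide_le_eq mult.commute)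
      qed
    qed simp
    then have "- (\<integral>y. h y \<partial>\<sigma>) \<le> (\<integral>x. - h (T x) \<partial>\<rho>)"
      by (rule LIMSEQ_le_const) (use ge in blast)
    then show ?thesis by simp
  qed
  have push: "distr \<rho> borel T = \<sigma>"
  proof (rule measure_eqI_bounded_continuous)
    show "prob_space (distr \<rho> borel T)" by (rule \<rho>.prob_space_distr[OF T_\<rho>])
    show "prob_space \<sigma>" by (rule P2_prob[OF \<sigma>])
    show "sets \<sigma> = sets borel" by (rule P2_sets[OF \<sigma>])
    fix h :: "'a \<Rightarrow> real" and B assume h: "continuous_on UNIV h" and B: "\<And>x. \<bar>h x\<bar> \<le> B"
    have "(\<integral>x. h (T x) \<partial>\<rho>) = (\<integral>y. h y \<partial>\<sigma>)"
      using half[OF h B] half[of "\<lambda>y. - h y" B] h B by (simp add: continuous_on_minus)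
    then show "(\<integral>x. h x \<partial>distr \<rho> borel T) = (\<integral>y. h y \<partial>\<sigma>)"
      by (simp add: integral_distr[OF T_\<rho> borel_measurable_continuous_onI[OF h]])
  qed simp
  have D_ne: "D \<noteq> {}" using X_ne XD by blast
  then obtain x0 where x0: "x0 \<in> D" by blast
  \<comment> \<open>The second potential is improved to the Legendre transform of \<open>u\<close>. For \<open>v\<close> itself, equality
    on the graph of \<open>T\<close> is not clear, since \<open>v\<close> need not be lower semicontinuous.\<close>
  define E where "E = conj_dom D u"
  define v' where "v' = conj_fun D u"
  have YE: "y \<in> E" and v'_le: "v' y \<le> v y" if "y \<in> Y" for y
    unfolding E_def v'_def using conj_domI[OF D_ne, of y u "v y"] conj_fun_le[OF D_ne, of y u "v y"] dual[OF _ that]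
    by (auto simp: algebra_simps inner_commute)
  have v'_borel: "v' \<in> borel_measurable borel" unfolding v'_def by (rule conj_fun_measurable[OF D_ne])
  have dual': "x \<bullet> y \<le> u x + v' y" if "x \<in> D" "y \<in> E" for x y
    using conj_fun_ge[of y D u x] that by (simp add: E_def v'_def inner_commute)
  have iv': "integrable \<sigma> v'"
  proof (rule Bochner_Integration.integrable_bound)
    have "integrable \<sigma> (\<lambda>y. x0 \<bullet> y)"
    proof (rule P2_integrable[OF \<sigma>, where a = "1 + (norm x0)\<^sup>2"])
      show "norm (x0 \<bullet> y) \<le> (1 + (norm x0)\<^sup>2) * ((norm y)\<^sup>2 + 1)" for y
      proof -
        have "norm (x0 \<bullet> y) \<le> (norm x0)\<^sup>2 + (norm y)\<^sup>2" using abs_inner_le_norm_sq by simp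
        also have "\<dots> \<le> (1 + (norm x0)\<^sup>2) * ((norm y)\<^sup>2 + 1)" by (simp add: algebra_simps)
        finally show ?thesis .
      qed
    qed simp
    then show "integrable \<sigma> (\<lambda>y. \<bar>v y\<bar> + (\<bar>x0 \<bullet> y\<bar> + \<bar>u x0\<bar>))" using iv by simp
    show "v' \<in> borel_measurable \<sigma>" using v'_borel by (simp add: P2_measurable[OF \<sigma>])
    show "AE y in \<sigma>. norm (v' y) \<le> norm (\<bar>v y\<bar> + (\<bar>x0 \<bullet> y\<bar> + \<bar>u x0\<bar>))"
      using Y
    proof eventually_elim
      case (elim y)
      then show ?case using v'_le[OF elim] dual'[OF x0 YE[OF elim]] by (simp add: abs_le_iff) linarith
    qed
  qed
  have E_AE: "AE y in \<sigma>. y \<in> E" using Y by eventually_elim (rule YE)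
  have eq: "u x + v' (T x) = x \<bullet> T x" if x: "x \<in> smooth_points D u" for x
  proof -
    have xD: "x \<in> D" using x interior_subset by (auto simp: smooth_points_def)
    have "\<forall>n. \<exists>y\<in>Y. u x - inverse (real (Suc n)) < x \<bullet> y - v y"
      unfolding u_def using conj_fun_approx[OF Y_ne xD[unfolded D_def]] by simp
    then obtain y where y: "\<And>n. y n \<in> Y" "\<And>n. u x - inverse (real (Suc n)) < x \<bullet> y n - v (y n)" by metis
    have sub: "u x + (z - x) \<bullet> y k - inverse (real (Suc k)) \<le> u z" if "z \<in> D" for k z
      using conj_near_maximiser_subgradient[of x Y v z "y k" "inverse (real (Suc k))"] xD that y(1)[of k] y(2)[of k]
      by (simp add: u_def D_def)
    have yT: "y \<longlonglongrightarrow> T x"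
      unfolding T_def by (rule approx_subgradients_converge[OF conv x LIMSEQ_inverse_real_of_nat sub])
    have ineq: "u x + (z - x) \<bullet> T x \<le> u z" if "z \<in> D" for z
    proof -
      have "(\<lambda>k. u x + (z - x) \<bullet> y k - inverse (real (Suc k))) \<longlonglongrightarrow> u x + (z - x) \<bullet> T x - 0"
        by (intro tendsto_intros yT LIMSEQ_inverse_real_of_nat)
      then have "u x + (z - x) \<bullet> T x - 0 \<le> u z" by (rule LIMSEQ_le_const2) (use sub[OF that] in blast)
      then show ?thesis by simp
    qed
    have *: "T x \<bullet> z - u z \<le> x \<bullet> T x - u x" if "z \<in> D" for z
      using ineq[OF that] by (simp add: inner_diff_left inner_commute[of "T x" z])
    have "T x \<in> E" "v' (T x) \<le> x \<bullet> T x - u x"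
      unfolding E_def v'_def using conj_domI[OF D_ne *] conj_fun_le[OF D_ne *] by auto
    then show ?thesis using dual'[OF xD] by force
  qed
  define \<gamma> where "\<gamma> = distr \<rho> borel (\<lambda>x. (x, T x))"
  have pair: "(\<lambda>x. (x, T x)) \<in> borel_measurable \<rho>"
    unfolding P2_measurable[OF \<rho>] by (intro borel_measurable_Pair T_borel) simp
  have \<gamma>: "\<gamma> \<in> plans \<rho> \<sigma>"
    using plan_of_maps[of "\<lambda>x. x" \<rho> T] T_\<rho> P2_measurable[OF \<rho>] P2_sets[OF \<rho>]
    by (simp add: \<gamma>_def push distr_id2)
  have eq_\<gamma>: "AE z in \<gamma>. u (fst z) + v' (snd z) = fst z \<bullet> snd z"
  proof -
    have [measurable]: "fst \<in> borel_measurable (borel :: ('a \<times> 'a) measure)"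
      "snd \<in> borel_measurable (borel :: ('a \<times> 'a) measure)"
      by (simp_all add: measurable_fst_borel measurable_snd_borel)
    note [measurable] = u_borel v'_borel
    have "{z \<in> space borel. u (fst z) + v' (snd z) = fst z \<bullet> snd z} \<in> sets (borel :: ('a \<times> 'a) measure)"
      by measurable
    then show ?thesis
      unfolding \<gamma>_def using AE_distr_iff[OF pair] smooth eq by (auto elim!: eventually_mono)
  qed
  have "is_opt_map \<rho> \<sigma> T"
    unfolding is_opt_map_def \<gamma>_def[symmetric]
    using T_borel push opt_plan_of_potentials[OF \<rho> \<sigma> iu iv' D_AE E_AE dual' \<gamma> eq_\<gamma>] by blast
  moreover have "\<gamma>' = \<gamma>" if \<gamma>': "\<gamma>' \<in> opt_plans \<rho> \<sigma>" for \<gamma>'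
  proof -
    note p = \<rho> \<sigma> opt_plansD(1)[OF \<gamma>']
    have "AE z in \<gamma>'. u (fst z) + v' (snd z) = fst z \<bullet> snd z"
      by (rule opt_plan_equality[OF \<rho> \<sigma> iu iv' D_AE E_AE dual' \<gamma> eq_\<gamma> \<gamma>'])
    moreover have "AE z in \<gamma>'. fst z \<in> smooth_points D u"
      using AE_distrD[OF plan_fst[OF p], of "\<lambda>x. x \<in> smooth_points D u", unfolded plan_distr[OF p]] smooth by blast
    moreover have "AE z in \<gamma>'. snd z \<in> E"
      using AE_distrD[OF plan_snd[OF p], of "\<lambda>y. y \<in> E", unfolded plan_distr[OF p]] E_AE by blast
    ultimately have "AE z in \<gamma>'. z = (fst z, T (fst z))"
    proof eventually_elim
      case (elim z)
      have "snd z = T (fst z)"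
        unfolding T_def
      proof (rule subgradient_unique[OF conv elim(2)])
        fix x assume "x \<in> D"
        then show "u (fst z) + (x - fst z) \<bullet> snd z \<le> u x"
          using dual'[OF _ elim(3), of x] elim(1) by (simp add: inner_diff_left)
      qed
      then show ?case by (metis prod.collapse)
    qed
    then have "distr \<gamma>' borel (\<lambda>z. z) = distr \<gamma>' borel (\<lambda>z. (fst z, T (fst z)))"
      by (intro distr_cong_AE) (use T_borel in \<open>auto simp: plan_measurable[OF p] intro!: measurable_compose[OF plan_fst[OF p], unfolded plan_measurable[OF p]]\<close>)
    also have "\<dots> = distr (distr \<gamma>' borel fst) borel (\<lambda>x. (x, T x))"
      using T_borel by (subst distr_distr[OF _ plan_fst[OF p]]) (auto simp: o_def)
    also have "\<dots> = \<gamma>" by (simp add: plan_distr[OF p] \<gamma>_def)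
    finally show ?thesis by (simp add: distr_id2 plan_sets[OF p])
  qed
  ultimately show ?thesis unfolding \<gamma>_def by blast
qed

section \<open>The explicit gradient step\<close>

text \<open>The chord slopes \<open>(H (x + t (y - x)) - H x) / t\<close> are at most \<open>H y - H x\<close> for \<open>0 < t < 1\<close> and
  tend to \<open>g \<bullet> (y - x)\<close>.\<close>
lemma convex_gradient_inequality:
  fixes H :: "'a::euclidean_space \<Rightarrow> real"
  assumes conv: "convex_on UNIV H" and grad: "GDERIV H x :> g"
  shows "H x + g \<bullet> (y - x) \<le> H y"
proof -
  define f where "f t = H (x + t *\<^sub>R (y - x))" for t
  have "(f has_derivative (\<lambda>t. (t *\<^sub>R (y - x)) \<bullet> g)) (at 0)"
  proof -
    have "(H has_derivative (\<lambda>h. h \<bullet> g)) (at (x + 0 *\<^sub>R (y - x)))" using grad by (simp add: gderiv_def)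
    moreover have "((\<lambda>t. x + t *\<^sub>R (y - x)) has_derivative (\<lambda>t. t *\<^sub>R (y - x))) (at 0)"
      by (auto intro!: derivative_eq_intros)
    ultimately show ?thesis unfolding f_def using has_derivative_compose by fast
  qed
  then have "DERIV f 0 :> (y - x) \<bullet> g"
    by (simp add: has_field_derivative_def mult_commute_abs)
  then have "((\<lambda>t. (f t - f 0) / t) \<longlongrightarrow> (y - x) \<bullet> g) (at_right 0)"
    by (simp add: DERIV_def filterlim_at_split)
  moreover have "eventually (\<lambda>t. (f t - f 0) / t \<le> H y - H x) (at_right 0)"
  proof (rule eventually_at_rightI)
    fix t :: real assume t: "t \<in> {0<..<1}"
    have "f t = H ((1 - t) *\<^sub>R x + t *\<^sub>R y)" by (simp add: f_def algebra_simps)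
    also have "\<dots> \<le> (1 - t) * H x + t * H y" by (rule convex_onD[OF conv]) (use t in auto)
    finally have "f t - f 0 \<le> (H y - H x) * t" by (simp add: f_def algebra_simps)
    then show "(f t - f 0) / t \<le> H y - H x" using t by (simp add: divide_le_eq)
  qed simp
  ultimately have "(y - x) \<bullet> g \<le> H y - H x"
    by (rule tendsto_upperbound) simp
  then show ?thesis by (simp add: inner_commute)
qed

text \<open>The inverse of the explicit step \<open>I + \<eta> g\<close>. Its range is closed if \<open>g\<close> is the continuous
  gradient of a convex function, so the default \<open>0\<close> outside the range keeps the map Borel.\<close>
definition backward_map :: "('a::euclidean_space \<Rightarrow> 'a) \<Rightarrow> real \<Rightarrow> 'a \<Rightarrow> 'a" where
  "backward_map g \<eta> x =
     (if x \<in> range (\<lambda>x. x + \<eta> *\<^sub>R g x) then inv (\<lambda>x. x + \<eta> *\<^sub>R g x) x else 0)"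

context
  fixes H :: "'a::euclidean_space \<Rightarrow> real" and gradH :: "'a \<Rightarrow> 'a" and \<eta> :: real
  assumes H_convex: "convex_on UNIV H" and H_grad: "\<And>x. GDERIV H x :> gradH x"
    and \<eta>: "0 < \<eta>"
begin

lemma grad_monotone: "0 \<le> (gradH x - gradH y) \<bullet> (x - y)"
  using convex_gradient_inequality[OF H_convex H_grad[of x], of y]
    convex_gradient_inequality[OF H_convex H_grad[of y], of x]
  by (simp add: inner_diff_left inner_diff_right)

text \<open>Monotonicity of the gradient makes the explicit step expansive. This yields injectivity, the
  closed range and the contractivity of the inverse.\<close>
lemma forward_map_expands: "norm (x - y) \<le> norm ((x + \<eta> *\<^sub>R gradH x) - (y + \<eta> *\<^sub>R gradH y))"
proof (cases "x = y")
  case False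
  let ?d = "(x + \<eta> *\<^sub>R gradH x) - (y + \<eta> *\<^sub>R gradH y)"
  have "(norm (x - y))\<^sup>2 \<le> (norm (x - y))\<^sup>2 + \<eta> * ((gradH x - gradH y) \<bullet> (x - y))"
    using grad_monotone[of x y] \<eta> by simp
  also have "\<dots> = ?d \<bullet> (x - y)"
    by (simp add: power2_norm_eq_inner algebra_simps inner_diff_left inner_diff_right inner_add_left inner_add_right)
  also have "\<dots> \<le> norm ?d * norm (x - y)" by (rule norm_cauchy_schwarz)
  finally show ?thesis using False by (simp add: power2_eq_square)
qed simp

lemma backward_forward: "backward_map gradH \<eta> (x + \<eta> *\<^sub>R gradH x) = x"
proof -
  have "inj (\<lambda>x. x + \<eta> *\<^sub>R gradH x)"
  proof (rule injI)
    fix x y assume "x + \<eta> *\<^sub>R gradH x = y + \<eta> *\<^sub>R gradH y"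
    then show "x = y" using forward_map_expands[of x y] by simp
  qed
  then show ?thesis unfolding backward_map_def by (simp add: inv_f_f[of "\<lambda>x. x + \<eta> *\<^sub>R gradH x" x, simplified])
qed

context
  assumes grad_cont: "continuous_on UNIV gradH"
begin

lemma forward_range_closed: "closed (range (\<lambda>x. x + \<eta> *\<^sub>R gradH x))"
  unfolding closed_sequential_limits
proof (intro allI impI, elim conjE)
  fix z l assume z: "\<forall>n. z n \<in> range (\<lambda>x. x + \<eta> *\<^sub>R gradH x)" and l: "z \<longlonglongrightarrow> l"
  then have "\<forall>n. \<exists>x. z n = x + \<eta> *\<^sub>R gradH x" by blast
  then obtain x where x: "\<And>n. z n = x n + \<eta> *\<^sub>R gradH (x n)" by metis
  have "Cauchy x"
  proof (rule metric_CauchyI)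
    fix e :: real assume "0 < e"
    then obtain M where M: "\<And>m n. M \<le> m \<Longrightarrow> M \<le> n \<Longrightarrow> dist (z m) (z n) < e"
      using LIMSEQ_imp_Cauchy[OF l] metric_CauchyD by blast
    have "dist (x m) (x n) < e" if "M \<le> m" "M \<le> n" for m n
      using M[OF that] forward_map_expands[of "x m" "x n"] unfolding x dist_norm by linarith
    then show "\<exists>M. \<forall>m\<ge>M. \<forall>n\<ge>M. dist (x m) (x n) < e" by blast
  qed
  then obtain y where y: "x \<longlonglongrightarrow> y" by (auto simp: Cauchy_convergent_iff convergent_def)
  have "(\<lambda>n. gradH (x n)) \<longlonglongrightarrow> gradH y"
    by (rule continuous_on_tendsto_compose[OF grad_cont y]) auto
  then have "z \<longlonglongrightarrow> y + \<eta> *\<^sub>R gradH y"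
    unfolding x[abs_def] by (intro tendsto_intros y)
  then have "l = y + \<eta> *\<^sub>R gradH y" using l by (simp add: LIMSEQ_unique)
  then show "l \<in> range (\<lambda>x. x + \<eta> *\<^sub>R gradH x)" by blast
qed

lemma backward_map_contracts:
  assumes "x \<in> range (\<lambda>x. x + \<eta> *\<^sub>R gradH x)" "y \<in> range (\<lambda>x. x + \<eta> *\<^sub>R gradH x)"
  shows "norm (backward_map gradH \<eta> x - backward_map gradH \<eta> y) \<le> norm (x - y)"
  using assms forward_map_expands by (auto simp: backward_forward)

lemma backward_map_borel: "backward_map gradH \<eta> \<in> borel_measurable borel"
proof -
  have "1-lipschitz_on (range (\<lambda>x. x + \<eta> *\<^sub>R gradH x)) (backward_map gradH \<eta>)"
    by (rule lipschitz_onI) (use backward_map_contracts in \<open>auto simp: dist_norm\<close>)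
  then have "continuous_on (range (\<lambda>x. x + \<eta> *\<^sub>R gradH x)) (backward_map gradH \<eta>)"
    by (rule lipschitz_on_continuous_on)
  then have "(\<lambda>x. if x \<in> range (\<lambda>x. x + \<eta> *\<^sub>R gradH x) then backward_map gradH \<eta> x else 0) \<in> borel_measurable borel"
    by (intro borel_measurable_continuous_on_if borel_closed forward_range_closed) auto
  moreover have "(\<lambda>x. if x \<in> range (\<lambda>x. x + \<eta> *\<^sub>R gradH x) then backward_map gradH \<eta> x else 0) = backward_map gradH \<eta>"
    by (auto simp: backward_map_def)
  ultimately show ?thesis by simp
qed

lemma forward_map_borel: "(\<lambda>x. x + \<eta> *\<^sub>R gradH x) \<in> borel_measurable borel"
  by (intro borel_measurable_continuous_onI continuous_intros grad_cont)

text \<open>A preimage under the explicit step is an image under its 1-Lipschitz inverse. Therefore the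
  step preserves absolute continuity.\<close>
lemma forward_vimage_null:
  assumes N: "N \<in> null_sets lborel"
  shows "(\<lambda>x. x + \<eta> *\<^sub>R gradH x) -` N \<in> null_sets lborel"
proof -
  let ?f = "\<lambda>x. x + \<eta> *\<^sub>R gradH x"
  have NB: "N \<in> sets borel" using N by auto
  have "negligible N"
    using N by (simp add: negligible_iff_null_sets null_sets_completionI)
  then have neg: "negligible (N \<inter> range ?f)" by (rule negligible_subset) blast
  have "negligible ((backward_map gradH \<eta>) ` (N \<inter> range ?f))"
  proof (rule negligible_locally_Lipschitz_image[OF order_refl neg])
    fix x assume "x \<in> N \<inter> range ?f"
    then show "\<exists>T B. open T \<and> x \<in> T \<and> (\<forall>y\<in>(N \<inter> range ?f) \<inter> T. norm (backward_map gradH \<eta> y - backward_map gradH \<eta> x) \<le> B * norm (y - x))"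
      using backward_map_contracts by (intro exI[of _ UNIV] exI[of _ 1]) auto
  qed
  moreover have "?f -` N \<subseteq> (backward_map gradH \<eta>) ` (N \<inter> range ?f)"
  proof
    fix x assume "x \<in> ?f -` N"
    then show "x \<in> (backward_map gradH \<eta>) ` (N \<inter> range ?f)"
      using backward_forward[of x] by (intro image_eqI[of _ _ "?f x"]) auto
  qed
  ultimately have "negligible (?f -` N)" by (rule negligible_subset)
  moreover have "?f -` N \<in> sets borel"
    using measurable_sets_borel[OF forward_map_borel NB] by simp
  ultimately show ?thesis by (simp add: negligible_iff_null_sets null_sets_completion_iff)
qed

end

end

section \<open>One step of the scheme\<close>

context
  fixes \<H> :: "'a::euclidean_space measure \<Rightarrow> ereal"
    and G H :: "'a \<Rightarrow> real" and gradH :: "'a \<Rightarrow> 'a" and \<eta> L :: real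
  assumes G_convex: "convex_on UNIV G" and G_growth: "quadratic_growth G"
    and H_convex: "convex_on UNIV H" and H_growth: "quadratic_growth H"
    and H_grad: "\<And>x. GDERIV H x :> gradH x" and grad_lip: "L-lipschitz_on UNIV gradH"
    and \<eta>: "0 < \<eta>"
    and \<H>_minf: "never_minf \<H>" and \<H>_proper: "proper_fun \<H>"
    and \<H>_convex: "gen_geodesically_convex \<H>" and \<H>_dom: "dom_fun \<H> \<subseteq> P2_abs"
begin

abbreviation (input) convex_part where "convex_part \<equiv> \<lambda>\<sigma>. ereal (potential G \<sigma>) + \<H> \<sigma>"
abbreviation (input) forward where "forward \<equiv> \<lambda>x. x + \<eta> *\<^sub>R gradH x"

lemma G_cont: "continuous_on UNIV G" by (rule convex_on_continuous[OF open_UNIV G_convex])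
lemma H_cont: "continuous_on UNIV H" by (rule convex_on_continuous[OF open_UNIV H_convex])
lemma grad_cont: "continuous_on UNIV gradH" using grad_lip by (rule lipschitz_on_continuous_on)
lemmas GH_borel = borel_measurable_continuous_onI[OF G_cont] borel_measurable_continuous_onI[OF H_cont]
  borel_measurable_continuous_onI[OF grad_cont]
lemmas G_integrable = quadratic_growth_integrable[OF G_growth G_cont]
lemmas H_integrable = quadratic_growth_integrable[OF H_growth H_cont]
lemmas forward_borel = forward_map_borel[OF H_convex H_grad \<eta> grad_cont]
lemmas backward_of_forward = backward_forward[OF H_convex H_grad \<eta>]
lemmas backward_borel = backward_map_borel[OF H_convex H_grad \<eta> grad_cont]

lemma grad_diff_le: "norm (gradH x - gradH y) \<le> L * norm (x - y)"
  using lipschitz_onD[OF grad_lip, of x y] by (simp add: dist_norm)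

lemma grad_integrable: "\<mu> \<in> P2 \<Longrightarrow> integrable \<mu> (\<lambda>x. (norm (gradH x))\<^sup>2)"
proof (rule P2_integrable[where a = "2 * L\<^sup>2 + 2 * (norm (gradH 0))\<^sup>2"])
  show "(\<lambda>x. (norm (gradH x))\<^sup>2) \<in> borel_measurable borel" using GH_borel(3) by measurable
  show "norm ((norm (gradH x))\<^sup>2) \<le> (2 * L\<^sup>2 + 2 * (norm (gradH 0))\<^sup>2) * ((norm x)\<^sup>2 + 1)" for x
  proof -
    have "(norm (gradH x))\<^sup>2 \<le> 2 * (norm (gradH x - gradH 0))\<^sup>2 + 2 * (norm (gradH 0))\<^sup>2"
      using norm_add_sq_le[of "gradH x - gradH 0" "gradH 0"] by simp
    also have "(norm (gradH x - gradH 0))\<^sup>2 \<le> (L * norm x)\<^sup>2"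
      using grad_diff_le[of x 0] by (intro power_mono) auto
    finally have "(norm (gradH x))\<^sup>2 \<le> 2 * L\<^sup>2 * (norm x)\<^sup>2 + 2 * (norm (gradH 0))\<^sup>2"
      by (simp add: power_mult_distrib)
    also have "\<dots> \<le> (2 * L\<^sup>2 + 2 * (norm (gradH 0))\<^sup>2) * ((norm x)\<^sup>2 + 1)"
      by (simp add: algebra_simps)
    finally show ?thesis by simp
  qed
qed

lemma forward_P2:
  assumes "\<mu> \<in> P2"
  shows "distr \<mu> borel forward \<in> P2"
proof (rule distr_in_P2[OF P2_prob[OF assms]])
  show "forward \<in> borel_measurable \<mu>" using forward_borel by (simp add: P2_measurable[OF assms])
  show "integrable \<mu> (\<lambda>x. (norm (forward x))\<^sup>2)"
  proof (rule Bochner_Integration.integrable_bound)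
    show "integrable \<mu> (\<lambda>x. 2 * (norm x)\<^sup>2 + 2 * (\<eta>\<^sup>2 * (norm (gradH x))\<^sup>2))"
      using P2_integrable_norm_sq[OF assms] grad_integrable[OF assms] by simp
    show "(\<lambda>x. (norm (forward x))\<^sup>2) \<in> borel_measurable \<mu>"
      unfolding P2_measurable[OF assms] using forward_borel by measurable
    show "AE x in \<mu>. norm ((norm (forward x))\<^sup>2) \<le> norm (2 * (norm x)\<^sup>2 + 2 * (\<eta>\<^sup>2 * (norm (gradH x))\<^sup>2))"
      using norm_add_sq_le[of _ "\<eta> *\<^sub>R gradH _"] by (intro AE_I2) (simp add: power_mult_distrib)
  qed
qed

lemma forward_P2_abs:
  assumes "\<mu> \<in> P2_abs"
  shows "distr \<mu> borel forward \<in> P2_abs"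
proof -
  have \<mu>: "\<mu> \<in> P2" and ac: "absolutely_continuous lborel \<mu>" using assms by (auto simp: P2_abs_def)
  have m: "forward \<in> borel_measurable \<mu>" using forward_borel by (simp add: P2_measurable[OF \<mu>])
  have "N \<in> null_sets (distr \<mu> borel forward)" if N: "N \<in> null_sets lborel" for N
  proof -
    have "forward -` N \<in> null_sets \<mu>"
      using forward_vimage_null[OF H_convex H_grad \<eta> grad_cont N] ac by (auto simp: absolutely_continuous_def)
    moreover have "N \<in> sets borel" using N by auto
    ultimately show ?thesis using m P2_space[OF \<mu>] by (intro null_setsI) (auto simp: emeasure_distr)
  qed
  then show ?thesis using forward_P2[OF \<mu>] by (auto simp: P2_abs_def absolutely_continuous_def)
qed

text \<open>The explicit step is the gradient of the convex function \<open>v y = |y|\<^sup>2 / 2 + \<eta> H y\<close>. Together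
  with its Legendre transform, whose value at \<open>x\<close> in the range of the step is \<open>x \<bullet> S x - v (S x)\<close>, it
  forms a pair of potentials without slack on the graph of the inverse \<open>S\<close>.\<close>
lemma backward_is_opt_map:
  assumes \<mu>: "\<mu> \<in> P2"
  shows "is_opt_map (distr \<mu> borel forward) \<mu> (backward_map gradH \<eta>)"
proof -
  let ?S = "backward_map gradH \<eta>"
  define \<nu> where "\<nu> = distr \<mu> borel forward"
  have \<nu>: "\<nu> \<in> P2" unfolding \<nu>_def by (rule forward_P2[OF \<mu>])
  have m: "forward \<in> borel_measurable \<mu>" using forward_borel by (simp add: P2_measurable[OF \<mu>])
  define v where "v y = (norm y)\<^sup>2 / 2 + \<eta> * H y" for y
  define u where "u x = x \<bullet> ?S x - v (?S x)" for x
  have v_borel: "v \<in> borel_measurable borel" unfolding v_def using GH_borel(2) by measurable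
  have u_borel: "u \<in> borel_measurable borel" unfolding u_def using backward_borel v_borel by measurable
  have push: "distr \<nu> borel ?S = \<mu>"
    unfolding \<nu>_def using distr_distr[OF backward_borel m] distr_id2[of borel \<mu>]
    by (simp add: o_def backward_of_forward P2_sets[OF \<mu>])
  have iv: "integrable \<mu> v"
    unfolding v_def using P2_integrable_norm_sq[OF \<mu>] H_integrable[OF \<mu>] by simp
  have i_inner: "integrable \<mu> (\<lambda>a. (a + \<eta> *\<^sub>R gradH a) \<bullet> a)"
  proof (rule Bochner_Integration.integrable_bound)
    have "integrable \<mu> (\<lambda>a. (norm (forward a))\<^sup>2)"
      using integrable_norm_sq_map[OF \<mu> forward_borel] \<nu> by (simp add: \<nu>_def)
    then show "integrable \<mu> (\<lambda>a. (norm (forward a))\<^sup>2 + (norm a)\<^sup>2)"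
      using P2_integrable_norm_sq[OF \<mu>] by simp
    show "(\<lambda>a. (a + \<eta> *\<^sub>R gradH a) \<bullet> a) \<in> borel_measurable \<mu>"
      unfolding P2_measurable[OF \<mu>] using forward_borel by (intro borel_measurable_inner) auto
    show "AE a in \<mu>. norm ((a + \<eta> *\<^sub>R gradH a) \<bullet> a) \<le> norm ((norm (forward a))\<^sup>2 + (norm a)\<^sup>2)"
      using abs_inner_le_norm_sq by (intro AE_I2) simp
  qed
  have iu: "integrable \<nu> u"
    unfolding \<nu>_def using i_inner iv by (subst integrable_distr_eq[OF m u_borel]) (simp add: u_def backward_of_forward)
  have dual: "x \<bullet> y \<le> u x + v y" if x: "x \<in> range forward" for x y
  proof -
    obtain a where a: "x = forward a" using x by blast
    have "\<eta> * (H a + gradH a \<bullet> (y - a)) \<le> \<eta> * H y"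
      using convex_gradient_inequality[OF H_convex H_grad, of a y] \<eta> by (intro mult_left_mono) auto
    moreover have "0 \<le> (norm (y - a))\<^sup>2" by simp
    ultimately show ?thesis
      unfolding a u_def v_def backward_of_forward norm_diff_sq
      by (simp add: power2_norm_eq_inner inner_add_left inner_diff_right algebra_simps inner_commute)
  qed
  have range_AE: "AE x in \<nu>. x \<in> range forward"
    unfolding \<nu>_def using borel_closed[OF forward_range_closed[OF H_convex H_grad \<eta> grad_cont]]
    by (subst AE_distr_iff[OF m]) auto
  define \<gamma> where "\<gamma> = distr \<nu> borel (\<lambda>x. (x, ?S x))"
  have pair: "(\<lambda>x. (x, ?S x)) \<in> borel_measurable \<nu>"
    unfolding P2_measurable[OF \<nu>] by (intro borel_measurable_Pair backward_borel) simp
  have \<gamma>: "\<gamma> \<in> plans \<nu> \<mu>"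
    using plan_of_maps[of "\<lambda>x. x" \<nu> ?S] backward_borel P2_measurable[OF \<nu>] P2_sets[OF \<nu>]
    by (simp add: \<gamma>_def push distr_id2)
  have eq: "AE z in \<gamma>. u (fst z) + v (snd z) = fst z \<bullet> snd z"
  proof -
    have [measurable]: "fst \<in> borel_measurable (borel :: ('a \<times> 'a) measure)"
      "snd \<in> borel_measurable (borel :: ('a \<times> 'a) measure)"
      by (simp_all add: measurable_fst_borel measurable_snd_borel)
    note [measurable] = u_borel v_borel
    have "{z \<in> space borel. u (fst z) + v (snd z) = fst z \<bullet> snd z} \<in> sets (borel :: ('a \<times> 'a) measure)"
      by measurable
    then show ?thesis
      unfolding \<gamma>_def using AE_distr_iff[OF pair] by (simp add: u_def)
  qed
  have "\<gamma> \<in> opt_plans \<nu> \<mu>"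
    by (rule opt_plan_of_potentials[OF \<nu> \<mu> iu iv range_AE _ _ \<gamma> eq, where Y = UNIV]) (auto intro: dual)
  then show ?thesis
    unfolding is_opt_map_def using backward_borel push by (simp add: \<gamma>_def \<nu>_def)
qed

lemma jkoD:
  assumes "m \<in> jko \<eta> convex_part \<nu>"
  shows "m \<in> P2"
    and "\<sigma> \<in> P2 \<Longrightarrow> convex_part m + ereal (1 / (2 * \<eta>) * (W2 \<nu> m)\<^sup>2) \<le> convex_part \<sigma> + ereal (1 / (2 * \<eta>) * (W2 \<nu> \<sigma>)\<^sup>2)"
  using assms by (auto simp: jko_def is_arg_min_linorder)

lemma jko_finite:
  assumes m: "m \<in> jko \<eta> convex_part \<nu>"
  obtains b where "\<H> m = ereal b" "m \<in> P2_abs"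
proof -
  obtain \<sigma> where \<sigma>: "\<sigma> \<in> P2" "\<H> \<sigma> < \<infinity>" using \<H>_proper by (auto simp: proper_fun_def dom_fun_def)
  have "convex_part \<sigma> + ereal (1 / (2 * \<eta>) * (W2 \<nu> \<sigma>)\<^sup>2) < \<infinity>" using \<sigma>(2) by (cases "\<H> \<sigma>") auto
  with jkoD(2)[OF m \<sigma>(1)] have "\<H> m < \<infinity>" by (cases "\<H> m") auto
  moreover have "\<H> m \<noteq> - \<infinity>" using \<H>_minf jkoD(1)[OF m] by (simp add: never_minf_def)
  moreover have "m \<in> P2_abs" using \<H>_dom jkoD(1)[OF m] \<open>\<H> m < \<infinity>\<close> by (auto simp: dom_fun_def)
  ultimately show ?thesis using that by (cases "\<H> m") auto
qed

text \<open>The last term is the strong convexity of the squared distance to \<open>x\<close>.\<close>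
lemma convex_comb_norm_sq:
  "(norm (x - (t *\<^sub>R y + (1 - t) *\<^sub>R z)))\<^sup>2 = t * (norm (x - y))\<^sup>2 + (1 - t) * (norm (x - z))\<^sup>2 - t * (1 - t) * (norm (y - z))\<^sup>2"
  for x y z :: "'b::real_inner"
  unfolding power2_norm_eq_inner
  by (simp add: inner_diff_left inner_diff_right inner_add_left inner_add_right inner_commute algebra_simps power2_eq_square)

text \<open>The JKO minimiser \<open>m\<close> is compared with \<open>t S + (1 - t) T\<close>, the generalized geodesic from \<open>m\<close> to
  \<open>\<mu>\<close> based at \<open>\<nu>\<close>. After division by \<open>t\<close>, the limit \<open>t \<rightarrow> 0\<close> retains the whole strong convexity
  term.\<close>
lemma jko_strong_descent:
  assumes \<nu>a: "\<nu> \<in> P2_abs" and \<mu>: "\<mu> \<in> P2" and m: "m \<in> jko \<eta> convex_part \<nu>"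
    and a: "\<H> \<mu> = ereal a" and b: "\<H> m = ereal b"
    and S: "is_opt_map \<nu> \<mu> S" and T: "is_opt_map \<nu> m T"
  shows "b + potential G m + 1 / (2 * \<eta>) * (\<integral>x. (norm (x - T x))\<^sup>2 \<partial>\<nu>)
     \<le> a + potential G \<mu> + 1 / (2 * \<eta>) * (\<integral>x. (norm (x - S x))\<^sup>2 \<partial>\<nu>)
       - 1 / (2 * \<eta>) * (\<integral>x. (norm (S x - T x))\<^sup>2 \<partial>\<nu>)"
proof -
  have \<nu>: "\<nu> \<in> P2" using \<nu>a by (simp add: P2_abs_def)
  have mP: "m \<in> P2" by (rule jkoD(1)[OF m])
  note Sd = is_opt_mapD[OF S] and Td = is_opt_mapD[OF T]
  have meas: "S \<in> borel_measurable \<nu>" "T \<in> borel_measurable \<nu>" "(\<lambda>x. x) \<in> borel_measurable \<nu>"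
    using Sd Td by (simp_all add: P2_measurable[OF \<nu>])
  have sq: "integrable \<nu> (\<lambda>x. (norm (S x))\<^sup>2)" "integrable \<nu> (\<lambda>x. (norm (T x))\<^sup>2)" "integrable \<nu> (\<lambda>x. (norm x)\<^sup>2)"
    using integrable_norm_sq_map[OF \<nu> Sd(1)] integrable_norm_sq_map[OF \<nu> Td(1)] Sd(2) Td(2) \<mu> mP P2_integrable_norm_sq[OF \<nu>]
    by simp_all
  have ST: "integrable \<nu> (\<lambda>x. (norm (S x - T x))\<^sup>2)" "integrable \<nu> (\<lambda>x. (norm (x - S x))\<^sup>2)" "integrable \<nu> (\<lambda>x. (norm (x - T x))\<^sup>2)"
    using meas sq by (auto intro: integrable_norm_diff_sq)
  define A where "A = (\<integral>x. (norm (x - T x))\<^sup>2 \<partial>\<nu>)"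
  define B where "B = (\<integral>x. (norm (x - S x))\<^sup>2 \<partial>\<nu>)"
  define C where "C = (\<integral>x. (norm (S x - T x))\<^sup>2 \<partial>\<nu>)"
  define P where "P = b + potential G m"
  define Q where "Q = a + potential G \<mu>"
  define k where "k = 1 / (2 * \<eta>)"
  have k: "0 < k" using \<eta> by (simp add: k_def)
  have iG: "integrable \<nu> (\<lambda>x. G (S x))" "integrable \<nu> (\<lambda>x. G (T x))"
    using integrable_distr_eq[OF meas(1) GH_borel(1)] integrable_distr_eq[OF meas(2) GH_borel(1)]
      G_integrable[OF \<mu>] G_integrable[OF mP] Sd(2) Td(2) by simp_all
  have pG: "potential G \<mu> = (\<integral>x. G (S x) \<partial>\<nu>)" "potential G m = (\<integral>x. G (T x) \<partial>\<nu>)"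
    using integral_distr[OF meas(1) GH_borel(1)] integral_distr[OF meas(2) GH_borel(1)] Sd(2) Td(2)
    by (simp_all add: potential_def)
  have ineq: "(1 - t) * (k * C) \<le> Q + k * B - P - k * A" if t: "0 < t" "t < 1" for t
  proof -
    define U where "U x = t *\<^sub>R S x + (1 - t) *\<^sub>R T x" for x
    define \<sigma> where "\<sigma> = distr \<nu> borel U"
    have U_borel: "U \<in> borel_measurable borel" unfolding U_def using Sd(1) Td(1) by measurable
    then have U: "U \<in> borel_measurable \<nu>" by (simp add: P2_measurable[OF \<nu>])
    have iU: "integrable \<nu> (\<lambda>x. (norm (U x))\<^sup>2)"
    proof (rule Bochner_Integration.integrable_bound)
      show "integrable \<nu> (\<lambda>x. 2 * (t\<^sup>2 * (norm (S x))\<^sup>2) + 2 * ((1 - t)\<^sup>2 * (norm (T x))\<^sup>2))" using sq by simp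
      show "(\<lambda>x. (norm (U x))\<^sup>2) \<in> borel_measurable \<nu>" using U by measurable
      show "AE x in \<nu>. norm ((norm (U x))\<^sup>2) \<le> norm (2 * (t\<^sup>2 * (norm (S x))\<^sup>2) + 2 * ((1 - t)\<^sup>2 * (norm (T x))\<^sup>2))"
        using norm_add_sq_le[of "t *\<^sub>R S _" "(1 - t) *\<^sub>R T _"]
        by (intro AE_I2) (simp add: U_def power_mult_distrib)
    qed
    have \<sigma>: "\<sigma> \<in> P2" unfolding \<sigma>_def by (rule distr_in_P2[OF P2_prob[OF \<nu>] U iU])
    have h: "\<H> \<sigma> \<le> ereal (t * a + (1 - t) * b)"
      using \<H>_convex[unfolded gen_geodesically_convex_def, rule_format, OF \<mu> mP \<nu>a _ S T, of t] t
      by (simp add: \<sigma>_def U_def[abs_def] a b)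
    have g: "potential G \<sigma> \<le> t * potential G \<mu> + (1 - t) * potential G m"
    proof -
      have "potential G \<sigma> = (\<integral>x. G (U x) \<partial>\<nu>)"
        unfolding potential_def \<sigma>_def by (rule integral_distr[OF U GH_borel(1)])
      also have "\<dots> \<le> (\<integral>x. t * G (S x) + (1 - t) * G (T x) \<partial>\<nu>)"
      proof (rule integral_mono)
        show "integrable \<nu> (\<lambda>x. G (U x))"
          using integrable_distr_eq[OF U GH_borel(1)] G_integrable[OF \<sigma>] by (simp add: \<sigma>_def)
        show "integrable \<nu> (\<lambda>x. t * G (S x) + (1 - t) * G (T x))" using iG by simp
        show "G (U x) \<le> t * G (S x) + (1 - t) * G (T x)" for x
          using convex_onD[OF G_convex, of t "T x" "S x"] t by (simp add: U_def algebra_simps)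
      qed
      also have "\<dots> = t * potential G \<mu> + (1 - t) * potential G m" using iG by (simp add: pG)
      finally show ?thesis .
    qed
    have w: "(W2 \<nu> \<sigma>)\<^sup>2 \<le> t * B + (1 - t) * A - t * (1 - t) * C"
    proof -
      have "distr \<nu> borel (\<lambda>x. x) = \<nu>" by (rule distr_id2) (simp add: P2_sets[OF \<nu>])
      then have "(W2 \<nu> \<sigma>)\<^sup>2 \<le> (\<integral>x. (norm (x - U x))\<^sup>2 \<partial>\<nu>)"
        using W2_sq_le_maps[OF meas(3) U] \<nu> \<sigma> by (simp add: \<sigma>_def)
      also have "\<dots> = t * B + (1 - t) * A - t * (1 - t) * C"
        unfolding U_def convex_comb_norm_sq using ST by (simp add: A_def B_def C_def)
      finally show ?thesis .
    qed
    have "convex_part m + ereal (k * A) \<le> convex_part \<sigma> + ereal (k * (W2 \<nu> \<sigma>)\<^sup>2)"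
      using jkoD(2)[OF m \<sigma>] W2_sq_opt_map[OF \<nu> T] by (simp add: k_def A_def)
    also have "\<dots> \<le> ereal (t * potential G \<mu> + (1 - t) * potential G m) + ereal (t * a + (1 - t) * b)
        + ereal (k * (t * B + (1 - t) * A - t * (1 - t) * C))"
      using h g w k by (intro add_mono) auto
    finally have "P + k * A \<le> t * Q + (1 - t) * P + k * (t * B + (1 - t) * A - t * (1 - t) * C)"
      by (simp add: b P_def Q_def algebra_simps)
    then have "t * ((1 - t) * (k * C)) \<le> t * (Q + k * B - P - k * A)" by (simp add: algebra_simps)
    then show ?thesis using t by simp
  qed
  have "k * C \<le> Q + k * B - P - k * A"
  proof (rule tendsto_upperbound)
    show "((\<lambda>t. (1 - t) * (k * C)) \<longlongrightarrow> k * C) (at_right 0)"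
      by (rule tendsto_eq_intros refl | simp)+
    show "eventually (\<lambda>t. (1 - t) * (k * C) \<le> Q + k * B - P - k * A) (at_right 0)"
      by (rule eventually_at_rightI[of 0 1]) (use ineq in auto)
  qed simp
  then show ?thesis by (simp add: A_def B_def C_def P_def Q_def k_def)
qed

lemma objective_eq:
  assumes "\<H> \<mu> = ereal a"
  shows "objective \<H> G H \<mu> = ereal (a + potential G \<mu> - potential H \<mu>)"
  using assms by (simp add: objective_def)

text \<open>
  Let \<open>\<gamma>\<close> be an optimal plan from \<open>m\<close> to a competitor \<open>\<sigma>\<close>. Applying \<open>R\<close> to its first coordinate
  gives a plan from \<open>\<nu>\<close> to \<open>\<sigma>\<close>, and expanding \<open>|R x - y|\<^sup>2\<close> around \<open>|R x - x|\<^sup>2\<close> in the minimality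
  of \<open>m\<close> produces \<open>(R x - x) / \<eta>\<close> up to a quadratic error. The concave part \<open>- H\<close> contributes
  \<open>- \<nabla>H\<close>, again up to a quadratic error because \<open>\<nabla>H\<close> is Lipschitz.
\<close>
lemma jko_frechet_subgradient:
  assumes \<nu>: "\<nu> \<in> P2" and m: "m \<in> jko \<eta> convex_part \<nu>" and R: "is_opt_map m \<nu> R"
  shows "(\<lambda>z. (1 / \<eta>) *\<^sub>R (R z - z) - gradH z) \<in> frechet_subdiff (objective \<H> G H) m"
proof -
  obtain b where b: "\<H> m = ereal b" using jko_finite[OF m] by blast
  have mP: "m \<in> P2" by (rule jkoD(1)[OF m])
  note Rd = is_opt_mapD[OF R]
  define \<xi> where "\<xi> z = (1 / \<eta>) *\<^sub>R (R z - z) - gradH z" for z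
  have \<xi>_borel: "\<xi> \<in> borel_measurable borel" unfolding \<xi>_def using Rd(1) GH_borel(3) by measurable
  have R2: "integrable m (\<lambda>z. (norm (R z))\<^sup>2)" using integrable_norm_sq_map[OF mP Rd(1)] Rd(2) \<nu> by simp
  have Rz: "integrable m (\<lambda>z. (norm (R z - z))\<^sup>2)"
    using Rd(1) R2 P2_integrable_norm_sq[OF mP] by (intro integrable_norm_diff_sq) (simp_all add: P2_measurable[OF mP])
  have \<xi>2: "integrable m (\<lambda>z. (norm (\<xi> z))\<^sup>2)"
    unfolding \<xi>_def
  proof (rule integrable_norm_diff_sq)
    show "(\<lambda>x. (1 / \<eta>) *\<^sub>R (R x - x)) \<in> borel_measurable m" "gradH \<in> borel_measurable m"
      using Rd(1) GH_borel(3) by (auto simp: P2_measurable[OF mP])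
    show "integrable m (\<lambda>x. (norm ((1 / \<eta>) *\<^sub>R (R x - x)))\<^sup>2)"
      using Rz by (simp add: power_mult_distrib power_divide)
    show "integrable m (\<lambda>x. (norm (gradH x))\<^sup>2)" by (rule grad_integrable[OF mP])
  qed
  define K where "K = 1 / (2 * \<eta>) + L"
  define r where "r s = - K * s\<^sup>2" for s :: real
  have r: "r \<in> o[at_right 0](\<lambda>s. s)"
  proof (rule smalloI_tendsto)
    have "((\<lambda>s. - K * s) \<longlongrightarrow> - K * 0) (at_right 0)" by (intro tendsto_intros)
    moreover have "eventually (\<lambda>s. - K * s = r s / s) (at_right 0)"
      using eventually_at_right_less[of 0] by eventually_elim (simp add: r_def power2_eq_square)
    ultimately show "((\<lambda>s. r s / s) \<longlongrightarrow> 0) (at_right 0)"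
      by (simp add: tendsto_cong)
    show "eventually (\<lambda>s. s \<noteq> 0) (at_right (0::real))"
      using eventually_at_right_less[of 0] by eventually_elim simp
  qed
  have main: "(SUP \<gamma> \<in> opt_plans m \<sigma>. ereal (\<integral>(x, y). \<xi> x \<bullet> (y - x) \<partial>\<gamma>)) + ereal (r (W2 m \<sigma>))
      \<le> objective \<H> G H \<sigma> - objective \<H> G H m" if \<sigma>: "\<sigma> \<in> P2" for \<sigma>
  proof (cases "\<H> \<sigma>")
    case PInf
    then show ?thesis by (simp add: objective_eq[OF b] objective_def)
  next
    case MInf
    then show ?thesis using \<H>_minf \<sigma> by (simp add: never_minf_def)
  next
    case (real h)
    define dF where "dF = (h + potential G \<sigma> - potential H \<sigma>) - (b + potential G m - potential H m)"
    have "(\<integral>(x, y). \<xi> x \<bullet> (y - x) \<partial>\<gamma>) \<le> dF + K * (W2 m \<sigma>)\<^sup>2" if \<gamma>: "\<gamma> \<in> opt_plans m \<sigma>" for \<gamma>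
    proof -
      note p = mP \<sigma> opt_plansD(1)[OF \<gamma>]
      have Rf: "(\<lambda>z. R (fst z)) \<in> borel_measurable \<gamma>" using measurable_compose[OF plan_fst[OF p] Rd(1)] .
      have \<xi>f: "(\<lambda>z. \<xi> (fst z)) \<in> borel_measurable \<gamma>" using measurable_compose[OF plan_fst[OF p] \<xi>_borel] .
      note meas = Rf \<xi>f plan_fst[OF p] plan_snd[OF p]
      have borel2: "(\<lambda>z. (norm (R z - z))\<^sup>2) \<in> borel_measurable borel" "(\<lambda>z. (norm (R z))\<^sup>2) \<in> borel_measurable borel"
        "(\<lambda>z. (norm (\<xi> z))\<^sup>2) \<in> borel_measurable borel"
        using Rd(1) \<xi>_borel by measurable
      have i: "integrable \<gamma> (\<lambda>z. (norm (R (fst z) - fst z))\<^sup>2)" "integrable \<gamma> (\<lambda>z. (norm (R (fst z)))\<^sup>2)"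
        "integrable \<gamma> (\<lambda>z. (norm (\<xi> (fst z)))\<^sup>2)"
        "integrable \<gamma> (\<lambda>z. H (fst z))" "integrable \<gamma> (\<lambda>z. H (snd z))" "integrable \<gamma> (\<lambda>z. (norm (fst z - snd z))\<^sup>2)"
        using plan_integrable_fst[OF p borel2(1)] plan_integrable_fst[OF p borel2(2)] plan_integrable_fst[OF p borel2(3)]
          plan_integrable_fst[OF p GH_borel(2)] plan_integrable_snd[OF p GH_borel(2)]
          Rz R2 \<xi>2 H_integrable[OF mP] H_integrable[OF \<sigma>] plan_integrable_norm_sq[OF p] by simp_all
      have iRy: "integrable \<gamma> (\<lambda>z. (norm (R (fst z) - snd z))\<^sup>2)"
        by (rule integrable_norm_diff_sq[OF Rf plan_snd[OF p] i(2) plan_integrable_snd_sq[OF p]])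
      have i\<xi>: "integrable \<gamma> (\<lambda>z. \<xi> (fst z) \<bullet> (snd z - fst z))"
      proof (rule Bochner_Integration.integrable_bound)
        show "integrable \<gamma> (\<lambda>z. (norm (\<xi> (fst z)))\<^sup>2 + (norm (fst z - snd z))\<^sup>2)" using i by simp
        show "(\<lambda>z. \<xi> (fst z) \<bullet> (snd z - fst z)) \<in> borel_measurable \<gamma>" using meas by measurable
        show "AE z in \<gamma>. norm (\<xi> (fst z) \<bullet> (snd z - fst z)) \<le> norm ((norm (\<xi> (fst z)))\<^sup>2 + (norm (fst z - snd z))\<^sup>2)"
        proof (rule AE_I2)
          fix z :: "'a \<times> 'a"
          show "norm (\<xi> (fst z) \<bullet> (snd z - fst z)) \<le> norm ((norm (\<xi> (fst z)))\<^sup>2 + (norm (fst z - snd z))\<^sup>2)"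
            using abs_inner_le_norm_sq[of "\<xi> (fst z)" "snd z - fst z"] by (simp add: norm_minus_commute)
        qed
      qed
      have pw: "\<xi> x \<bullet> (y - x) \<le> 1 / (2 * \<eta>) * (norm (R x - x))\<^sup>2 - 1 / (2 * \<eta>) * (norm (R x - y))\<^sup>2 + (H x - H y) + K * (norm (x - y))\<^sup>2" for x y
      proof -
        have "H y - H x \<le> gradH y \<bullet> (y - x)"
          using convex_gradient_inequality[OF H_convex H_grad, of y x] by (simp add: inner_diff_right)
        also have "\<dots> = gradH x \<bullet> (y - x) + (gradH y - gradH x) \<bullet> (y - x)" by (simp add: inner_diff_left)
        also have "(gradH y - gradH x) \<bullet> (y - x) \<le> norm (gradH y - gradH x) * norm (y - x)"
          by (rule norm_cauchy_schwarz)
        also have "\<dots> \<le> (L * norm (y - x)) * norm (y - x)"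
          by (intro mult_right_mono grad_diff_le) simp
        finally have 1: "H y - H x \<le> gradH x \<bullet> (y - x) + L * (norm (x - y))\<^sup>2"
          by (simp add: power2_eq_square norm_minus_commute mult.assoc)
        have "(norm (R x - y))\<^sup>2 = (norm (R x - x))\<^sup>2 - 2 * ((R x - x) \<bullet> (y - x)) + (norm (x - y))\<^sup>2"
          unfolding power2_norm_eq_inner
          by (simp add: inner_diff_left inner_diff_right inner_commute)
        then have "(R x - x) \<bullet> (y - x) = ((norm (R x - x))\<^sup>2 - (norm (R x - y))\<^sup>2 + (norm (x - y))\<^sup>2) / 2" by simp
        then have 2: "(1 / \<eta>) * ((R x - x) \<bullet> (y - x)) = 1 / (2 * \<eta>) * (norm (R x - x))\<^sup>2 - 1 / (2 * \<eta>) * (norm (R x - y))\<^sup>2 + 1 / (2 * \<eta>) * (norm (x - y))\<^sup>2"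
          using \<eta> by (simp add: field_simps)
        have "\<xi> x \<bullet> (y - x) = (1 / \<eta>) * ((R x - x) \<bullet> (y - x)) - gradH x \<bullet> (y - x)"
          by (simp add: \<xi>_def inner_diff_left)
        then show ?thesis using 1 2 unfolding K_def distrib_right by linarith
      qed
      have "(\<integral>(x, y). \<xi> x \<bullet> (y - x) \<partial>\<gamma>) = (\<integral>z. \<xi> (fst z) \<bullet> (snd z - fst z) \<partial>\<gamma>)"
        by (simp add: case_prod_unfold)
      also have "\<dots> \<le> (\<integral>z. 1 / (2 * \<eta>) * (norm (R (fst z) - fst z))\<^sup>2 - 1 / (2 * \<eta>) * (norm (R (fst z) - snd z))\<^sup>2
          + (H (fst z) - H (snd z)) + K * (norm (fst z - snd z))\<^sup>2 \<partial>\<gamma>)"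
        by (rule integral_mono[OF i\<xi>]) (use i iRy pw in simp_all)
      also have "\<dots> = 1 / (2 * \<eta>) * (\<integral>z. (norm (R (fst z) - fst z))\<^sup>2 \<partial>\<gamma>) - 1 / (2 * \<eta>) * (\<integral>z. (norm (R (fst z) - snd z))\<^sup>2 \<partial>\<gamma>)
          + ((\<integral>z. H (fst z) \<partial>\<gamma>) - (\<integral>z. H (snd z) \<partial>\<gamma>)) + K * (\<integral>z. (norm (fst z - snd z))\<^sup>2 \<partial>\<gamma>)"
        using i iRy by simp
      also have "(\<integral>z. (norm (R (fst z) - fst z))\<^sup>2 \<partial>\<gamma>) = (W2 \<nu> m)\<^sup>2"
        using plan_integral_fst[OF p borel2(1)] opt_map_flip(2)[OF mP R] by simp
      also have "(\<integral>z. H (fst z) \<partial>\<gamma>) = potential H m"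
        using plan_integral_fst[OF p GH_borel(2)] by (simp add: potential_def)
      also have "(\<integral>z. H (snd z) \<partial>\<gamma>) = potential H \<sigma>"
        using plan_integral_snd[OF p GH_borel(2)] by (simp add: potential_def)
      also have "(\<integral>z. (norm (fst z - snd z))\<^sup>2 \<partial>\<gamma>) = (W2 m \<sigma>)\<^sup>2"
        using W2_sq_opt[OF \<gamma>] by (simp add: transport_cost_def case_prod_unfold)
      finally have le: "(\<integral>(x, y). \<xi> x \<bullet> (y - x) \<partial>\<gamma>) \<le> 1 / (2 * \<eta>) * (W2 \<nu> m)\<^sup>2
          - 1 / (2 * \<eta>) * (\<integral>z. (norm (R (fst z) - snd z))\<^sup>2 \<partial>\<gamma>) + (potential H m - potential H \<sigma>) + K * (W2 m \<sigma>)\<^sup>2" .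
      have "distr \<gamma> borel (\<lambda>z. R (fst z)) = \<nu>"
        using distr_distr[OF Rd(1) plan_fst[OF p]] plan_distr(1)[OF p] Rd(2) by (simp add: o_def)
      then have "(W2 \<nu> \<sigma>)\<^sup>2 \<le> (\<integral>z. (norm (R (fst z) - snd z))\<^sup>2 \<partial>\<gamma>)"
        using W2_sq_le_maps[OF Rf plan_snd[OF p]] \<nu> \<sigma> by (simp add: plan_distr(2)[OF p])
      then have "1 / (2 * \<eta>) * (W2 \<nu> \<sigma>)\<^sup>2 \<le> 1 / (2 * \<eta>) * (\<integral>z. (norm (R (fst z) - snd z))\<^sup>2 \<partial>\<gamma>)"
        using \<eta> by (intro mult_left_mono) auto
      moreover have "potential G m + b + 1 / (2 * \<eta>) * (W2 \<nu> m)\<^sup>2 \<le> potential G \<sigma> + h + 1 / (2 * \<eta>) * (W2 \<nu> \<sigma>)\<^sup>2"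
        using jkoD(2)[OF m \<sigma>] by (simp add: b real)
      ultimately show ?thesis using le unfolding dF_def by linarith
    qed
    then have "(SUP \<gamma> \<in> opt_plans m \<sigma>. ereal (\<integral>(x, y). \<xi> x \<bullet> (y - x) \<partial>\<gamma>)) \<le> ereal (dF + K * (W2 m \<sigma>)\<^sup>2)"
      by (intro SUP_least) simp
    then have "(SUP \<gamma> \<in> opt_plans m \<sigma>. ereal (\<integral>(x, y). \<xi> x \<bullet> (y - x) \<partial>\<gamma>)) + ereal (r (W2 m \<sigma>))
        \<le> ereal (dF + K * (W2 m \<sigma>)\<^sup>2) + ereal (r (W2 m \<sigma>))" by (rule add_right_mono)
    then show ?thesis by (simp add: r_def dF_def objective_eq[OF b] objective_eq[OF real])
  qed
  have "m \<in> dom_fun (objective \<H> G H)" using mP by (simp add: dom_fun_def objective_eq[OF b])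
  moreover have "\<xi> \<in> L2 m" using \<xi>_borel \<xi>2 by (simp add: L2_def)
  ultimately have "\<xi> \<in> frechet_subdiff (objective \<H> G H) m"
    unfolding frechet_subdiff_def using r main by blast
  then show ?thesis by (simp add: \<xi>_def[abs_def])
qed

text \<open>All integrals are transported to \<open>\<mu>\<close> by \<open>x \<mapsto> x + \<eta> \<nabla>H x\<close>, where \<open>S\<close> becomes the identity and
  \<open>T\<close> becomes \<open>Z\<close>. Both the decrease of the objective and the norm of the subgradient are then
  expressed by the same quantity \<open>D = \<integral> |x - Z x|\<^sup>2\<close>.\<close>
proposition semi_fb_step:
  assumes \<mu>a: "\<mu> \<in> P2_abs" and a: "\<H> \<mu> = ereal a"
    and m: "m \<in> jko \<eta> convex_part (distr \<mu> borel forward)"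
  shows "\<exists>b \<xi>. m \<in> P2_abs \<and> \<H> m = ereal b \<and> \<xi> \<in> frechet_subdiff (objective \<H> G H) m \<and>
    (L2_norm_wrt m \<xi>)\<^sup>2 \<le> 2 * (\<eta>\<^sup>2 * L\<^sup>2 + 1) / \<eta> *
      ((a + potential G \<mu> - potential H \<mu>) - (b + potential G m - potential H m))"
proof -
  obtain b where b: "\<H> m = ereal b" and ma: "m \<in> P2_abs" by (rule jko_finite[OF m])
  have \<mu>: "\<mu> \<in> P2" and mP: "m \<in> P2" using \<mu>a ma by (auto simp: P2_abs_def)
  define \<nu> where "\<nu> = distr \<mu> borel forward"
  have \<nu>a: "\<nu> \<in> P2_abs" unfolding \<nu>_def by (rule forward_P2_abs[OF \<mu>a])
  have \<nu>: "\<nu> \<in> P2" using \<nu>a by (simp add: P2_abs_def)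
  note m' = m[folded \<nu>_def]
  obtain R where R: "is_opt_map m \<nu> R" using optimal_map_exists_unique[OF ma \<nu>] by blast
  obtain T where T: "is_opt_map \<nu> m T" and T_unique: "\<And>\<gamma>. \<gamma> \<in> opt_plans \<nu> m \<Longrightarrow> \<gamma> = distr \<nu> borel (\<lambda>x. (x, T x))"
    using optimal_map_exists_unique[OF \<nu>a mP] by blast
  note Td = is_opt_mapD[OF T] and Rd = is_opt_mapD[OF R]
  define S where "S = backward_map gradH \<eta>"
  have S: "is_opt_map \<nu> \<mu> S" unfolding S_def \<nu>_def by (rule backward_is_opt_map[OF \<mu>])
  have S_forward: "S (forward x) = x" for x unfolding S_def by (rule backward_of_forward)
  have fm: "forward \<in> borel_measurable \<mu>" using forward_borel by (simp add: P2_measurable[OF \<mu>])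
  have int_\<nu>: "(\<integral>x. F x \<partial>\<nu>) = (\<integral>x. F (forward x) \<partial>\<mu>)" if "F \<in> borel_measurable borel" for F :: "'a \<Rightarrow> real"
    unfolding \<nu>_def by (rule integral_distr[OF fm that])
  define Z where "Z x = T (forward x)" for x
  have Z_borel: "Z \<in> borel_measurable borel" unfolding Z_def by (rule measurable_compose[OF forward_borel Td(1)])
  then have Zm: "Z \<in> borel_measurable \<mu>" by (simp add: P2_measurable[OF \<mu>])
  have Z_push: "distr \<mu> borel Z = m"
    using distr_distr[OF Td(1) fm] Td(2) by (simp add: \<nu>_def o_def Z_def[abs_def])
  have sq: "integrable \<mu> (\<lambda>x. (norm x)\<^sup>2)" "integrable \<mu> (\<lambda>x. (norm (forward x))\<^sup>2)" "integrable \<mu> (\<lambda>x. (norm (Z x))\<^sup>2)"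
    using P2_integrable_norm_sq[OF \<mu>] integrable_norm_sq_map[OF \<mu> forward_borel] integrable_norm_sq_map[OF \<mu> Z_borel]
      \<nu> mP by (simp_all add: \<nu>_def Z_push)
  have idm: "(\<lambda>x. x) \<in> borel_measurable \<mu>" by (simp add: P2_measurable[OF \<mu>])
  have i: "integrable \<mu> (\<lambda>x. (norm (x - Z x))\<^sup>2)" "integrable \<mu> (\<lambda>x. (norm (forward x - Z x))\<^sup>2)" "integrable \<mu> (\<lambda>x. (norm (forward x - x))\<^sup>2)"
    by (rule integrable_norm_diff_sq[OF idm Zm sq(1,3)] integrable_norm_diff_sq[OF fm Zm sq(2,3)]
          integrable_norm_diff_sq[OF fm idm sq(2,1)])+
  define D where "D = (\<integral>x. (norm (x - Z x))\<^sup>2 \<partial>\<mu>)"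
  have iHZ: "integrable \<mu> (\<lambda>x. H (Z x))"
    using integrable_distr_eq[OF Zm GH_borel(2)] H_integrable[OF mP] by (simp add: Z_push)
  have pHm: "potential H m = (\<integral>x. H (Z x) \<partial>\<mu>)"
    using integral_distr[OF Zm GH_borel(2)] by (simp add: potential_def Z_push)
  have descent: "D / \<eta> \<le> (a + potential G \<mu> - potential H \<mu>) - (b + potential G m - potential H m)"
  proof -
    have [measurable]: "S \<in> borel_measurable borel" "T \<in> borel_measurable borel"
      using is_opt_mapD(1)[OF S] Td(1) by auto
    have e: "(\<integral>x. (norm (x - T x))\<^sup>2 \<partial>\<nu>) = (\<integral>x. (norm (forward x - Z x))\<^sup>2 \<partial>\<mu>)"
      "(\<integral>x. (norm (x - S x))\<^sup>2 \<partial>\<nu>) = (\<integral>x. (norm (forward x - x))\<^sup>2 \<partial>\<mu>)"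
      "(\<integral>x. (norm (S x - T x))\<^sup>2 \<partial>\<nu>) = D"
      by (subst int_\<nu>, measurable, simp add: S_forward Z_def D_def)+
    have "potential H \<mu> - potential H m = (\<integral>x. H x - H (Z x) \<partial>\<mu>)"
      using iHZ H_integrable[OF \<mu>] by (simp add: pHm[unfolded potential_def] potential_def)
    also have "\<dots> \<le> (\<integral>x. 1 / (2 * \<eta>) * ((norm (forward x - Z x))\<^sup>2 - (norm (forward x - x))\<^sup>2 - (norm (x - Z x))\<^sup>2) \<partial>\<mu>)"
    proof (rule integral_mono)
      show "integrable \<mu> (\<lambda>x. H x - H (Z x))" using iHZ H_integrable[OF \<mu>] by simp
      show "integrable \<mu> (\<lambda>x. 1 / (2 * \<eta>) * ((norm (forward x - Z x))\<^sup>2 - (norm (forward x - x))\<^sup>2 - (norm (x - Z x))\<^sup>2))"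
        using i by simp
      fix x
      have "(norm (forward x - Z x))\<^sup>2 - (norm (forward x - x))\<^sup>2 - (norm (x - Z x))\<^sup>2 = 2 * \<eta> * (gradH x \<bullet> (x - Z x))"
        unfolding power2_norm_eq_inner
        by (simp add: inner_diff_left inner_diff_right inner_add_left inner_add_right inner_commute algebra_simps)
      then have "1 / (2 * \<eta>) * ((norm (forward x - Z x))\<^sup>2 - (norm (forward x - x))\<^sup>2 - (norm (x - Z x))\<^sup>2) = gradH x \<bullet> (x - Z x)"
        using \<eta> by simp
      moreover have "H x - H (Z x) \<le> gradH x \<bullet> (x - Z x)"
        using convex_gradient_inequality[OF H_convex H_grad, of x "Z x"] by (simp add: inner_diff_right)
      ultimately show "H x - H (Z x) \<le> 1 / (2 * \<eta>) * ((norm (forward x - Z x))\<^sup>2 - (norm (forward x - x))\<^sup>2 - (norm (x - Z x))\<^sup>2)" by simp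
    qed
    also have "\<dots> = 1 / (2 * \<eta>) * ((\<integral>x. (norm (forward x - Z x))\<^sup>2 \<partial>\<mu>) - (\<integral>x. (norm (forward x - x))\<^sup>2 \<partial>\<mu>) - D)"
      using i by (simp add: D_def)
    also have "\<dots> = 1 / (2 * \<eta>) * (\<integral>x. (norm (forward x - Z x))\<^sup>2 \<partial>\<mu>) - 1 / (2 * \<eta>) * (\<integral>x. (norm (forward x - x))\<^sup>2 \<partial>\<mu>) - 1 / (2 * \<eta>) * D"
      by (simp only: right_diff_distrib)
    finally have "potential H \<mu> - potential H m \<le> \<dots>" .
    moreover have "D / \<eta> = 1 / (2 * \<eta>) * D + 1 / (2 * \<eta>) * D" using \<eta> by (simp add: field_simps)
    ultimately show ?thesis using jko_strong_descent[OF \<nu>a \<mu> m' a b S T] unfolding e by linarith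
  qed
  define \<xi> where "\<xi> z = (1 / \<eta>) *\<^sub>R (R z - z) - gradH z" for z
  have \<xi>: "\<xi> \<in> frechet_subdiff (objective \<H> G H) m"
    unfolding \<xi>_def by (rule jko_frechet_subgradient[OF \<nu> m' R])
  have "(L2_norm_wrt m \<xi>)\<^sup>2 \<le> 2 * (\<eta>\<^sup>2 * L\<^sup>2 + 1) / \<eta>\<^sup>2 * D"
  proof -
    define \<psi> where "\<psi> p = (norm ((1 / \<eta>) *\<^sub>R (fst p - snd p) - gradH (snd p)))\<^sup>2" for p :: "'a \<times> 'a"
    have "continuous_on UNIV \<psi>"
      unfolding \<psi>_def by (intro continuous_intros continuous_on_compose2[OF grad_cont]) auto
    then have \<psi>: "\<psi> \<in> borel_measurable borel" by (rule borel_measurable_continuous_onI)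
    have pair: "(\<lambda>z. (R z, z)) \<in> borel_measurable m" "(\<lambda>x. (x, T x)) \<in> borel_measurable \<nu>"
      unfolding P2_measurable[OF mP] P2_measurable[OF \<nu>] by (auto intro!: borel_measurable_Pair Rd(1) Td(1))
    have "(L2_norm_wrt m \<xi>)\<^sup>2 = (\<integral>z. (norm (\<xi> z))\<^sup>2 \<partial>m)"
      by (simp add: L2_norm_wrt_def integral_nonneg_AE)
    also have "\<dots> = (\<integral>p. \<psi> p \<partial>distr m borel (\<lambda>z. (R z, z)))"
      by (subst integral_distr[OF pair(1) \<psi>]) (simp add: \<psi>_def \<xi>_def)
    \<comment> \<open>Both describe the optimal plan from \<open>\<nu>\<close> to \<open>m\<close>, which is unique.\<close>
    also have "distr m borel (\<lambda>z. (R z, z)) = distr \<nu> borel (\<lambda>x. (x, T x))"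
      by (rule T_unique[OF opt_map_flip(1)[OF mP R]])
    also have "(\<integral>p. \<psi> p \<partial>distr \<nu> borel (\<lambda>x. (x, T x))) = (\<integral>x. \<psi> (x, T x) \<partial>\<nu>)"
      by (rule integral_distr[OF pair(2) \<psi>])
    also have "\<dots> = (\<integral>x. \<psi> (forward x, Z x) \<partial>\<mu>)"
    proof -
      have "(\<lambda>x. \<psi> (x, T x)) \<in> borel_measurable borel"
        by (rule measurable_compose[OF _ \<psi>]) (auto intro!: borel_measurable_Pair Td(1))
      then show ?thesis by (simp add: int_\<nu> Z_def)
    qed
    also have "\<dots> \<le> (\<integral>x. 2 * (\<eta>\<^sup>2 * L\<^sup>2 + 1) / \<eta>\<^sup>2 * (norm (x - Z x))\<^sup>2 \<partial>\<mu>)"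
    proof (rule integral_mono_AE')
      show "integrable \<mu> (\<lambda>x. 2 * (\<eta>\<^sup>2 * L\<^sup>2 + 1) / \<eta>\<^sup>2 * (norm (x - Z x))\<^sup>2)" using i by simp
      show "AE x in \<mu>. 0 \<le> 2 * (\<eta>\<^sup>2 * L\<^sup>2 + 1) / \<eta>\<^sup>2 * (norm (x - Z x))\<^sup>2" by simp
      have "\<psi> (forward x, Z x) \<le> 2 * (\<eta>\<^sup>2 * L\<^sup>2 + 1) / \<eta>\<^sup>2 * (norm (x - Z x))\<^sup>2" for x
      proof -
        have "(1 / \<eta>) *\<^sub>R (forward x - Z x) - gradH (Z x) = (1 / \<eta>) *\<^sub>R (x - Z x) + (gradH x - gradH (Z x))"
          using \<eta> by (simp add: algebra_simps)
        then have "\<psi> (forward x, Z x) = (norm ((1 / \<eta>) *\<^sub>R (x - Z x) + (gradH x - gradH (Z x))))\<^sup>2"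
          by (simp only: \<psi>_def fst_conv snd_conv)
        also have "\<dots> \<le> 2 * (norm ((1 / \<eta>) *\<^sub>R (x - Z x)))\<^sup>2 + 2 * (norm (gradH x - gradH (Z x)))\<^sup>2"
          by (rule norm_add_sq_le)
        also have "(norm (gradH x - gradH (Z x)))\<^sup>2 \<le> (L * norm (x - Z x))\<^sup>2"
          by (intro power_mono grad_diff_le) simp
        finally have "\<psi> (forward x, Z x) \<le> 2 * ((norm (x - Z x))\<^sup>2 / \<eta>\<^sup>2) + 2 * (L\<^sup>2 * (norm (x - Z x))\<^sup>2)"
          by (simp add: power_mult_distrib power_divide)
        also have "\<dots> = 2 * (\<eta>\<^sup>2 * L\<^sup>2 + 1) / \<eta>\<^sup>2 * (norm (x - Z x))\<^sup>2"
          using \<eta> by (simp add: field_simps)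
        finally show ?thesis .
      qed
      then show "AE x in \<mu>. \<psi> (forward x, Z x) \<le> 2 * (\<eta>\<^sup>2 * L\<^sup>2 + 1) / \<eta>\<^sup>2 * (norm (x - Z x))\<^sup>2" by simp
    qed
    also have "\<dots> = 2 * (\<eta>\<^sup>2 * L\<^sup>2 + 1) / \<eta>\<^sup>2 * D" by (simp add: D_def)
    finally show ?thesis .
  qed
  also have "\<dots> = 2 * (\<eta>\<^sup>2 * L\<^sup>2 + 1) / \<eta> * (D / \<eta>)" using \<eta> by (simp add: power2_eq_square)
  also have "\<dots> \<le> 2 * (\<eta>\<^sup>2 * L\<^sup>2 + 1) / \<eta> *
      ((a + potential G \<mu> - potential H \<mu>) - (b + potential G m - potential H m))"
    using \<eta> by (intro mult_left_mono descent) (auto intro!: divide_nonneg_nonneg)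
  finally show ?thesis using b ma \<xi> by blast
qed

end

section \<open>Rates from a power-law recursion\<close>

context
  fixes a :: "nat \<Rightarrow> real" and M \<theta> :: real
  assumes nonneg: "\<And>n. 0 \<le> a n" and M: "0 < M"
    and step: "\<And>n. a (Suc n) powr (2 * \<theta>) \<le> M * (a n - a (Suc n))"
begin

lemma loja_decreasing: "a (Suc n) \<le> a n"
proof -
  have "0 \<le> M * (a n - a (Suc n))" using step[of n] powr_ge_zero order_trans by blast
  then show ?thesis using M by (simp add: zero_le_mult_iff)
qed

lemma loja_antimono: "m \<le> n \<Longrightarrow> a n \<le> a m"
  by (rule lift_Suc_antimono_le[of a]) (auto intro: loja_decreasing)

text \<open>For \<open>\<theta> = 0\<close> the left-hand side of the recursion is \<open>1\<close> as long as the gap is positive, so each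
  step gains at least \<open>1 / M\<close>.\<close>
lemma loja_finite_steps:
  assumes "\<theta> = 0"
  shows "\<exists>N. \<forall>n\<ge>N. a n = 0"
proof (rule ccontr)
  assume *: "\<not> ?thesis"
  have pos: "0 < a n" for n
  proof -
    obtain m where "n \<le> m" "a m \<noteq> 0" using * by blast
    then show ?thesis using loja_antimono[of n m] nonneg[of m] by linarith
  qed
  have "a n \<le> a 0 - n / M" for n
  proof (induction n)
    case (Suc n)
    have "1 \<le> M * (a n - a (Suc n))" using step[of n] pos[of "Suc n"] assms by simp
    then have "1 / M \<le> a n - a (Suc n)" using M by (simp add: field_simps)
    then show ?case using Suc by (simp add: add_divide_distrib)
  qed simp
  moreover obtain n :: nat where "a 0 * M < n" using reals_Archimedean2 by blast
  ultimately show False using pos[of n] M by (smt (verit) pos_less_divide_eq)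
qed

lemma loja_tendsto_0:
  assumes "0 < \<theta>"
  shows "a \<longlonglongrightarrow> 0"
proof -
  have "decseq a" unfolding decseq_def using loja_antimono by blast
  then obtain l where l: "a \<longlonglongrightarrow> l"
    using decseq_convergent[of a 0] nonneg by metis
  have "(\<lambda>n. M * (a n - a (Suc n))) \<longlonglongrightarrow> M * (l - l)"
    by (intro tendsto_intros l LIMSEQ_Suc)
  then have *: "(\<lambda>n. M * (a n - a (Suc n))) \<longlonglongrightarrow> 0" by simp
  have "(\<lambda>n. a (Suc n) powr (2 * \<theta>)) \<longlonglongrightarrow> 0"
    by (rule real_tendsto_sandwich[OF _ _ tendsto_const *]) (auto intro!: always_eventually step)
  then have "(\<lambda>n. (a (Suc n) powr (2 * \<theta>)) powr (1 / (2 * \<theta>))) \<longlonglongrightarrow> 0 powr (1 / (2 * \<theta>))"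
    using assms by (intro tendsto_powr' tendsto_const) auto
  moreover have "(a (Suc n) powr (2 * \<theta>)) powr (1 / (2 * \<theta>)) = a (Suc n)" for n
    using assms nonneg[of "Suc n"] by (simp only: powr_powr) simp
  ultimately have "(\<lambda>n. a (Suc n)) \<longlonglongrightarrow> 0" by simp
  then show ?thesis by (rule LIMSEQ_imp_Suc)
qed

text \<open>As the gap tends to \<open>0\<close>, it is eventually below \<open>1\<close>, where \<open>2 \<theta> \<le> 1\<close> makes the power at least
  the gap itself. The recursion then becomes a contraction by \<open>M / (M + 1)\<close>.\<close>
lemma loja_linear:
  assumes "0 < \<theta>" "\<theta> \<le> 1 / 2"
  shows "a \<in> O(\<lambda>n. (M / (M + 1)) ^ n)"
proof -
  define q where "q = M / (M + 1)"
  have q: "0 < q" using M by (simp add: q_def)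
  have "eventually (\<lambda>n. a n < 1) sequentially"
    using loja_tendsto_0[OF assms(1)] by (rule order_tendstoD) simp
  then obtain N where N: "\<And>n. N \<le> n \<Longrightarrow> a n < 1" by (auto simp: eventually_sequentially)
  have contr: "a (Suc n) \<le> q * a n" if "N \<le> n" for n
  proof -
    have "a (Suc n) \<le> a (Suc n) powr (2 * \<theta>)"
    proof (cases "a (Suc n) = 0")
      case False
      then have "a (Suc n) powr 1 \<le> a (Suc n) powr (2 * \<theta>)"
        using N[of "Suc n"] nonneg[of "Suc n"] that assms by (intro powr_mono') auto
      then show ?thesis using nonneg[of "Suc n"] by simp
    qed simp
    then have "a (Suc n) * (M + 1) \<le> M * a n" using step[of n] by (simp add: algebra_simps)
    then show ?thesis using M by (simp add: q_def field_simps)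
  qed
  have bound: "a (N + k) \<le> a N * q ^ k" for k
  proof (induction k)
    case (Suc k)
    have "a (N + Suc k) \<le> q * a (N + k)" using contr[of "N + k"] by simp
    also have "\<dots> \<le> q * (a N * q ^ k)" by (rule mult_left_mono[OF Suc]) (use q in simp)
    finally show ?case by (simp add: mult_ac)
  qed simp
  have "norm (a n) \<le> (a N / q ^ N) * norm (q ^ n)" if "N \<le> n" for n
  proof -
    obtain k where k: "n = N + k" using \<open>N \<le> n\<close> le_Suc_ex by blast
    have "(a N / q ^ N) * q ^ n = a N * q ^ k"
using q by (simp add: k power_add)
    moreover have "norm (a n) = a n" "norm (q ^ n) = q ^ n" using nonneg q by simp_all
    ultimately show ?thesis using bound[of k] k by simp
  qed
  then show ?thesis
    unfolding q_def[symmetric] by (intro bigoI[where c = "a N / q ^ N"] eventually_sequentiallyI[of N]) auto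
qed

text \<open>With \<open>p = 2 \<theta> - 1\<close>, the sequence \<open>a n powr - p\<close> grows at least linearly. If \<open>a\<close> at most halves
  in a step, the tangent of \<open>x powr - p\<close> and the recursion give a fixed increment. If it drops below
  half, \<open>a n powr - p\<close> grows by the factor \<open>2 powr p\<close>, again at least a fixed increment.\<close>
lemma loja_sublinear:
  assumes "1 / 2 < \<theta>"
  shows "a \<in> O(\<lambda>n. real n powr (- (1 / (2 * \<theta> - 1))))"
proof (cases "\<exists>N. a N = 0")
  case True
  then obtain N where "a N = 0" by blast
  then have "a n = 0" if "N \<le> n" for n using loja_antimono[OF that] nonneg[of n] by simp
  then show ?thesis by (intro bigoI[where c = 1] eventually_sequentiallyI[of N]) auto
next
  case False
  then have pos: "0 < a n" for n using nonneg[of n] by (metis less_eq_real_def)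
  define p where "p = 2 * \<theta> - 1"
  have p: "0 < p" using assms by (simp add: p_def)
  \<comment> \<open>The two entries are the increments of \<open>a n powr - p\<close> in the two cases.\<close>
  define \<kappa> where "\<kappa> = min (p / (2 powr (1 + p) * M)) ((2 powr p - 1) * a 0 powr - p)"
  have \<kappa>: "0 < \<kappa>" using p M pos[of 0] by (simp add: \<kappa>_def)
  have incr: "a n powr - p + \<kappa> \<le> a (Suc n) powr - p" for n
  proof (cases "a n \<le> 2 * a (Suc n)")
    case True
    have tangent: "y powr - p \<ge> x powr - p + p * x powr (- p - 1) * (x - y)" if "0 < x" "0 < y" for x y :: real
    proof -
      define z where "z = y / x"
      have z: "0 < z" "y = z * x" using that by (simp_all add: z_def)
      have "p * ln z \<le> p * (z - 1)" using ln_le_minus_one[OF z(1)] p by (intro mult_left_mono) auto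
      then have "1 + p * (1 - z) \<le> 1 + - p * ln z" unfolding right_diff_distrib by simp
      also have "\<dots> \<le> z powr - p"
        using exp_ge_add_one_self[of "- p * ln z"] z(1) by (simp only: powr_def) simp
      finally have "x powr - p * (1 + p * (1 - z)) \<le> x powr - p * z powr - p"
        by (rule mult_left_mono) simp
      moreover have "z powr - p * x powr - p = y powr - p" unfolding z(2) by (rule powr_mult[symmetric])
      moreover have "x powr (- p - 1) * x = x powr - p"
        using that powr_mult_base[of x "- p - 1"] by (simp add: mult.commute)
      moreover have "x powr - p * (1 + p * (1 - z)) = x powr - p + p * (x powr - p * (1 - z))"
        by (simp add: algebra_simps)
      moreover have "p * x powr (- p - 1) * (x - y) = p * (x powr (- p - 1) * x * (1 - z))"
        by (simp only: z(2)) (simp add: algebra_simps)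
      ultimately show ?thesis by (simp only: mult.commute)
    qed
    have "p / (2 powr (1 + p) * M) \<le> p * a n powr (- p - 1) * (a n - a (Suc n))"
    proof -
      have "(a n / 2) powr (1 + p) \<le> a (Suc n) powr (1 + p)"
        using True pos[of n] p by (intro powr_mono2) auto
      also have "\<dots> \<le> M * (a n - a (Suc n))" using step[of n] by (simp add: p_def)
      finally have *: "a n powr (1 + p) / 2 powr (1 + p) \<le> M * (a n - a (Suc n))"
        using pos[of n] by (simp add: powr_divide)
      have "p / (2 powr (1 + p) * M) = (p * a n powr (- p - 1) / M) * (a n powr (1 + p) / 2 powr (1 + p))"
        using pos[of n] powr_add[of "a n" "- p - 1" "1 + p"] by (simp add: mult.assoc)
      also have "\<dots> \<le> (p * a n powr (- p - 1) / M) * (M * (a n - a (Suc n)))"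
        by (rule mult_left_mono[OF *]) (use p M in simp)
      finally show ?thesis using M by simp
    qed
    moreover have "\<kappa> \<le> p / (2 powr (1 + p) * M)" by (simp add: \<kappa>_def)
    ultimately show ?thesis using tangent[OF pos[of n] pos[of "Suc n"]] by linarith
  next
    case False
    have "(2 powr p - 1) * a 0 powr - p \<le> (2 powr p - 1) * a n powr - p"
      using p pos[of 0] pos[of n] loja_antimono[of 0 n]
      by (intro mult_left_mono powr_mono2') (auto simp: ge_one_powr_ge_zero)
    moreover have "(a n / 2) powr - p \<le> a (Suc n) powr - p"
      using False p pos[of "Suc n"] by (intro powr_mono2') auto
    moreover have "(a n / 2) powr - p = 2 powr p * a n powr - p"
      using pos[of n] powr_divide[of "a n" 2 "- p"] powr_minus_divide[of 2 p] by simp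
    moreover have "\<kappa> \<le> (2 powr p - 1) * a 0 powr - p" by (simp add: \<kappa>_def)
    ultimately show ?thesis unfolding left_diff_distrib by linarith
  qed
  have lin: "real n * \<kappa> \<le> a n powr - p" for n
  proof (induction n)
    case (Suc n)
    then show ?case using incr[of n] by (simp add: algebra_simps)
  qed simp
  have "norm (a n) \<le> \<kappa> powr (- (1 / p)) * norm (real n powr (- (1 / p)))" if "1 \<le> n" for n
  proof -
    have "(a n powr - p) powr (- (1 / p)) \<le> (real n * \<kappa>) powr (- (1 / p))"
      using lin[of n] that \<kappa> p by (intro powr_mono2') auto
    moreover have "(a n powr - p) powr (- (1 / p)) = a n"
      using p pos[of n] by (simp only: powr_powr) simp
    moreover have "(real n * \<kappa>) powr (- (1 / p)) = \<kappa> powr (- (1 / p)) * real n powr (- (1 / p))"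
      using \<kappa> by (simp add: powr_mult)
    ultimately show ?thesis using pos[of n] by simp
  qed
  then have "a \<in> O(\<lambda>n. real n powr (- (1 / p)))"
    by (intro bigoI eventually_sequentiallyI)
  then show ?thesis by (simp add: p_def)
qed

end

section \<open>Convergence of the scheme\<close>

theorem theorem4:
  fixes \<H> :: "'a::euclidean_space measure \<Rightarrow> ereal"
    and G H :: "'a \<Rightarrow> real"
    and gradH :: "'a \<Rightarrow> 'a"
    and \<eta>\<^sub>0 \<eta> L\<^sub>H c \<theta> :: real
    and r\<^sub>0 :: ereal
    and \<mu> \<nu> :: "nat \<Rightarrow> 'a measure"
  assumes "bounded_below_fun (objective \<H> G H)"
    and "convex_on UNIV G" "quadratic_growth G"
    and "convex_on UNIV H" "quadratic_growth H"
    and "never_minf \<H>" "proper_fun \<H>" "lsc_W2 \<H>" "gen_geodesically_convex \<H>"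
    and "dom_fun \<H> \<subseteq> P2_abs"
    and "0 < \<eta>\<^sub>0"
    and "\<And>\<tau> \<rho>. 0 < \<tau> \<Longrightarrow> \<tau> < \<eta>\<^sub>0 \<Longrightarrow> \<rho> \<in> P2 \<Longrightarrow>
           jko \<tau> (\<lambda>\<sigma>. ereal (potential G \<sigma>) + \<H> \<sigma>) \<rho> \<noteq> {}"
    and "C2_bounded_hessian H gradH"
    and "L\<^sub>H-lipschitz_on UNIV gradH"
    and "lojasiewicz (objective \<H> G H) r\<^sub>0 c \<theta>"
    and "0 < \<eta>" "\<eta> < \<eta>\<^sub>0"
    and "\<mu> 0 \<in> P2_abs"
    and "objective \<H> G H (\<mu> 0) - optval (objective \<H> G H) < r\<^sub>0"
    and "\<And>n. \<nu> (Suc n) = distr (\<mu> n) borel (\<lambda>x. x + \<eta> *\<^sub>R gradH x)"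
    and "\<And>n. \<mu> (Suc n) \<in> jko \<eta> (\<lambda>\<sigma>. ereal (potential G \<sigma>) + \<H> \<sigma>) (\<nu> (Suc n))"
  shows "\<exists>gap :: nat \<Rightarrow> real.
           (\<forall>n. objective \<H> G H (\<mu> n) - optval (objective \<H> G H) = ereal (gap n)) \<and>
           (\<theta> = 0 \<longrightarrow> (\<exists>N. \<forall>n\<ge>N. gap n = 0)) \<and>
           (0 < \<theta> \<and> \<theta> \<le> 1 / 2 \<longrightarrow>
              (let M = 2 * (\<eta>\<^sup>2 * L\<^sub>H\<^sup>2 + 1) / (c\<^sup>2 * \<eta>)
               in gap \<in> O(\<lambda>n. (M / (M + 1)) ^ n))) \<and>
           (1 / 2 < \<theta> \<and> \<theta> < 1 \<longrightarrow>
              gap \<in> O(\<lambda>n. real n powr (- (1 / (2 * \<theta> - 1)))))"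
proof -
  let ?F = "objective \<H> G H"
  define F where "F \<sigma> = real_of_ereal (\<H> \<sigma>) + potential G \<sigma> - potential H \<sigma>" for \<sigma>
  have H_grad: "\<And>x. GDERIV H x :> gradH x" using assms(13) by (simp add: C2_bounded_hessian_def)
  have F_eq: "?F \<sigma> = ereal (F \<sigma>)" if "\<bar>\<H> \<sigma>\<bar> \<noteq> \<infinity>" for \<sigma>
    using that by (auto simp: objective_def F_def)
  obtain Fs where Fs: "optval ?F = ereal Fs"
  proof -
    obtain b where b: "\<And>\<sigma>. \<sigma> \<in> P2 \<Longrightarrow> ereal b \<le> ?F \<sigma>" using assms(1) by (auto simp: bounded_below_fun_def)
    obtain \<sigma> where \<sigma>: "\<sigma> \<in> P2" "\<H> \<sigma> < \<infinity>" using assms(7) by (auto simp: proper_fun_def dom_fun_def)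
    then have "\<bar>\<H> \<sigma>\<bar> \<noteq> \<infinity>" using assms(6) by (auto simp: never_minf_def)
    then have "optval ?F \<le> ereal (F \<sigma>)"
      unfolding optval_def using INF_lower[OF \<sigma>(1), of ?F] F_eq by simp
    moreover have "ereal b \<le> optval ?F" unfolding optval_def using b by (intro INF_greatest)
    ultimately show ?thesis using that by (cases "optval ?F") auto
  qed
  define gap where "gap n = F (\<mu> n) - Fs" for n
  have \<mu>0: "\<bar>\<H> (\<mu> 0)\<bar> \<noteq> \<infinity>"
  proof -
    have "\<mu> 0 \<in> P2" using assms(18) by (simp add: P2_abs_def)
    moreover have "\<H> (\<mu> 0) \<noteq> \<infinity>" using assms(19) Fs by (auto simp: objective_def)
    ultimately show ?thesis using assms(6) by (auto simp: never_minf_def)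
  qed
  note step = semi_fb_step[OF assms(2,3,4,5) H_grad assms(14,16,6,7,9,10)]
  have jko: "\<mu> (Suc n) \<in> jko \<eta> (\<lambda>\<sigma>. ereal (potential G \<sigma>) + \<H> \<sigma>) (distr (\<mu> n) borel (\<lambda>x. x + \<eta> *\<^sub>R gradH x))" for n
    using assms(21)[of n] unfolding assms(20) .
  have inv: "\<mu> n \<in> P2_abs \<and> \<bar>\<H> (\<mu> n)\<bar> \<noteq> \<infinity>" for n
  proof (induction n)
    case 0
    show ?case using assms(18) \<mu>0 by simp
  next
    case (Suc n)
    then obtain a where "\<H> (\<mu> n) = ereal a" by (cases "\<H> (\<mu> n)") auto
    from step[OF conjunct1[OF Suc] this jko] show ?case by auto
  qed
  have P2: "\<mu> n \<in> P2" for n using inv[of n] by (simp add: P2_abs_def)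
  have gap_eq: "?F (\<mu> n) - optval ?F = ereal (gap n)" for n
    using F_eq[OF conjunct2[OF inv]] by (simp add: Fs gap_def)
  have gap_nonneg: "0 \<le> gap n" for n
  proof -
    have "optval ?F \<le> ?F (\<mu> n)" unfolding optval_def by (rule INF_lower[OF P2])
    then show ?thesis using F_eq[OF conjunct2[OF inv]] by (simp add: Fs gap_def)
  qed
  define k where "k = 2 * (\<eta>\<^sup>2 * L\<^sub>H\<^sup>2 + 1) / \<eta>"
  have k: "0 < k" unfolding k_def using assms(16) by (intro divide_pos_pos mult_pos_pos add_nonneg_pos) auto
  have c: "0 < c" and \<theta>: "0 \<le> \<theta>" using assms(15) by (auto simp: lojasiewicz_def)
  have sub: "\<exists>\<xi> \<in> frechet_subdiff ?F (\<mu> (Suc n)). (L2_norm_wrt (\<mu> (Suc n)) \<xi>)\<^sup>2 \<le> k * (gap n - gap (Suc n))" for n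
  proof -
    obtain a where a: "\<H> (\<mu> n) = ereal a" using inv[of n] by (cases "\<H> (\<mu> n)") auto
    from step[OF conjunct1[OF inv] a jko] obtain b \<xi>
      where b: "\<H> (\<mu> (Suc n)) = ereal b" and \<xi>: "\<xi> \<in> frechet_subdiff ?F (\<mu> (Suc n))"
        and le: "(L2_norm_wrt (\<mu> (Suc n)) \<xi>)\<^sup>2 \<le> k * ((a + potential G (\<mu> n) - potential H (\<mu> n))
          - (b + potential G (\<mu> (Suc n)) - potential H (\<mu> (Suc n))))"
      unfolding k_def by blast
    have "gap n - gap (Suc n) = (a + potential G (\<mu> n) - potential H (\<mu> n))
        - (b + potential G (\<mu> (Suc n)) - potential H (\<mu> (Suc n)))"
      by (simp add: gap_def F_def a b)
    then show ?thesis using \<xi> le by (intro bexI[of _ \<xi>]) simp_all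
  qed
  have decr: "gap (Suc n) \<le> gap n" for n
  proof -
    have "0 \<le> k * (gap n - gap (Suc n))" using sub[of n] zero_le_power2 order_trans by blast
    then show ?thesis using k by (simp add: zero_le_mult_iff)
  qed
  have below: "ereal (gap n) < r\<^sub>0" for n
  proof (induction n)
    case 0
    then show ?case using assms(19) by (simp add: gap_eq)
  next
    case (Suc n)
    then show ?case using decr[of n] order.strict_trans1[of "ereal (gap (Suc n))" "ereal (gap n)" r\<^sub>0] by simp
  qed
  define M where "M = 2 * (\<eta>\<^sup>2 * L\<^sub>H\<^sup>2 + 1) / (c\<^sup>2 * \<eta>)"
  have M_eq: "M = k / c\<^sup>2" by (simp add: M_def k_def)
  have M: "0 < M" using k c by (simp add: M_eq)
  have rec: "gap (Suc n) powr (2 * \<theta>) \<le> M * (gap n - gap (Suc n))" for n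
  proof -
    obtain \<xi> where \<xi>: "\<xi> \<in> frechet_subdiff ?F (\<mu> (Suc n))" "(L2_norm_wrt (\<mu> (Suc n)) \<xi>)\<^sup>2 \<le> k * (gap n - gap (Suc n))"
      using sub by blast
    have "ereal (c * gap (Suc n) powr \<theta>) \<le> (INF \<xi> \<in> frechet_subdiff ?F (\<mu> (Suc n)). ereal (L2_norm_wrt (\<mu> (Suc n)) \<xi>))"
      using assms(15) P2[of "Suc n"] below[of "Suc n"] gap_eq[of "Suc n"] by (auto simp: lojasiewicz_def)
    also have "\<dots> \<le> ereal (L2_norm_wrt (\<mu> (Suc n)) \<xi>)" by (rule INF_lower[OF \<xi>(1)])
    finally have "c * gap (Suc n) powr \<theta> \<le> L2_norm_wrt (\<mu> (Suc n)) \<xi>" by simp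
    then have "(c * gap (Suc n) powr \<theta>)\<^sup>2 \<le> (L2_norm_wrt (\<mu> (Suc n)) \<xi>)\<^sup>2"
      using c by (intro power_mono) auto
    also note \<xi>(2)
    also have "(c * gap (Suc n) powr \<theta>)\<^sup>2 = c\<^sup>2 * gap (Suc n) powr (2 * \<theta>)"
      by (simp add: power_mult_distrib power2_eq_square powr_add[symmetric])
    finally show ?thesis using c by (simp add: M_eq field_simps)
  qed
  note rates = loja_finite_steps[of gap M \<theta>, OF gap_nonneg M rec] loja_linear[of gap M \<theta>, OF gap_nonneg M rec] loja_sublinear[of gap M \<theta>, OF gap_nonneg M rec]
  show ?thesis
  proof (intro exI[of _ gap] conjI allI impI)
    show "?F (\<mu> n) - optval ?F = ereal (gap n)" for n by (rule gap_eq)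
    show "\<exists>N. \<forall>n\<ge>N. gap n = 0" if "\<theta> = 0" by (rule rates(1)[OF that])
    show "let M = 2 * (\<eta>\<^sup>2 * L\<^sub>H\<^sup>2 + 1) / (c\<^sup>2 * \<eta>) in gap \<in> O(\<lambda>n. (M / (M + 1)) ^ n)" if "0 < \<theta> \<and> \<theta> \<le> 1 / 2"
      using rates(2) that by (simp add: M_def Let_def)
    show "gap \<in> O(\<lambda>n. real n powr (- (1 / (2 * \<theta> - 1))))" if "1 / 2 < \<theta> \<and> \<theta> < 1"
      using rates(3) that by blast
  qed
qed

end
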